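(* Every countably dimensional metrizable locally convex space $E$ possesses a hypercyclic operator, i.e. there exist a continuous linear operator $T:E\to E$ and $x\in E$ such that $\{T^nx:n\in\mathbb{Z}_+\}$ is dense in $E$.
   Context: Spaces are Hausdorff, over $\mathbb{K}\in\{\mathbb{R},\mathbb{C}\}$. Countably dimensional means having a countably infinite Hamel basis. *)

theory Defs
  imports "HOL-Analysis.Analysis"
begin

text \<open>A Hausdorff topological vector space over a scalar field 'k (here used with
  'k = real or 'k = complex), given by an abstract scalar multiplication
  sc on a type 'a whose (type-class) topology is the topology of the space.\<close>

definition is_tvs :: "('k::real_normed_field \<Rightarrow> 'a::{ab_group_add,t2_space} \<Rightarrow> 'a) \<Rightarrow> bool" where
  "is_tvs sc \<longleftrightarrow> Vector_Spaces.vector_space sc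
     \<and> continuous_on UNIV (\<lambda>p::'a \<times> 'a. fst p + snd p)
     \<and> continuous_on UNIV (\<lambda>p::'k \<times> 'a. sc (fst p) (snd p))"

definition convex_wrt :: "('k::real_normed_field \<Rightarrow> 'a::ab_group_add \<Rightarrow> 'a) \<Rightarrow> 'a set \<Rightarrow> bool" where
  "convex_wrt sc V \<longleftrightarrow> (\<forall>x\<in>V. \<forall>y\<in>V. \<forall>t::real. 0 \<le> t \<and> t \<le> 1 \<longrightarrow>
       sc (of_real t) x + sc (of_real (1 - t)) y \<in> V)"

definition locally_convex :: "('k::real_normed_field \<Rightarrow> 'a::{ab_group_add,t2_space} \<Rightarrow> 'a) \<Rightarrow> bool" where
  "locally_convex sc \<longleftrightarrow> is_tvs sc \<and>
     (\<forall>U. open U \<and> 0 \<in> U \<longrightarrow> (\<exists>V. open V \<and> 0 \<in> V \<and> convex_wrt sc V \<and> V \<subseteq> U))"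

definition countably_dimensional :: "('k::real_normed_field \<Rightarrow> 'a::ab_group_add \<Rightarrow> 'a) \<Rightarrow> bool" where
  "countably_dimensional sc \<longleftrightarrow> (\<exists>B. countable B \<and> infinite B \<and>
     \<not> module.dependent sc B \<and> module.span sc B = UNIV)"

definition hypercyclic :: "('k::real_normed_field \<Rightarrow> 'a::{ab_group_add,topological_space} \<Rightarrow> 'a) \<Rightarrow> ('a \<Rightarrow> 'a) \<Rightarrow> bool" where
  "hypercyclic sc T \<longleftrightarrow> Vector_Spaces.linear sc sc T \<and> continuous_on UNIV T \<and>
     (\<exists>x. closure (range (\<lambda>n. (T ^^ n) x)) = UNIV)"

end

theory Submission
  imports Defs
begin

text \<open>
  The topology is given by an increasing sequence of seminorms \<open>p\<^sub>k\<close>, and two cases arise.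

  If some \<open>p = p\<^sub>K\<close> has infinite rank, i.e. \<open>E / ker p\<close> is infinite-dimensional, then
  Gram--Schmidt yields biorthogonal sequences \<open>e\<^sub>n\<close> in \<open>E\<close> and \<open>g\<^sub>n\<close> in \<open>E'\<close> such that the
  \<open>g\<^sub>n\<close> are dominated by \<open>p\<close>, the span of the \<open>e\<^sub>n\<close> is dense, and every \<open>g\<^sub>n x\<close> vanishes for large
  \<open>n\<close>. This transports the problem to finitely supported sequences in \<open>\<ell>\<^sup>1\<close>. On \<open>\<ell>\<^sup>1\<close>,
  translation of polynomials in suitably weighted coordinates is a hypercyclic operator of the
  form identity plus an arbitrarily small perturbation. The span of one of its dense orbits and the
  finitely supported sequences are two dense subspaces of countable dimension, and a back-and-forth
  construction in the style of Grivaux gives an isomorphism between them that is close enough to the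
  identity for the conjugated operator to remain a small perturbation of the identity.

  If all \<open>p\<^sub>k\<close> have finite rank, \<open>E\<close> is a dense subspace of \<open>\<omega>\<close>. All such subspaces of countable
  dimension are isomorphic, since they have Hamel bases with a continuous dual basis, and one of them
  is the span of the orbit of a hypercyclic vector of the backward shift on \<open>\<omega>\<close>.
\<close>

section \<open>Sublinear functionals and the Hahn--Banach theorem\<close>

text \<open>A Hausdorff space of countably infinite dimension is never a Baire space, so no category
  argument can be run on \<open>E\<close> itself. In the infinite rank case, moreover, the
  functionals \<open>g n\<close> have uncontrolled size and the \<open>e n\<close> need not span
  \<open>E\<close>. Both defects are bypassed by the formula \<open>T = I + J (S - I) c\<close>,
  where \<open>c\<close> reads off coordinates and \<open>J\<close> expands them. Since
  \<open>p n (e n) \<le> 1\<close>, the map \<open>J\<close> is continuous for the norm of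
  \<open>l1\<close>, but \<open>c\<close> is continuous only into a weighted, weaker norm. Hence
  \<open>S - I\<close> must be bounded from the weak norm into the strong one, and conjugation must
  preserve this. That is why the isomorphism between the dense subspaces is estimated from above in
  the norm and from below in the weak norm. Finite support of every \<open>c x\<close> lets
  \<open>J\<close> do without completeness. If all seminorms have finite rank, no single one
  dominates an infinite biorthogonal sequence, so this scheme fails. In exchange each seminorm
  vanishes on all but finitely many vectors of a suitable basis, and maps that match coordinates are
  automatically continuous.\<close>

lemma linear_functionalI:
  fixes f :: "'a::ab_group_add \<Rightarrow> 'k::field"
  assumes "vector_space sc" "\<And>x y. f (x + y) = f x + f y" "\<And>c x. f (sc c x) = c * f x"
  shows "Vector_Spaces.linear sc (*) f"
  using assms by (simp add: Vector_Spaces.linear_iff vector_space_over_itself.vector_space_axioms)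

lemma linear_space: "Vector_Spaces.linear s1 s2 f \<Longrightarrow> vector_space s1"
  by (simp add: Vector_Spaces.linear_iff)

lemma linear_module_hom: "Vector_Spaces.linear s1 s2 f \<Longrightarrow> module_hom s1 s2 f"
  by (simp add: module_hom_iff_linear)

lemmas lin_add = module_hom.add[OF linear_module_hom]
  and lin_scale = module_hom.scale[OF linear_module_hom]
  and lin_diff = module_hom.diff[OF linear_module_hom]
  and lin_zero = module_hom.zero[OF linear_module_hom]
  and lin_neg = module_hom.neg[OF linear_module_hom]
  and lin_sum = module_hom.sum[OF linear_module_hom]

definition seminorm :: "('k::real_normed_field \<Rightarrow> 'a::ab_group_add \<Rightarrow> 'a) \<Rightarrow> ('a \<Rightarrow> real) \<Rightarrow> bool" where
  "seminorm sc p \<longleftrightarrow> vector_space sc \<and> (\<forall>x y. p (x + y) \<le> p x + p y) \<and> (\<forall>c x. p (sc c x) = norm c * p x)"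

definition dominated :: "('k::real_normed_field \<Rightarrow> 'a::ab_group_add \<Rightarrow> 'a) \<Rightarrow> ('a \<Rightarrow> real) \<Rightarrow> ('a \<Rightarrow> 'k) \<Rightarrow> bool" where
  "dominated sc p f \<longleftrightarrow> Vector_Spaces.linear sc (*) f \<and> (\<exists>C. \<forall>x. norm (f x) \<le> C * p x)"

context
  fixes sc :: "'k::real_normed_field \<Rightarrow> 'a::ab_group_add \<Rightarrow> 'a" and p
  assumes sn: "seminorm sc p"
begin

interpretation vector_space sc using sn by (simp add: seminorm_def)

lemma seminorm_space: "vector_space sc" by (rule vector_space_axioms)

lemma seminorm_triangle: "p (x + y) \<le> p x + p y" using sn by (simp add: seminorm_def)

lemma seminorm_scale: "p (sc c x) = norm c * p x" using sn by (simp add: seminorm_def)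

lemma seminorm_zero: "p 0 = 0" using seminorm_scale[of 0 0] by simp

lemma seminorm_minus: "p (- x) = p x" using seminorm_scale[of "-1" x] by simp

lemma seminorm_nonneg: "0 \<le> p x"
  using seminorm_triangle[of x "-x"] by (simp add: seminorm_minus seminorm_zero)

lemma seminorm_diff: "p (x - y) \<le> p x + p y"
  using seminorm_triangle[of x "-y"] by (simp add: seminorm_minus)

lemma seminorm_diff_commute: "p (x - y) = p (y - x)"
  using seminorm_minus[of "x - y"] by simp

lemma seminorm_triangle_sub: "p (x - z) \<le> p (x - y) + p (y - z)"
  using seminorm_triangle[of "x - y" "y - z"] by simp

lemma seminorm_sum: "p (\<Sum>i\<in>I. f i) \<le> (\<Sum>i\<in>I. p (f i))"
proof (induction I rule: infinite_finite_induct)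
  case (insert x F)
  then show ?case using seminorm_triangle[of "f x" "sum f F"] by simp
qed (simp_all add: seminorm_zero)

lemma dominatedE:
  assumes "dominated sc p f"
  obtains C where "C > 0" "\<And>x. norm (f x) \<le> C * p x"
proof -
  obtain C where C: "\<And>x. norm (f x) \<le> C * p x" using assms by (auto simp: dominated_def)
  have "norm (f x) \<le> (\<bar>C\<bar> + 1) * p x" for x
    using C[of x] seminorm_nonneg[of x] mult_right_mono[of C "\<bar>C\<bar> + 1" "p x"] by linarith
  then show ?thesis using that[of "\<bar>C\<bar> + 1"] by auto
qed

end

text \<open>Minimal sublinear functionals are linear; this gives the Hahn--Banach theorem by
  Zorn's lemma without extending functionals from subspaces.\<close>

definition sublinear :: "(real \<Rightarrow> 'a::ab_group_add \<Rightarrow> 'a) \<Rightarrow> ('a \<Rightarrow> real) \<Rightarrow> bool" where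
  "sublinear sc q \<longleftrightarrow> (\<forall>x y. q (x + y) \<le> q x + q y) \<and> (\<forall>t x. 0 \<le> t \<longrightarrow> q (sc t x) = t * q x)"

lemma sublinear_lower_bound:
  assumes "vector_space sc" "sublinear sc q"
  shows "- q (- x) \<le> q x"
proof -
  interpret vector_space sc by fact
  have "q 0 = 0" using assms(2) unfolding sublinear_def by (metis mult_zero_left order_refl scale_zero_left)
  moreover have "q (x + - x) \<le> q x + q (- x)" using assms(2) by (simp only: sublinear_def)
  ultimately show ?thesis by simp
qed

text \<open>One lemma covers both infima taken below, over the shifts along a vector and over a
  chain of functionals. Homogeneity is asked only as an inequality for \<open>t > 0\<close>; the
  reverse one follows by applying it to \<open>1/t\<close>.\<close>

lemma sublinear_Inf:
  assumes vs: "vector_space sc" and ne: "I \<noteq> {}"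
    and lb: "\<And>x. bdd_below ((\<lambda>i. F i x) ` I)"
    and add: "\<And>i j x y. i \<in> I \<Longrightarrow> j \<in> I \<Longrightarrow> \<exists>k\<in>I. F k (x + y) \<le> F i x + F j y"
    and hom: "\<And>i t x. i \<in> I \<Longrightarrow> t > 0 \<Longrightarrow> \<exists>k\<in>I. F k (sc t x) \<le> t * F i x"
    and zero: "\<And>i. i \<in> I \<Longrightarrow> F i 0 = 0"
  shows "sublinear sc (\<lambda>x. INF i\<in>I. F i x)" (is "sublinear sc ?G")
proof -
  interpret vector_space sc by fact
  have le: "?G x \<le> F i x" if "i \<in> I" for i x
    using that by (intro cINF_lower lb)
  have greatest: "c \<le> ?G x" if "\<And>i. i \<in> I \<Longrightarrow> c \<le> F i x" for c x
    using that by (intro cINF_greatest ne)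
  have add': "?G (x + y) \<le> ?G x + ?G y" for x y
  proof -
    have "?G (x + y) - F j y \<le> ?G x" if j: "j \<in> I" for j
    proof (rule greatest)
      fix i assume "i \<in> I"
      then obtain k where "k \<in> I" "F k (x + y) \<le> F i x + F j y" using add j by blast
      then show "?G (x + y) - F j y \<le> F i x" using le[of k "x + y"] by linarith
    qed
    then have "?G (x + y) - ?G x \<le> ?G y" by (intro greatest) (simp add: algebra_simps)
    then show ?thesis by simp
  qed
  have hom1: "?G (sc t x) \<le> t * ?G x" if t: "t > 0" for t x
  proof -
    have "?G (sc t x) / t \<le> ?G x"
    proof (rule greatest)
      fix i assume "i \<in> I"
      then obtain k where "k \<in> I" "F k (sc t x) \<le> t * F i x" using hom t by blast
      then have "?G (sc t x) \<le> t * F i x" using le[of k "sc t x"] by linarith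
      then show "?G (sc t x) / t \<le> F i x" using t by (simp add: field_simps)
    qed
    then show ?thesis using t by (simp add: field_simps)
  qed
  have "?G (sc t x) = t * ?G x" if "t \<ge> 0" for t x
  proof (cases "t = 0")
    case True
    have "(\<lambda>i. F i 0) ` I = {0}" using ne zero by (auto simp: image_iff)
    then have "?G 0 = 0" by simp
    then show ?thesis using True by simp
  next
    case False
    then have t: "t > 0" using that by simp
    have "?G (sc (1/t) (sc t x)) \<le> 1/t * ?G (sc t x)" using t by (intro hom1) simp
    then have "t * ?G x \<le> ?G (sc t x)" using t by (simp add: field_simps)
    then show ?thesis using hom1[OF t, of x] by simp
  qed
  then show ?thesis using add' by (simp add: sublinear_def)
qed

text \<open>The witness is the infimum over \<open>t \<ge> 0\<close> of
  \<open>q (x + sc t y) - t * q y\<close>. If \<open>q\<close> is minimal then \<open>r = q\<close>,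
  and the last inequality turns subadditivity into additivity.\<close>

lemma sublinear_shift:
  assumes vs: "vector_space sc" and q: "sublinear sc q"
  obtains r where "sublinear sc r" "\<And>x. r x \<le> q x" "\<And>x. r x \<le> q (x + y) - q y"
proof -
  interpret vector_space sc by fact
  have add: "q (u + v) \<le> q u + q v" and hom: "t \<ge> 0 \<Longrightarrow> q (sc t u) = t * q u" for u v t
    using q by (auto simp: sublinear_def)
  define F where "F t x = q (x + sc t y) - t * q y" for t x
  have lb: "- q (- x) \<le> F t x" if "t \<ge> 0" for t x
    using add[of "x + sc t y" "- x"] hom[OF that, of y] by (simp add: F_def)
  have bdd: "bdd_below ((\<lambda>t. F t x) ` {0..})" for x
    by (rule bdd_belowI2[where m = "- q (- x)"]) (use lb in auto)
  have sub: "sublinear sc (\<lambda>x. INF t\<in>{0..}. F t x)"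
  proof (rule sublinear_Inf[OF vs _ bdd])
    fix s t :: real and u v assume "s \<in> {0..}" "t \<in> {0..}"
    moreover have "F (s + t) (u + v) \<le> F s u + F t v"
      using add[of "u + sc s y" "v + sc t y"] by (simp add: F_def scale_left_distrib algebra_simps)
    ultimately show "\<exists>k\<in>{0..}. F k (u + v) \<le> F s u + F t v" by (intro bexI[of _ "s + t"]) auto
  next
    fix s t :: real and u assume s: "s \<in> {0..}" and t: "t > 0"
    have "F (t * s) (sc t u) = t * F s u"
      using hom[of t "u + sc s y"] t by (simp add: F_def scale_right_distrib algebra_simps)
    then show "\<exists>k\<in>{0..}. F k (sc t u) \<le> t * F s u" using s t by (intro bexI[of _ "t * s"]) auto
  next
    fix s :: real assume "s \<in> {0..}"
    then show "F s 0 = 0" using hom[of s y] by (simp add: F_def)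
  qed auto
  have "(INF t\<in>{0..}. F t x) \<le> F s x" if "s \<ge> 0" for s x
    using that by (intro cINF_lower bdd) auto
  from this[of 0] this[of 1] show ?thesis
    by (intro that[OF sub]) (auto simp: F_def)
qed

lemma exists_minimal_sublinear:
  assumes vs: "vector_space sc" and q: "sublinear sc q"
  obtains m where "sublinear sc m" "\<And>x. m x \<le> q x"
    "\<And>r. sublinear sc r \<Longrightarrow> (\<And>x. r x \<le> m x) \<Longrightarrow> r = m"
proof -
  interpret vector_space sc by fact
  define A where "A = {r. sublinear sc r \<and> (\<forall>x. r x \<le> q x)}"
  \<comment> \<open>The order is reversed, so that a maximal element for Zorn's lemma is a minimal
    functional, and a chain is bounded by its pointwise infimum.\<close>
  define P where "P = (\<lambda>f g. \<forall>x. (g x :: real) \<le> f (x::'a))"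
  have po: "partial_order_on A (relation_of P A)"
    unfolding partial_order_on_def preorder_on_def relation_of_def P_def
    by (auto simp: refl_on_def trans_def antisym_def intro: order_trans) (meson antisym ext)
  have ch: "\<exists>u\<in>A. \<forall>a\<in>C. P a u" if C: "C \<in> Chains (relation_of P A)" for C
  proof (cases "C = {}")
    case True
    then show ?thesis using q by (auto simp: A_def)
  next
    case False
    have CA: "C \<subseteq> A" and tot: "\<And>f g. f \<in> C \<Longrightarrow> g \<in> C \<Longrightarrow> P f g \<or> P g f"
      using C by (auto simp: Chains_def relation_of_def)
    have bdd: "bdd_below ((\<lambda>f. f x) ` C)" for x
    proof (rule bdd_belowI2[where m = "- q (- x)"])
      fix f assume "f \<in> C"
      then have f: "sublinear sc f" "f (- x) \<le> q (- x)" using CA by (auto simp: A_def)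
      show "- q (- x) \<le> f x" using sublinear_lower_bound[OF vs f(1), of x] f(2) by linarith
    qed
    have sl: "f (u + v) \<le> f u + f v" "t \<ge> 0 \<Longrightarrow> f (sc t u) = t * f u" if "f \<in> C" for f u v t
      using that CA by (auto simp: A_def sublinear_def)
    have "sublinear sc (\<lambda>x. INF f\<in>C. f x)"
    proof (rule sublinear_Inf[OF vs False bdd])
      fix f g u v assume fg: "f \<in> C" "g \<in> C"
      from tot[OF fg] show "\<exists>k\<in>C. k (u + v) \<le> f u + g v"
      proof
        assume "P f g"
        then have "g u \<le> f u" by (simp add: P_def)
        then show ?thesis using sl(1)[OF fg(2), of u v] fg by (intro bexI[of _ g]) auto
      next
        assume "P g f"
        then have "f v \<le> g v" by (simp add: P_def)
        then show ?thesis using sl(1)[OF fg(1), of u v] fg by (intro bexI[of _ f]) auto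
      qed
    next
      fix f u and t :: real assume "f \<in> C" "t > 0"
      then show "\<exists>k\<in>C. k (sc t u) \<le> t * f u" using sl(2)[of f t u] by (intro bexI[of _ f]) auto
    next
      fix f assume "f \<in> C"
      then show "f 0 = 0" using sl(2)[of f 0 0] by simp
    qed
    moreover have low: "(INF f\<in>C. f x) \<le> g x" if "g \<in> C" for g x
      using that by (intro cINF_lower bdd)
    moreover have "(INF f\<in>C. f x) \<le> q x" for x
    proof -
      obtain g where "g \<in> C" using False by auto
      then have "g x \<le> q x" using CA by (auto simp: A_def)
      then show ?thesis using low[OF \<open>g \<in> C\<close>, of x] by linarith
    qed
    ultimately show ?thesis by (intro bexI[of _ "\<lambda>x. INF f\<in>C. f x"]) (auto simp: A_def P_def)
  qed
  from predicate_Zorn[OF po ch] obtain m where m: "m \<in> A" "\<And>a. a \<in> A \<Longrightarrow> P m a \<Longrightarrow> a = m"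
    by blast
  show ?thesis
  proof (rule that[of m])
    fix r assume "sublinear sc r" and le: "\<And>x. r x \<le> m x"
    then have "r \<in> A" using m(1) by (force simp: A_def intro: order_trans)
    then show "r = m" using m(2) le by (simp add: P_def)
  qed (use m(1) in \<open>auto simp: A_def\<close>)
qed

section \<open>The Hahn-Banach theorem over the real and the complex numbers\<close>

lemma hahn_banach_real:
  fixes sc :: "real \<Rightarrow> 'a::ab_group_add \<Rightarrow> 'a"
  assumes p: "seminorm sc p"
  obtains f where "Vector_Spaces.linear sc (*) f" "\<And>x. \<bar>f x\<bar> \<le> p x" "f x0 = p x0"
proof -
  note vs = seminorm_space[OF p]
  interpret vector_space sc by (rule vs)
  have "sublinear sc p"
    using p by (auto simp: sublinear_def seminorm_triangle[OF p] seminorm_scale[OF p])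
  \<comment> \<open>Shifting by \<open>x0\<close> before minimizing forces
    \<open>m (- x0) \<le> - p x0\<close>, so the linear functional obtained attains \<open>p\<close>
    at \<open>x0\<close>.\<close>
  from sublinear_shift[OF vs this, of x0] obtain r
    where r: "sublinear sc r" "\<And>x. r x \<le> p x" "\<And>x. r x \<le> p (x + x0) - p x0"
    by blast
  obtain m where m: "sublinear sc m" "\<And>x. m x \<le> r x"
      "\<And>r. sublinear sc r \<Longrightarrow> (\<And>x. r x \<le> m x) \<Longrightarrow> r = m"
    using exists_minimal_sublinear[OF vs r(1)] by metis
  have sub: "m (x + y) \<le> m x + m y" and hom: "t \<ge> 0 \<Longrightarrow> m (sc t x) = t * m x" for x y t
    using m(1) by (auto simp: sublinear_def)
  have add: "m (x + y) = m x + m y" for x y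
  proof -
    from sublinear_shift[OF vs m(1), of y] obtain r'
      where r': "sublinear sc r'" "\<And>x. r' x \<le> m x" "\<And>x. r' x \<le> m (x + y) - m y"
      by blast
    then have "r' = m" by (intro m(3))
    then show ?thesis using r'(3)[of x] sub[of x y] by simp
  qed
  have m0: "m 0 = 0" using hom[of 0 0] by simp
  have neg: "m (- x) = - m x" for x using add[of x "- x"] m0 by simp
  have scale: "m (sc t x) = t * m x" for t x
  proof (cases "t \<ge> 0")
    case False
    then have "m (sc (- t) x) = - t * m x" by (intro hom) simp
    then show ?thesis by (simp add: neg)
  qed (rule hom)
  have le: "m x \<le> p x" for x using m(2) r(2) order_trans by blast
  show ?thesis
  proof (rule that)
    show "Vector_Spaces.linear sc (*) m" by (intro linear_functionalI vs add scale)
    show "\<bar>m x\<bar> \<le> p x" for x using le[of x] le[of "- x"] by (simp add: neg seminorm_minus[OF p])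
    have "m (- x0) \<le> p (- x0 + x0) - p x0" using m(2) r(3) order_trans by blast
    then show "m x0 = p x0" using le[of x0] by (simp add: neg seminorm_zero[OF p])
  qed
qed

lemma dominated_normalize:
  assumes "dominated sc p f" "f x \<noteq> 0"
  shows "\<exists>g. dominated sc p g \<and> g x = 1"
proof -
  obtain C where f: "Vector_Spaces.linear sc (*) f" and C: "\<And>x. norm (f x) \<le> C * p x"
    using assms by (auto simp: dominated_def)
  have "Vector_Spaces.linear sc (*) (\<lambda>z. f z / f x)"
    using linear_space[OF f]
    by (intro linear_functionalI) (simp_all add: lin_add[OF f] lin_scale[OF f] add_divide_distrib)
  moreover have "norm (f z / f x) \<le> (C / norm (f x)) * p z" for z
    using C[of z] assms(2) by (simp add: norm_divide field_simps)
  ultimately show ?thesis using assms(2)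
    unfolding dominated_def by (intro exI[of _ "\<lambda>z. f z / f x"] conjI exI[of _ "C / norm (f x)"]) auto
qed

lemma hahn_banach_functional_real:
  fixes sc :: "real \<Rightarrow> 'a::ab_group_add \<Rightarrow> 'a"
  assumes "seminorm sc p" "p x0 \<noteq> 0"
  shows "\<exists>f. dominated sc p f \<and> f x0 = 1"
proof -
  obtain f where f: "Vector_Spaces.linear sc (*) f" "\<And>x. \<bar>f x\<bar> \<le> p x" "f x0 = p x0"
    using hahn_banach_real[OF assms(1)] by metis
  have "dominated sc p f" using f by (auto simp: dominated_def intro: exI[of _ 1])
  then show ?thesis by (rule dominated_normalize) (simp add: f assms)
qed

lemma hahn_banach_functional_complex:
  fixes sc :: "complex \<Rightarrow> 'a::ab_group_add \<Rightarrow> 'a"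
  assumes "seminorm sc p" "p x0 \<noteq> 0"
  shows "\<exists>f. dominated sc p f \<and> f x0 = 1"
proof -
  note p = assms(1)
  interpret vector_space sc by (rule seminorm_space[OF p])
  define rs where "rs = (\<lambda>t::real. sc (of_real t))"
  have "vector_space rs"
    by unfold_locales (simp_all add: rs_def scale_right_distrib scale_left_distrib)
  then have "seminorm rs p"
    by (simp add: seminorm_def seminorm_triangle[OF p]) (simp add: rs_def seminorm_scale[OF p])
  then obtain f where f: "Vector_Spaces.linear rs (*) f" "\<And>x. \<bar>f x\<bar> \<le> p x" "f x0 = p x0"
    using hahn_banach_real by metis
  have add: "f (x + y) = f x + f y" and scale: "f (sc (of_real t) x) = t * f x" for x y t
    using lin_add[OF f(1)] lin_scale[OF f(1)] by (auto simp: rs_def)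
  have neg: "f (- x) = - f x" for x using lin_neg[OF f(1)] .
  \<comment> \<open>The usual complexification, \<open>f x\<close> minus \<i> times
    \<open>f (sc \<i> x)\<close>. Its real part is \<open>f\<close>, so \<open>g x0\<close> is
    nonzero whenever \<open>p x0\<close> is; the crude bound by \<open>2 * p x\<close> suffices for
    domination.\<close>
  define g where "g x = Complex (f x) (- f (sc \<i> x))" for x
  have g_scale: "g (sc c x) = c * g x" for c x
  proof -
    have *: "f (sc c y) = Re c * f y + Im c * f (sc \<i> y)" for y
    proof -
      have "sc c y = sc (of_real (Re c)) y + sc (of_real (Im c)) (sc \<i> y)"
        by (simp add: scale_left_distrib[symmetric] complex_eq mult.commute)
      then show ?thesis by (simp only: add scale)
    qed
    have "f (sc \<i> (sc c x)) = f (sc c (sc \<i> x))" by (simp add: mult.commute)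
    also have "\<dots> = Re c * f (sc \<i> x) - Im c * f x"
      using *[of "sc \<i> x"] by (simp add: neg)
    finally show ?thesis using *[of x] by (simp add: g_def complex_eq_iff algebra_simps)
  qed
  have "Vector_Spaces.linear sc (*) g"
    using vector_space_axioms
    by (intro linear_functionalI g_scale) (simp_all add: g_def add scale_right_distrib complex_eq_iff)
  moreover have "norm (g x) \<le> 2 * p x" for x
  proof -
    have "\<bar>f (sc \<i> x)\<bar> \<le> p x" using f(2)[of "sc \<i> x"] seminorm_scale[OF p, of \<i> x] by simp
    then show ?thesis using cmod_le[of "g x"] f(2)[of x] by (simp add: g_def)
  qed
  ultimately have "dominated sc p g" by (auto simp: dominated_def intro: exI[of _ 2])
  then show ?thesis
    by (rule dominated_normalize) (simp add: g_def f(3) assms complex_eq_iff)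
qed

section \<open>Seminorms generating a locally convex metrizable topology\<close>

text \<open>The last two clauses say that the balls of the \<open>p k\<close> form neighbourhood
  bases and that each \<open>p k\<close> is continuous. Monotonicity lets one index stand for
  finitely many.\<close>

definition fundamental_seminorms ::
    "('k::real_normed_field \<Rightarrow> 'a::{ab_group_add,topological_space} \<Rightarrow> 'a) \<Rightarrow> (nat \<Rightarrow> 'a \<Rightarrow> real) \<Rightarrow> bool" where
  "fundamental_seminorms sc p \<longleftrightarrow>
     (\<forall>k. seminorm sc (p k)) \<and> (\<forall>x. mono (\<lambda>k. p k x)) \<and>
     (\<forall>U x. open U \<and> x \<in> U \<longrightarrow> (\<exists>k. \<exists>e>0. \<forall>y. p k (y - x) < e \<longrightarrow> y \<in> U)) \<and>
     (\<forall>k x. \<forall>e>0. \<exists>V. open V \<and> x \<in> V \<and> (\<forall>y\<in>V. p k (y - x) < e))"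

lemma seminorm_sum_family:
  assumes "vector_space sc" "\<And>i. i \<in> I \<Longrightarrow> seminorm sc (q i)"
  shows "seminorm sc (\<lambda>x. \<Sum>i\<in>I. q i x)"
  unfolding seminorm_def
proof (intro conjI allI assms)
  show "(\<Sum>i\<in>I. q i (x + y)) \<le> (\<Sum>i\<in>I. q i x) + (\<Sum>i\<in>I. q i y)" for x y
    unfolding sum.distrib[symmetric] using assms(2) by (intro sum_mono) (simp add: seminorm_def)
  show "(\<Sum>i\<in>I. q i (sc c x)) = norm c * (\<Sum>i\<in>I. q i x)" for c x
    unfolding sum_distrib_left using assms(2) by (intro sum.cong) (simp_all add: seminorm_def)
qed

text \<open>This is the gauge of \<open>H\<close>, the infimum of all \<open>t > 0\<close> with
  \<open>x / t\<close> in \<open>H\<close>. Convexity yields the triangle inequality, and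
  balancedness yields homogeneity over the full scalar field.\<close>

lemma minkowski_seminorm:
  fixes sc :: "'k::real_normed_field \<Rightarrow> 'a::ab_group_add \<Rightarrow> 'a"
  assumes vs: "vector_space sc"
    and conv: "convex_wrt sc H"
    and bal: "\<And>c x. norm c \<le> 1 \<Longrightarrow> x \<in> H \<Longrightarrow> sc c x \<in> H"
    and absorb: "\<And>x. \<exists>t>0. sc (of_real (inverse t)) x \<in> H"
  obtains p where "seminorm sc p" "\<And>x. p x < 1 \<Longrightarrow> x \<in> H"
    "\<And>x t. t > 0 \<Longrightarrow> sc (of_real (inverse t)) x \<in> H \<Longrightarrow> p x \<le> t"
proof -
  interpret vector_space sc by fact
  define S where "S x = {t. t > 0 \<and> sc (of_real (inverse t)) x \<in> H}" for x
  define p where "p x = Inf (S x)" for x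
  have ne: "S x \<noteq> {}" and bdd: "bdd_below (S x)" for x
    using absorb[of x] by (auto simp: S_def intro!: bdd_belowI[of _ 0])
  have le: "p x \<le> t" if "t > 0" "sc (of_real (inverse t)) x \<in> H" for x t
    unfolding p_def using that by (intro cInf_lower bdd) (simp add: S_def)
  have approx: "\<exists>t. t > 0 \<and> sc (of_real (inverse t)) x \<in> H \<and> t < p x + e" if "e > 0" for x e
  proof -
    have "p x < p x + e" using that by simp
    then obtain t where "t \<in> S x" "t < p x + e"
      unfolding p_def using cInf_less_iff[OF ne bdd] by blast
    then show ?thesis by (auto simp: S_def)
  qed
  have p_nonneg: "p x \<ge> 0" for x
    unfolding p_def by (intro cInf_greatest ne) (simp add: S_def)
  have tri: "p (x + y) \<le> p x + p y" for x y
  proof (rule field_le_epsilon)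
    fix e :: real assume "e > 0"
    then obtain s t where s: "s > 0" "sc (of_real (inverse s)) x \<in> H" "s < p x + e / 2"
      and t: "t > 0" "sc (of_real (inverse t)) y \<in> H" "t < p y + e / 2"
      using approx[of "e/2" x] approx[of "e/2" y] by auto
    \<comment> \<open>The vector \<open>(x + y) / (s + t)\<close> is the convex combination of
      \<open>x / s\<close> and \<open>y / t\<close> with weights \<open>s / (s + t)\<close> and
      \<open>t / (s + t)\<close>.\<close>
    define r where "r = s / (s + t)"
    have r: "0 \<le> r" "r \<le> 1" "r * inverse s = inverse (s + t)" "(1 - r) * inverse t = inverse (s + t)"
      using s t by (simp_all add: r_def field_simps)
    have "sc (of_real r) (sc (of_real (inverse s)) x) + sc (of_real (1 - r)) (sc (of_real (inverse t)) y) \<in> H"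
      using conv s t r unfolding convex_wrt_def by blast
    also have "sc (of_real r) (sc (of_real (inverse s)) x) + sc (of_real (1 - r)) (sc (of_real (inverse t)) y)
        = sc (of_real (inverse (s + t))) (x + y)"
      by (simp only: scale_scale of_real_mult[symmetric] r scale_right_distrib)
    finally have "p (x + y) \<le> s + t" using s t by (intro le) auto
    then show "p (x + y) \<le> p x + p y + e" using s t by linarith
  qed
  have hom1: "p (sc c x) \<le> norm c * p x" if "c \<noteq> 0" for c x
  proof (rule field_le_epsilon)
    fix e :: real assume "e > 0"
    then have "e / norm c > 0" using that by simp
    then obtain t where t: "t > 0" "sc (of_real (inverse t)) x \<in> H" "t < p x + e / norm c"
      using approx by blast
    have "sc (c * of_real (inverse (norm c))) (sc (of_real (inverse t)) x) \<in> H"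
      using that by (intro bal[OF _ t(2)]) (simp add: norm_mult norm_inverse)
    then have "sc (of_real (inverse (norm c * t))) (sc c x) \<in> H"
      by (simp add: mult_ac)
    then have "p (sc c x) \<le> norm c * t" using that t by (intro le) auto
    also have "\<dots> \<le> norm c * (p x + e / norm c)" using t by (intro mult_left_mono) auto
    also have "\<dots> = norm c * p x + e" using that by (simp add: distrib_left)
    finally show "p (sc c x) \<le> norm c * p x + e" .
  qed
  have zero: "p 0 = 0"
  proof -
    have "sc 0 x \<in> H" if "x \<in> H" for x using that by (intro bal) auto
    then have "0 \<in> H" using absorb[of 0] by (auto)
    then have "p 0 \<le> 0 + e" if "e > 0" for e using that by (auto intro: le)
    then have "p 0 \<le> 0" by (rule field_le_epsilon)
    then show ?thesis using p_nonneg[of 0] by simp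
  qed
  have hom: "p (sc c x) = norm c * p x" for c x
  proof (cases "c = 0")
    case False
    have "p (sc (inverse c) (sc c x)) \<le> norm (inverse c) * p (sc c x)"
      using False by (intro hom1) auto
    then have "norm c * p x \<le> p (sc c x)"
      using False by (simp add: norm_inverse) (simp add: field_simps)
    then show ?thesis using hom1[OF False, of x] by simp
  qed (simp add: zero)
  show ?thesis
  proof (rule that)
    show "seminorm sc p" using vs tri hom by (simp add: seminorm_def)
    show "x \<in> H" if lt: "p x < 1" for x
    proof -
      obtain t where t: "t > 0" "sc (of_real (inverse t)) x \<in> H" "t < 1"
        using approx[of "1 - p x" x] lt by auto
      have "sc (of_real t) (sc (of_real (inverse t)) x) \<in> H" using t by (intro bal[OF _ t(2)]) auto
      then show ?thesis using t(1) by (simp add: of_real_mult[symmetric] del: of_real_mult of_real_inverse)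
    qed
  qed (rule le)
qed

section \<open>Seminorms from neighbourhoods of zero\<close>

context
  fixes sc :: "'k::real_normed_field \<Rightarrow> 'a::{ab_group_add,t2_space} \<Rightarrow> 'a"
  assumes tvs: "is_tvs sc"
begin

interpretation vector_space sc using tvs by (simp add: is_tvs_def)

lemma tvs_open_translate:
  assumes "open U" shows "open {y. y - (x::'a) \<in> U}"
proof -
  have "continuous_on UNIV (\<lambda>y. fst (y, - x) + snd (y, - x))"
    by (rule continuous_on_compose2[where g = "\<lambda>p. fst p + snd p" and t = UNIV])
       (use tvs in \<open>auto simp: is_tvs_def intro!: continuous_intros\<close>)
  from open_vimage[OF assms this] show ?thesis by (simp add: vimage_def)
qed

lemma tvs_open_scale:
  assumes "open U" shows "open {y. sc c y \<in> U}"
proof -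
  have "continuous_on UNIV (\<lambda>y. sc (fst (c, y)) (snd (c, y)))"
    by (rule continuous_on_compose2[where g = "\<lambda>p. sc (fst p) (snd p)" and t = UNIV])
       (use tvs in \<open>auto simp: is_tvs_def intro!: continuous_intros\<close>)
  from open_vimage[OF assms this] show ?thesis by (simp add: vimage_def)
qed

lemma tvs_absorbing:
  assumes "open U" "0 \<in> U" shows "\<exists>t>0. sc (of_real (inverse t)) x \<in> U"
proof -
  have "continuous_on UNIV (\<lambda>c. sc (fst (c, x)) (snd (c, x)))"
    by (rule continuous_on_compose2[where g = "\<lambda>p. sc (fst p) (snd p)" and t = UNIV])
       (use tvs in \<open>auto simp: is_tvs_def intro!: continuous_intros\<close>)
  from open_vimage[OF assms(1) this] have "open {c. sc c x \<in> U}" by (simp add: vimage_def)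
  moreover have "0 \<in> {c. sc c x \<in> U}" using assms by simp
  ultimately obtain e where "e > 0" "ball 0 e \<subseteq> {c. sc c x \<in> U}"
    unfolding open_contains_ball by blast
  then have e: "e > 0" "\<And>c. norm c < e \<Longrightarrow> sc c x \<in> U" by (auto simp: subset_eq)
  have "sc (of_real (inverse (2 / e))) x \<in> U" using e(1) by (intro e(2)) (simp add: norm_divide)
  then show ?thesis using e(1) by (intro exI[of _ "2 / e"]) auto
qed

text \<open>A convex neighbourhood \<open>V\<close> need not be balanced. Its balanced core
  \<open>H\<close> is still convex, and it contains a neighbourhood \<open>N\<close> of 0 by joint
  continuity of scalar multiplication at the origin. The gauge of \<open>H\<close> is the required
  seminorm.\<close>

lemma tvs_neighbourhood_seminorm:
  assumes lc: "locally_convex sc" and U: "open U" "0 \<in> U"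
  obtains p where "seminorm sc p" "\<And>x. p x < 1 \<Longrightarrow> x \<in> U"
    "\<And>e. e > 0 \<Longrightarrow> \<exists>V. open V \<and> 0 \<in> V \<and> (\<forall>y\<in>V. p y < e)"
proof -
  obtain V where V: "open V" "0 \<in> V" "convex_wrt sc V" "V \<subseteq> U"
    using lc U unfolding locally_convex_def by blast
  have "open ((\<lambda>p. sc (fst p) (snd p)) -` V)"
    using tvs by (intro open_vimage V) (simp add: is_tvs_def)
  moreover have "(0, 0) \<in> (\<lambda>p. sc (fst p) (snd p)) -` V" using V by simp
  ultimately obtain A W where AW: "open A" "open W" "0 \<in> A" "0 \<in> W"
      "A \<times> W \<subseteq> (\<lambda>p. sc (fst p) (snd p)) -` V"
    by (rule open_prod_elim) (rule that, auto)
  then obtain d where d: "d > 0" "\<And>c. norm c < d \<Longrightarrow> c \<in> A"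
    unfolding open_contains_ball by (fastforce simp: subset_eq)
  define H where "H = {x. \<forall>c. norm c \<le> 1 \<longrightarrow> sc c x \<in> V}"
  \<comment> \<open>A scalar of modulus at most 1 lands in \<open>A\<close> after multiplication by
    \<open>d / 2\<close>; the factor \<open>2 / d\<close> on the vector compensates.\<close>
  define N where "N = {x. sc (of_real (2 / d)) x \<in> W}"
  have N: "open N" "0 \<in> N" unfolding N_def using AW by (simp_all add: tvs_open_scale)
  have NH: "N \<subseteq> H"
  proof
    fix x assume x: "x \<in> N"
    have "sc c x \<in> V" if "norm c \<le> 1" for c
    proof -
      have "norm (c * of_real (d / 2)) < d" using that d(1)
        by (simp add: norm_mult)
      then have "(c * of_real (d / 2), sc (of_real (2 / d)) x) \<in> A \<times> W"
        using d x by (simp add: N_def)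
      then have "sc (c * of_real (d / 2)) (sc (of_real (2 / d)) x) \<in> V" using AW by auto
      moreover have "of_real (d / 2) * of_real (2 / d) = (1 :: 'k)"
        using d(1) by (simp add: of_real_mult[symmetric] del: of_real_mult of_real_divide)
      ultimately show ?thesis by (simp add: mult.assoc del: of_real_divide)
    qed
    then show "x \<in> H" by (simp add: H_def)
  qed
  have HV: "H \<subseteq> V"
  proof
    fix x assume "x \<in> H"
    then have "sc 1 x \<in> V" unfolding H_def by (metis (mono_tags, lifting) mem_Collect_eq norm_one order_refl)
    then show "x \<in> V" by simp
  qed
  have conv: "convex_wrt sc H"
    unfolding convex_wrt_def H_def
  proof (intro ballI allI impI CollectI)
    fix x y c and t :: real
    assume x: "x \<in> {x. \<forall>c. norm c \<le> 1 \<longrightarrow> sc c x \<in> V}" and y: "y \<in> {x. \<forall>c. norm c \<le> 1 \<longrightarrow> sc c x \<in> V}"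
      and t: "0 \<le> t \<and> t \<le> 1" and c: "norm (c :: 'k) \<le> 1"
    have "sc (of_real t) (sc c x) + sc (of_real (1 - t)) (sc c y) \<in> V"
      using V(3) x y t c unfolding convex_wrt_def by blast
    also have "sc (of_real t) (sc c x) + sc (of_real (1 - t)) (sc c y)
      = sc c (sc (of_real t) x + sc (of_real (1 - t)) y)"
      by (simp add: scale_right_distrib mult.commute)
    finally show "sc c (sc (of_real t) x + sc (of_real (1 - t)) y) \<in> V" .
  qed
  have bal: "sc c x \<in> H" if "norm c \<le> 1" "x \<in> H" for c x
  proof -
    have "norm (b * c) \<le> 1" if "norm b \<le> 1" for b
      using that \<open>norm c \<le> 1\<close> by (simp add: norm_mult mult_le_one)
    then show ?thesis using that by (auto simp: H_def)
  qed
  have absorb: "\<exists>t>0. sc (of_real (inverse t)) x \<in> H" for x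
    using tvs_absorbing[OF N, of x] NH by blast
  obtain p where p: "seminorm sc p" "\<And>x. p x < 1 \<Longrightarrow> x \<in> H"
    "\<And>x t. t > 0 \<Longrightarrow> sc (of_real (inverse t)) x \<in> H \<Longrightarrow> p x \<le> t"
    using minkowski_seminorm[OF vector_space_axioms conv bal absorb] by blast
  show ?thesis
  proof (rule that[OF p(1)])
    show "x \<in> U" if "p x < 1" for x using p(2)[OF that] HV V by auto
    fix e :: real assume e: "e > 0"
    define M where "M = {y. sc (of_real (inverse (e / 2))) y \<in> N}"
    have "p y < e" if "y \<in> M" for y
    proof -
      have "p y \<le> e / 2" using that e NH by (intro p(3)) (auto simp: M_def)
      then show ?thesis using e by simp
    qed
    moreover have "open M" "0 \<in> M" unfolding M_def using N by (simp_all add: tvs_open_scale)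
    ultimately show "\<exists>V. open V \<and> 0 \<in> V \<and> (\<forall>y\<in>V. p y < e)" by blast
  qed
qed

lemma fundamental_seminorms_exist:
  assumes lc: "locally_convex sc" and met: "metrizable_space (euclidean :: 'a topology)"
  obtains p where "fundamental_seminorms sc p"
proof -
  have "first_countable (euclidean :: 'a topology)" using met by (rule metrizable_imp_first_countable)
  then have "\<exists>\<B>. countable \<B> \<and> (\<forall>V\<in>\<B>. openin euclidean V) \<and>
      (\<forall>U. openin euclidean U \<and> (0::'a) \<in> U \<longrightarrow> (\<exists>V\<in>\<B>. 0 \<in> V \<and> V \<subseteq> U))"
    unfolding first_countable_def by simp
  then obtain \<B> where B: "countable \<B>" "\<And>V. V \<in> \<B> \<Longrightarrow> open V"
      "\<And>U. open U \<Longrightarrow> (0::'a) \<in> U \<Longrightarrow> \<exists>V\<in>\<B>. 0 \<in> V \<and> V \<subseteq> U"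
    unfolding open_openin[symmetric] by metis
  define \<C> where "\<C> = {V \<in> \<B>. 0 \<in> V}"
  have C: "countable \<C>" "\<C> \<noteq> {}"
    using B(1) B(3)[of UNIV] by (auto simp: \<C>_def)
  define N where "N = from_nat_into \<C>"
  have N: "range N = \<C>" using C by (simp add: N_def)
  have N': "open (N n)" "0 \<in> N n" for n
    using N B(2) unfolding \<C>_def by blast+
  have "\<exists>p. seminorm sc p \<and> (\<forall>x. p x < 1 \<longrightarrow> x \<in> N n) \<and>
      (\<forall>e>0. \<exists>V. open V \<and> 0 \<in> V \<and> (\<forall>y\<in>V. p y < e))" for n
    using tvs_neighbourhood_seminorm[OF lc N'[of n]] by metis
  then obtain q where q: "\<And>n. seminorm sc (q n)" "\<And>n x. q n x < 1 \<Longrightarrow> x \<in> N n"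
      "\<And>n e. e > 0 \<Longrightarrow> \<exists>V. open V \<and> 0 \<in> V \<and> (\<forall>y\<in>V. q n y < e)"
    by metis
  \<comment> \<open>Partial sums turn the countably many gauges into an increasing sequence
    generating the same topology.\<close>
  define p where "p k x = (\<Sum>i\<le>k. q i x)" for k x
  have sn: "seminorm sc (p k)" for k
    unfolding p_def by (rule seminorm_sum_family[OF vector_space_axioms q(1)])
  have mono: "mono (\<lambda>k. p k x)" for x
    unfolding p_def by (intro monoI sum_mono2) (auto simp: seminorm_nonneg[OF q(1)])
  have nbhd: "\<exists>k. \<exists>e>0. \<forall>y. p k (y - x) < e \<longrightarrow> y \<in> U" if U: "open U" "x \<in> U" for U x
  proof -
    have "open {y. y - (- x) \<in> U}" by (rule tvs_open_translate[OF U(1)])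
    then obtain V where V: "V \<in> \<B>" "0 \<in> V" "V \<subseteq> {y. y - (- x) \<in> U}"
      using B(3)[of "{y. y - (- x) \<in> U}"] U(2) by auto
    then have "V \<in> range N" using N by (simp add: \<C>_def)
    then obtain n where n: "N n = V" by auto
    have "y \<in> U" if "p n (y - x) < 1" for y
    proof -
      have "q n (y - x) \<le> p n (y - x)" unfolding p_def
        by (intro member_le_sum) (auto simp: seminorm_nonneg[OF q(1)])
      then have "y - x \<in> V" using that q(2)[of n "y - x"] n by auto
      then show ?thesis using V(3) by auto
    qed
    then show ?thesis by (intro exI[of _ n] exI[of _ 1]) auto
  qed
  have cont: "\<exists>V. open V \<and> x \<in> V \<and> (\<forall>y\<in>V. p k (y - x) < e)" if e: "e > 0" for k x e
  proof -
    have "e / (k + 1) > 0" using e by simp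
    then obtain V where V: "\<And>i. open (V i)" "\<And>i. 0 \<in> V i" "\<And>i y. y \<in> V i \<Longrightarrow> q i y < e / (k + 1)"
      using q(3) by metis
    let ?V = "{y. y - x \<in> (\<Inter>i\<le>k. V i)}"
    have "open ?V" using V(1) by (intro tvs_open_translate open_INT) auto
    moreover have "p k (y - x) < e" if y: "y \<in> ?V" for y
    proof -
      have "p k (y - x) < (\<Sum>i\<le>k. e / (k + 1))"
        unfolding p_def using y by (intro sum_strict_mono V(3)) auto
      then show ?thesis by simp
    qed
    ultimately show ?thesis using V(2) by (intro exI[of _ ?V]) auto
  qed
  show ?thesis
    by (rule that[of p]) (use sn mono nbhd cont in \<open>auto simp: fundamental_seminorms_def\<close>)
qed

end

lemma fundamental_seminorms_separate:
  fixes sc :: "'k::real_normed_field \<Rightarrow> 'a::{ab_group_add,t2_space} \<Rightarrow> 'a"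
  assumes "fundamental_seminorms sc p" "x \<noteq> 0"
  shows "\<exists>k. p k x \<noteq> 0"
proof -
  obtain U where U: "open U" "0 \<in> U" "x \<notin> U" using hausdorff[of 0 x] assms(2) by blast
  then obtain k e where "e > 0" "\<And>y. p k (y - 0) < e \<Longrightarrow> y \<in> U"
    using assms(1) unfolding fundamental_seminorms_def by meson
  then show ?thesis using U(3) by (metis diff_zero)
qed

lemma hypercyclicI:
  fixes sc :: "'k::real_normed_field \<Rightarrow> 'a::{ab_group_add,t2_space} \<Rightarrow> 'a"
  assumes p: "fundamental_seminorms sc p"
    and T: "Vector_Spaces.linear sc sc T" "\<And>k. \<exists>l C. \<forall>x. p k (T x) \<le> C * p l x"
    and dense: "\<And>k e z. e > 0 \<Longrightarrow> \<exists>n. p k ((T ^^ n) x - z) < e"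
  shows "hypercyclic sc T"
  unfolding hypercyclic_def
proof (intro conjI T exI[of _ x])
  have sn: "seminorm sc (p k)" for k using p by (simp add: fundamental_seminorms_def)
  show "continuous_on UNIV T"
    unfolding continuous_on_topological
  proof (intro ballI allI impI)
    fix z U assume "open U" "T z \<in> U"
    then obtain k e where ke: "e > 0" "\<And>y. p k (y - T z) < e \<Longrightarrow> y \<in> U"
      using p unfolding fundamental_seminorms_def by meson
    obtain l C where C: "\<And>x. p k (T x) \<le> C * p l x" using T(2) by blast
    have "e / (\<bar>C\<bar> + 1) > 0" using ke(1) by simp
    then obtain V where V: "open V" "z \<in> V" "\<And>y. y \<in> V \<Longrightarrow> p l (y - z) < e / (\<bar>C\<bar> + 1)"
      using p unfolding fundamental_seminorms_def by meson
    have "T y \<in> U" if "y \<in> V" for y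
    proof (rule ke(2))
      have "p k (T y - T z) = p k (T (y - z))" by (simp add: lin_diff[OF T(1)])
      also have "\<dots> \<le> C * p l (y - z)" by (rule C)
      also have "\<dots> \<le> (\<bar>C\<bar> + 1) * p l (y - z)"
        using seminorm_nonneg[OF sn, of l "y - z"] by (intro mult_right_mono) auto
      also have "\<dots> < e" using V(3)[OF that] by (simp add: field_simps)
      finally show "p k (T y - T z) < e" .
    qed
    then show "\<exists>A. open A \<and> z \<in> A \<and> (\<forall>y\<in>UNIV. y \<in> A \<longrightarrow> T y \<in> U)" using V by blast
  qed
  show "closure (range (\<lambda>n. (T ^^ n) x)) = UNIV"
  proof (intro set_eqI iffI UNIV_I)
    fix z
    show "z \<in> closure (range (\<lambda>n. (T ^^ n) x))"
      unfolding closure_iff_nhds_not_empty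
    proof (intro allI impI)
      fix A U assume "U \<subseteq> A" "open U" "z \<in> U"
      then obtain k e where "e > 0" "\<And>y. p k (y - z) < e \<Longrightarrow> y \<in> U"
        using p unfolding fundamental_seminorms_def by meson
      then show "range (\<lambda>n. (T ^^ n) x) \<inter> A \<noteq> {}" using dense[of e k z] \<open>U \<subseteq> A\<close> by blast
    qed
  qed
qed

section \<open>Biorthogonal systems\<close>

text \<open>The Gram-Schmidt remainder. For a biorthogonal system it is the projection onto the
  common kernel of the first \<open>n\<close> functionals along the span of the first
  \<open>n\<close> vectors.\<close>

definition residual :: "('k::real_normed_field \<Rightarrow> 'a::ab_group_add \<Rightarrow> 'a) \<Rightarrow> (nat \<Rightarrow> 'a) \<Rightarrow> (nat \<Rightarrow> 'a \<Rightarrow> 'k) \<Rightarrow> nat \<Rightarrow> 'a \<Rightarrow> 'a" where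
  "residual sc e g n x = x - (\<Sum>i<n. sc (g i x) (e i))"

definition biorthogonal_upto :: "('k::real_normed_field \<Rightarrow> 'a::ab_group_add \<Rightarrow> 'a) \<Rightarrow> (nat \<Rightarrow> 'a) \<Rightarrow> (nat \<Rightarrow> 'a \<Rightarrow> 'k) \<Rightarrow> nat \<Rightarrow> bool" where
  "biorthogonal_upto sc e g n \<longleftrightarrow>
     (\<forall>i<n. Vector_Spaces.linear sc (*) (g i) \<and> (\<forall>j<n. g i (e j) = (if i = j then 1 else 0)))"

lemma residual_cong:
  "(\<And>i. i < n \<Longrightarrow> e i = e' i) \<Longrightarrow> (\<And>i. i < n \<Longrightarrow> g i = g' i) \<Longrightarrow>
    residual sc e g n x = residual sc e' g' n x"
  by (simp add: residual_def)

lemma residual_Suc: "residual sc e g (Suc n) x = residual sc e g n x - sc (g n x) (e n)"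
  by (simp add: residual_def)

lemma biorthogonal_upto_Suc:
  assumes "biorthogonal_upto sc e g n" "Vector_Spaces.linear sc (*) (g n)" "g n (e n) = 1"
    "\<And>i. i < n \<Longrightarrow> g n (e i) = 0" "\<And>i. i < n \<Longrightarrow> g i (e n) = 0"
  shows "biorthogonal_upto sc e g (Suc n)"
  using assms by (auto simp: biorthogonal_upto_def less_Suc_eq)

lemma functional_residual:
  assumes "Vector_Spaces.linear sc (*) h"
  shows "h (residual sc e g n x) = h x - (\<Sum>i<n. g i x * h (e i))"
  by (simp add: residual_def lin_diff[OF assms] lin_sum[OF assms] lin_scale[OF assms])

lemma functional_residual_eq:
  assumes "Vector_Spaces.linear sc (*) h" "\<And>i. i < n \<Longrightarrow> h (e i) = 0"
  shows "h (residual sc e g n x) = h x"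
  using assms by (simp add: functional_residual)

lemma biorthogonal_residual:
  assumes "biorthogonal_upto sc e g n" "i < n"
  shows "g i (residual sc e g n x) = 0"
proof -
  have "(\<Sum>j<n. g j x * g i (e j)) = (\<Sum>j<n. if j = i then g j x else 0)"
    using assms by (intro sum.cong) (auto simp: biorthogonal_upto_def)
  then show ?thesis using assms by (simp add: functional_residual biorthogonal_upto_def)
qed

lemma residual_basis:
  assumes "vector_space sc" "biorthogonal_upto sc e g n" "i < n"
  shows "residual sc e g n (e i) = 0"
proof -
  interpret vector_space sc by fact
  have "(\<Sum>j<n. sc (g j (e i)) (e j)) = (\<Sum>j<n. if j = i then e j else 0)"
    using assms(2,3) by (intro sum.cong) (auto simp: biorthogonal_upto_def)
  then show ?thesis using assms(3) by (simp add: residual_def)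
qed

lemma residual_fixed:
  assumes "vector_space sc" "\<And>i. i < n \<Longrightarrow> g i x = 0"
  shows "residual sc e g n x = x"
proof -
  interpret vector_space sc by fact
  show ?thesis using assms(2) by (simp add: residual_def)
qed

lemma diff_residual_in_span:
  assumes "vector_space sc"
  shows "x - residual sc e g n x \<in> module.span sc (e ` {..<n})"
proof -
  interpret vector_space sc by fact
  have "(\<Sum>i<n. sc (g i x) (e i)) \<in> span (e ` {..<n})"
    by (intro span_sum span_scale span_base) auto
  then show ?thesis by (simp add: residual_def)
qed

text \<open>Summing over the support avoids a truncation index. A sum over an infinite set is 0 by
  default, so the value is meaningful only for finitely supported \<open>a\<close>.\<close>

definition expansion :: "('k::field \<Rightarrow> 'a::ab_group_add \<Rightarrow> 'a) \<Rightarrow> (nat \<Rightarrow> 'a) \<Rightarrow> (nat \<Rightarrow> 'k) \<Rightarrow> 'a" where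
  "expansion sc e a = (\<Sum>n | a n \<noteq> 0. sc (a n) (e n))"

lemma expansion_eq_sum:
  assumes "vector_space sc" "\<forall>n\<ge>N. a n = 0"
  shows "expansion sc e a = (\<Sum>n<N. sc (a n) (e n))"
proof -
  interpret vector_space sc by fact
  show ?thesis unfolding expansion_def
  proof (rule sum.mono_neutral_left)
    show "{n. a n \<noteq> 0} \<subseteq> {..<N}" using assms(2) by (force simp: not_less[symmetric])
  qed auto
qed

lemma expansion_add:
  assumes vs: "vector_space sc" and "\<exists>N. \<forall>n\<ge>N. a n = 0" "\<exists>N. \<forall>n\<ge>N. b n = 0"
  shows "expansion sc e (\<lambda>n. a n + b n) = expansion sc e a + expansion sc e b"
proof -
  interpret vector_space sc by fact
  obtain N M where "\<forall>n\<ge>N. a n = 0" "\<forall>n\<ge>M. b n = 0" using assms by blast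
  then have *: "\<forall>n\<ge>max N M. a n = 0" "\<forall>n\<ge>max N M. b n = 0" "\<forall>n\<ge>max N M. a n + b n = 0" by auto
  show ?thesis by (simp add: *[THEN expansion_eq_sum[OF vs]] scale_left_distrib sum.distrib)
qed

lemma expansion_scale:
  assumes vs: "vector_space sc" and "\<exists>N. \<forall>n\<ge>N. a n = 0"
  shows "expansion sc e (\<lambda>n. c * a n) = sc c (expansion sc e a)"
proof -
  interpret vector_space sc by fact
  obtain N where "\<forall>n\<ge>N. a n = 0" using assms by blast
  then have *: "\<forall>n\<ge>N. a n = 0" "\<forall>n\<ge>N. c * a n = 0" by auto
  show ?thesis by (simp add: *[THEN expansion_eq_sum[OF vs]] scale_sum_right)
qed

lemma functional_expansion:
  assumes lin: "Vector_Spaces.linear sc (*) (g m)" and "\<exists>N. \<forall>n\<ge>N. a n = 0"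
    and orth: "\<And>n. g m (e n) = (if m = n then 1 else 0)"
  shows "g m (expansion sc e a) = a m"
proof -
  obtain N where N: "\<forall>n\<ge>N. a n = 0" using assms by blast
  have "g m (expansion sc e a) = (\<Sum>n<N. if n = m then a m else 0)"
    unfolding expansion_eq_sum[OF linear_space[OF lin] N] lin_sum[OF lin] lin_scale[OF lin] orth
    by (intro sum.cong) auto
  then show ?thesis using N by auto
qed

lemma seminorm_expansion_le:
  assumes p: "seminorm sc p" and N: "\<forall>n\<ge>N. a n = 0"
  shows "p (expansion sc e a) \<le> (\<Sum>n<N. norm (a n) * p (e n))"
  unfolding expansion_eq_sum[OF seminorm_space[OF p] N] seminorm_scale[OF p, symmetric]
  by (rule seminorm_sum[OF p])

lemma functional_span_zero:
  assumes f: "Vector_Spaces.linear sc (*) f" and "\<forall>v\<in>V. f v = 0" "x \<in> module.span sc V"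
  shows "f x = 0"
proof -
  interpret vector_space sc by (rule linear_space[OF f])
  have "span V \<subseteq> {v. f v = 0}"
  proof (rule span_minimal)
    show "subspace {v. f v = 0}"
      by (rule subspaceI) (simp_all add: lin_zero[OF f] lin_add[OF f] lin_scale[OF f])
  qed (use assms in auto)
  then show ?thesis using assms by blast
qed

lemma dominated_linear: "dominated sc p f \<Longrightarrow> Vector_Spaces.linear sc (*) f"
  by (simp add: dominated_def)

lemma dominated_vanish: "dominated sc p f \<Longrightarrow> p x = 0 \<Longrightarrow> f x = 0"
  unfolding dominated_def by (metis mult_zero_right norm_le_zero_iff)

lemma dominated_mono:
  assumes "seminorm sc p" "dominated sc p f" "\<And>x. p x \<le> q x"
  shows "dominated sc q f"
proof -
  obtain C where C: "C > 0" "\<And>x. norm (f x) \<le> C * p x" using dominatedE[OF assms(1,2)] by metis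
  have "norm (f x) \<le> C * q x" for x
    using C(2)[of x] mult_left_mono[OF assms(3)[of x], of C] C(1) by linarith
  then show ?thesis using assms(2) by (auto simp: dominated_def)
qed

text \<open>Used to correct a Hahn-Banach functional: for a biorthogonal system its composite with
  the remainder map vanishes on the earlier vectors, yet stays dominated by the same
  seminorm.\<close>

lemma dominated_residual:
  assumes p: "seminorm sc p" and h: "dominated sc p h" and g: "\<And>i. i < n \<Longrightarrow> dominated sc p (g i)"
  shows "dominated sc p (\<lambda>x. h (residual sc e g n x))"
proof -
  interpret vector_space sc by (rule seminorm_space[OF p])
  obtain C where C: "\<And>x. norm (h x) \<le> C * p x" using h by (auto simp: dominated_def)
  have "\<forall>i. \<exists>D. i < n \<longrightarrow> (\<forall>x. norm (g i x) \<le> D * p x)" using g by (auto simp: dominated_def)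
  then obtain D where D: "\<And>i x. i < n \<Longrightarrow> norm (g i x) \<le> D i * p x" by metis
  note hl = dominated_linear[OF h] and gl = dominated_linear[OF g]
  have eq: "h (residual sc e g n x) = h x - (\<Sum>i<n. g i x * h (e i))" for x
    by (rule functional_residual[OF hl])
  have "Vector_Spaces.linear sc (*) (\<lambda>x. h (residual sc e g n x))"
    unfolding eq
    by (intro linear_functionalI vector_space_axioms)
       (simp_all add: lin_add[OF hl] lin_scale[OF hl] lin_add[OF gl] lin_scale[OF gl]
          sum.distrib[symmetric] sum_distrib_left algebra_simps cong: sum.cong_simp)
  moreover have "norm (h (residual sc e g n x)) \<le> (C + (\<Sum>i<n. D i * norm (h (e i)))) * p x" for x
  proof -
    have "norm (h (residual sc e g n x)) \<le> norm (h x) + (\<Sum>i<n. norm (g i x * h (e i)))"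
      unfolding eq by (rule order_trans[OF norm_triangle_ineq4 add_left_mono[OF norm_sum]])
    also have "\<dots> \<le> C * p x + (\<Sum>i<n. D i * p x * norm (h (e i)))"
      unfolding norm_mult by (intro add_mono C sum_mono mult_right_mono D) auto
    also have "\<dots> = (C + (\<Sum>i<n. D i * norm (h (e i)))) * p x"
      by (simp add: algebra_simps sum_distrib_left)
    finally show ?thesis .
  qed
  ultimately show ?thesis by (auto simp: dominated_def)
qed

section \<open>Gram-Schmidt modulo a seminorm of infinite rank\<close>

definition finite_rank :: "('k::real_normed_field \<Rightarrow> 'a::ab_group_add \<Rightarrow> 'a) \<Rightarrow> ('a \<Rightarrow> real) \<Rightarrow> bool" where
  "finite_rank sc p \<longleftrightarrow> (\<exists>F. finite F \<and> (\<forall>x. \<exists>y\<in>module.span sc F. p (x - y) = 0))"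

lemma subspace_finitely_many_nonzero:
  fixes g :: "nat \<Rightarrow> 'a::ab_group_add \<Rightarrow> 'k::field"
  assumes "vector_space sc" "\<And>n. Vector_Spaces.linear sc (*) (g n)"
  shows "module.subspace sc {x. \<exists>N. \<forall>n\<ge>N. g n x = 0}"
proof -
  interpret vector_space sc by fact
  show ?thesis
  proof (rule subspaceI; clarsimp)
    show "\<exists>N. \<forall>n\<ge>N. g n 0 = 0" by (simp add: lin_zero[OF assms(2)])
    fix x y N M assume "\<forall>n\<ge>N. g n x = 0" "\<forall>n\<ge>M. g n y = 0"
    then show "\<exists>N. \<forall>n\<ge>N. g n (x + y) = 0"
      by (intro exI[of _ "max N M"]) (simp add: lin_add[OF assms(2)])
  next
    fix c x N assume "\<forall>n\<ge>N. g n x = 0"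
    then show "\<exists>N. \<forall>n\<ge>N. g n (sc c x) = 0" by (auto simp: lin_scale[OF assms(2)])
  qed
qed

text \<open>The new vector must capture the remainder \<open>r\<close> of \<open>b\<close> exactly
  modulo the kernel of \<open>p\<close> and approximately in \<open>q\<close>. If \<open>p r\<close>
  is nonzero, a multiple of \<open>r\<close> does both. Otherwise \<open>r\<close> admits no
  functional dominated by \<open>p\<close>, so it is perturbed by a small multiple of some
  \<open>u\<close> in the common kernel with \<open>p u\<close> nonzero; infinite rank provides
  \<open>u\<close>.\<close>

lemma biorthogonal_system_step:
  fixes q :: "'a::ab_group_add \<Rightarrow> real"
  assumes p: "seminorm sc p" and q: "seminorm sc q"
    and hb: "\<And>x. p x \<noteq> 0 \<Longrightarrow> \<exists>f. dominated sc p f \<and> f x = 1"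
    and inf: "\<not> finite_rank sc p"
    and bi: "biorthogonal_upto sc E G n" and dom: "\<And>i. i < n \<Longrightarrow> dominated sc p (G i)"
    and d: "d > 0"
  obtains e g c where "dominated sc p g" "g e = 1" "\<And>i. i < n \<Longrightarrow> g (E i) = 0"
    "\<And>i. i < n \<Longrightarrow> G i e = 0" "q e \<le> 1" "q (residual sc E G n b - sc c e) < d"
    "p (residual sc E G n b - sc (g (residual sc E G n b)) e) = 0"
proof -
  interpret vector_space sc by (rule seminorm_space[OF p])
  define r where "r = residual sc E G n b"
  have Gl: "Vector_Spaces.linear sc (*) (G i)" if "i < n" for i using bi that by (simp add: biorthogonal_upto_def)
  have Gr: "G i r = 0" if "i < n" for i unfolding r_def by (rule biorthogonal_residual[OF bi that])
  have "\<exists>u. (\<forall>i<n. G i u = 0) \<and> p u \<noteq> 0"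
  proof -
    obtain x where x: "\<And>y. y \<in> span (E ` {..<n}) \<Longrightarrow> p (x - y) \<noteq> 0"
      using inf unfolding finite_rank_def by (metis finite_imageI finite_lessThan)
    have "p (x - (x - residual sc E G n x)) \<noteq> 0"
      by (rule x) (rule diff_residual_in_span[OF vector_space_axioms])
    then show ?thesis using biorthogonal_residual[OF bi] by auto
  qed
  then obtain u where u: "\<And>i. i < n \<Longrightarrow> G i u = 0" "p u \<noteq> 0" by blast
  have "\<exists>v. (\<forall>i<n. G i v = 0) \<and> p v \<noteq> 0 \<and> q (r - v) < d \<and> (p r \<noteq> 0 \<longrightarrow> v = r)"
  proof (cases "p r = 0")
    case False
    then show ?thesis using Gr d by (intro exI[of _ r]) (auto simp: seminorm_zero[OF q])
  next
    case True
    \<comment> \<open>Small enough that adding \<open>t\<close> times \<open>u\<close> moves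
      \<open>r\<close> by less than \<open>d\<close> in \<open>q\<close>; the \<open>+ 1\<close>
      covers \<open>q u = 0\<close>.\<close>
    define t where "t = d / (q u + 1)"
    have qu: "q u \<ge> 0" by (rule seminorm_nonneg[OF q])
    then have t: "t > 0" using d by (simp add: t_def add_nonneg_pos)
    define v where "v = r + sc (of_real t) u"
    have "q (r - v) = t * q u"
      using t seminorm_minus[OF q, of "sc (of_real t) u"] by (simp add: v_def seminorm_scale[OF q])
    also have "\<dots> < d" using qu d by (simp add: t_def field_simps)
    finally have "q (r - v) < d" .
    moreover have "p v \<noteq> 0"
    proof
      assume "p v = 0"
      then have "p (v - r) \<le> 0" using seminorm_diff[OF p, of v r] True by simp
      then have "t * p u \<le> 0" using t by (simp add: v_def seminorm_scale[OF p])
      then show False using t u(2) seminorm_nonneg[OF p, of u] by (simp add: mult_le_0_iff)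
    qed
    moreover have "G i v = 0" if "i < n" for i
      using Gr[OF that] u(1)[OF that] by (simp add: v_def lin_add[OF Gl[OF that]] lin_scale[OF Gl[OF that]])
    ultimately show ?thesis using True by blast
  qed
  then obtain v where v: "\<And>i. i < n \<Longrightarrow> G i v = 0" "p v \<noteq> 0" "q (r - v) < d" "p r \<noteq> 0 \<Longrightarrow> v = r"
    by blast
  define s where "s = 1 / (q v + 1)"
  have s: "s > 0" "s * q v \<le> 1" using seminorm_nonneg[OF q, of v] by (simp_all add: s_def)
  define e where "e = sc (of_real s) v"
  have v_eq: "v = sc (of_real (1 / s)) e"
    using s(1) by (simp add: e_def of_real_mult[symmetric] del: of_real_mult of_real_divide)
  have "p e \<noteq> 0" using s v(2) by (simp add: e_def seminorm_scale[OF p])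
  then obtain h where h: "dominated sc p h" "h e = 1" using hb by blast
  define g where "g x = h (residual sc E G n x)" for x
  have Ge: "G i e = 0" if "i < n" for i using v(1)[OF that] by (simp add: e_def lin_scale[OF Gl[OF that]])
  have gE: "g (E i) = 0" if "i < n" for i
    using residual_basis[OF vector_space_axioms bi that]
    by (simp add: g_def lin_zero[OF dominated_linear[OF h(1)]])
  have ge: "g e = 1" using h(2) residual_fixed[OF vector_space_axioms, of n G e E] Ge by (simp add: g_def)
  have gd: "dominated sc p g" unfolding g_def by (intro dominated_residual p h dom)
  have "p (r - sc (g r) e) = 0"
  proof (cases "p r = 0")
    case True
    then show ?thesis using dominated_vanish[OF gd True] by simp
  next
    case False
    then have r: "r = sc (of_real (1 / s)) e" using v(4) v_eq by simp
    have "g r = of_real (1 / s)"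
      unfolding r lin_scale[OF dominated_linear[OF gd]] ge by simp
    then show ?thesis using r by (simp add: seminorm_zero[OF p])
  qed
  moreover have "q (r - sc (of_real (1 / s)) e) < d" using v(3) v_eq by simp
  moreover have "q e \<le> 1" using s by (simp add: e_def seminorm_scale[OF q])
  ultimately show ?thesis using that[of g e "of_real (1 / s)"] gd ge gE Ge by (simp add: r_def)
qed

theorem biorthogonal_system_exists:
  fixes p :: "nat \<Rightarrow> 'a::ab_group_add \<Rightarrow> real" and sc :: "'k::real_normed_field \<Rightarrow> 'a \<Rightarrow> 'a"
    and b :: "nat \<Rightarrow> 'a"
  assumes sn: "\<And>k. seminorm sc (p k)" and mono: "\<And>x. mono (\<lambda>k. p k x)"
    and hb: "\<And>x. p K x \<noteq> 0 \<Longrightarrow> \<exists>f. dominated sc (p K) f \<and> f x = 1"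
    and inf: "\<not> finite_rank sc (p K)" and b: "module.span sc (range b) = UNIV"
  obtains e g where "\<And>n. dominated sc (p K) (g n)" "\<And>n m. g n (e m) = (if n = m then 1 else 0)"
    "\<And>x. \<exists>N. \<forall>n\<ge>N. g n x = 0" "\<And>n. p n (e n) \<le> 1"
    "\<And>x k d. d > 0 \<Longrightarrow> \<exists>y\<in>module.span sc (range e). p k (x - y) < d"
proof -
  interpret vector_space sc by (rule seminorm_space[OF sn])
  \<comment> \<open>Every \<open>b j\<close> is listed infinitely often. One visit makes all later
    functionals vanish at \<open>b j\<close>; further visits improve its approximation in higher
    seminorms.\<close>
  define B where "B n = b (fst (prod_decode n))" for n
  \<comment> \<open>\<open>Q f n\<close> judges the pair chosen at stage \<open>n\<close> and reads
    \<open>f\<close> only below \<open>n\<close>, as \<open>dependent_wellorder_choice\<close>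
    demands.\<close>
  define Q where "Q f n = (\<lambda>(e, g). dominated sc (p K) g \<and> g e = 1 \<and>
      (\<forall>i<n. g (fst (f i)) = 0 \<and> snd (f i) e = 0) \<and> p n e \<le> 1 \<and>
      (\<exists>c. p n (residual sc (\<lambda>i. fst (f i)) (\<lambda>i. snd (f i)) n (B n) - sc c e) < 1 / Suc n) \<and>
      p K (residual sc (\<lambda>i. fst (f i)) (\<lambda>i. snd (f i)) n (B n) -
        sc (g (residual sc (\<lambda>i. fst (f i)) (\<lambda>i. snd (f i)) n (B n))) e) = 0)" for f :: "nat \<Rightarrow> 'a \<times> ('a \<Rightarrow> 'k)" and n
  have bi: "biorthogonal_upto sc (\<lambda>i. fst (f i)) (\<lambda>i. snd (f i)) n" if "\<And>i. i < n \<Longrightarrow> Q f i (f i)" for f n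
    using that
  proof (induction n)
    case (Suc n)
    then have "Q f n (f n)" "biorthogonal_upto sc (\<lambda>i. fst (f i)) (\<lambda>i. snd (f i)) n" by auto
    then show ?case
      by (intro biorthogonal_upto_Suc) (auto simp: Q_def case_prod_beta dominated_def)
  qed (simp add: biorthogonal_upto_def)
  have "\<exists>f. \<forall>n. Q f n (f n)"
  proof (rule dependent_wellorder_choice)
    fix r and f f' :: "nat \<Rightarrow> 'a \<times> ('a \<Rightarrow> 'k)" and n :: nat
    assume eq: "\<And>i. i < n \<Longrightarrow> f i = f' i"
    have "residual sc (\<lambda>i. fst (f i)) (\<lambda>i. snd (f i)) n x = residual sc (\<lambda>i. fst (f' i)) (\<lambda>i. snd (f' i)) n x" for x
      by (rule residual_cong) (simp_all add: eq)
    then show "Q f n r = Q f' n r" by (simp add: Q_def eq)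
  next
    fix n and f :: "nat \<Rightarrow> 'a \<times> ('a \<Rightarrow> 'k)"
    assume IH: "\<And>i. i < n \<Longrightarrow> Q f i (f i)"
    have dom: "dominated sc (p K) (snd (f i))" if "i < n" for i
      using IH[OF that] by (simp add: Q_def case_prod_beta)
    have bi': "biorthogonal_upto sc (\<lambda>i. fst (f i)) (\<lambda>i. snd (f i)) n" by (rule bi[OF IH])
    show "\<exists>r. Q f n r"
    proof (rule biorthogonal_system_step[OF sn sn hb inf bi' dom, where d = "1 / Suc n" and b = "B n"])
      fix e g c
      assume "dominated sc (p K) g" "g e = 1" "\<And>i. i < n \<Longrightarrow> g (fst (f i)) = 0"
        "\<And>i. i < n \<Longrightarrow> snd (f i) e = 0" "p n e \<le> 1"
        "p n (residual sc (\<lambda>i. fst (f i)) (\<lambda>i. snd (f i)) n (B n) - sc c e) < 1 / Suc n"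
        "p K (residual sc (\<lambda>i. fst (f i)) (\<lambda>i. snd (f i)) n (B n) -
          sc (g (residual sc (\<lambda>i. fst (f i)) (\<lambda>i. snd (f i)) n (B n))) e) = 0"
      then show ?thesis by (intro exI[of _ "(e, g)"]) (auto simp: Q_def)
    qed auto
  qed
  then obtain f where f: "\<And>n. Q f n (f n)" by blast
  define e where "e n = fst (f n)" for n
  define g where "g n = snd (f n)" for n
  have bi: "biorthogonal_upto sc e g n" for n
    unfolding e_def[abs_def] g_def[abs_def] by (rule bi[OF f])
  have dom: "dominated sc (p K) (g n)" and e1: "p n (e n) \<le> 1"
    and approx: "\<exists>c. p n (residual sc e g n (B n) - sc c (e n)) < 1 / Suc n"
    and fin: "p K (residual sc e g n (B n) - sc (g n (residual sc e g n (B n))) (e n)) = 0" for n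
    using f[of n] by (simp_all add: Q_def case_prod_beta e_def[abs_def] g_def[abs_def])
  have orth: "g n (e m) = (if n = m then 1 else 0)" for n m
    using bi[of "Suc (max n m)"] by (auto simp: biorthogonal_upto_def)
  note gl = dominated_linear[OF dom]
  show ?thesis
  proof (rule that[OF dom orth _ e1])
    let ?V = "{x. \<exists>N. \<forall>n\<ge>N. g n x = 0}"
    have "b j \<in> ?V" for j
    proof -
      \<comment> \<open>After this stage the remainder of \<open>b j\<close> lies in the kernel of
        \<open>p K\<close>. Every later functional is dominated by \<open>p K\<close> and therefore
        vanishes at \<open>b j\<close>.\<close>
      define n where "n = prod_encode (j, 0)"
      have Bn: "B n = b j" by (simp add: B_def n_def)
      have "g n (residual sc e g n (b j)) = g n (b j)"
        by (rule functional_residual_eq[OF gl]) (simp add: orth)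
      then have z: "p K (residual sc e g (Suc n) (b j)) = 0" using fin[of n] by (simp add: Bn residual_Suc)
      have "g m (b j) = 0" if "m \<ge> Suc n" for m
      proof -
        have "g m (residual sc e g (Suc n) (b j)) = g m (b j)"
          using that by (intro functional_residual_eq[OF gl]) (simp add: orth)
        then show ?thesis using dominated_vanish[OF dom z] by simp
      qed
      then show ?thesis by blast
    qed
    then have "span (range b) \<subseteq> ?V"
      by (intro span_minimal subspace_finitely_many_nonzero vector_space_axioms gl) auto
    then show "\<exists>N. \<forall>n\<ge>N. g n x = 0" for x using b by blast
  next
    let ?V = "{x. \<forall>k. \<forall>d>0. \<exists>y\<in>span (range e). p k (x - y) < d}"
    have "b j \<in> ?V" for j
    proof (intro CollectI allI impI)
      fix k and d :: real assume d: "d > 0"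
      then obtain l where l: "inverse (real (Suc l)) < d" using reals_Archimedean by blast
      \<comment> \<open>This visit to \<open>b j\<close> happens at a stage at least
        \<open>k\<close> and \<open>l\<close>, so \<open>p k\<close> is below \<open>p n\<close> and
        the tolerance \<open>1 / Suc n\<close> is below \<open>d\<close>.\<close>
      define n where "n = prod_encode (j, max k l)"
      have Bn: "B n = b j" and kn: "k \<le> n" and ln: "l \<le> n"
        using le_prod_encode_2[of "max k l" j] by (simp_all add: B_def n_def)
      obtain c where c: "p n (residual sc e g n (b j) - sc c (e n)) < 1 / Suc n"
        using approx[of n] by (auto simp: Bn)
      let ?y = "(b j - residual sc e g n (b j)) + sc c (e n)"
      have "b j - residual sc e g n (b j) \<in> span (range e)"
        using diff_residual_in_span[OF vector_space_axioms, of "b j" e g n] span_mono[of "e ` {..<n}" "range e"] by blast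
      then have y: "?y \<in> span (range e)" by (intro span_add span_scale[OF span_base]) auto
      have "p k (b j - ?y) \<le> p n (b j - ?y)" using monoD[OF mono kn] .
      also have "\<dots> < 1 / Suc n" using c by (simp add: algebra_simps)
      also have "\<dots> \<le> inverse (real (Suc l))" using ln by (simp add: field_simps)
      finally show "\<exists>y\<in>span (range e). p k (b j - y) < d" using y l by force
    qed
    moreover have "subspace ?V"
    proof (rule subspaceI)
      show "0 \<in> ?V" using span_zero by (auto simp: seminorm_zero[OF sn] intro!: bexI[of _ 0])
    next
      fix x y assume xy: "x \<in> ?V" "y \<in> ?V"
      show "x + y \<in> ?V"
      proof (intro CollectI allI impI)
        fix k and d :: real assume "d > 0"
        then have "d / 2 > 0" by simp
        with xy have "\<exists>u\<in>span (range e). p k (x - u) < d / 2" "\<exists>v\<in>span (range e). p k (y - v) < d / 2"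
          by blast+
        then obtain u v where uv: "u \<in> span (range e)" "v \<in> span (range e)" "p k (x - u) < d / 2" "p k (y - v) < d / 2"
          by blast
        have "p k ((x + y) - (u + v)) \<le> p k (x - u) + p k (y - v)"
          using seminorm_triangle[OF sn, of k "x - u" "y - v"] by (simp add: algebra_simps)
        then show "\<exists>w\<in>span (range e). p k (x + y - w) < d"
          using uv by (intro bexI[of _ "u + v"] span_add) auto
      qed
    next
      fix c x assume x: "x \<in> ?V"
      show "sc c x \<in> ?V"
      proof (intro CollectI allI impI)
        fix k and d :: real assume d: "d > 0"
        have "d / (norm c + 1) > 0" using d by (simp add: add_nonneg_pos)
        then obtain u where u: "u \<in> span (range e)" "p k (x - u) < d / (norm c + 1)" using x by blast
        have "p k (sc c x - sc c u) = norm c * p k (x - u)"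
          by (simp add: scale_right_diff_distrib[symmetric] seminorm_scale[OF sn])
        also have "\<dots> \<le> (norm c + 1) * p k (x - u)"
          by (intro mult_right_mono seminorm_nonneg[OF sn]) auto
        also have "\<dots> < d"
          using u(2) by (subst (asm) pos_less_divide_eq) (simp_all add: add_nonneg_pos mult.commute)
        finally show "\<exists>w\<in>span (range e). p k (sc c x - w) < d" using u by (intro bexI[of _ "sc c u"] span_scale)
      qed
    qed
    ultimately have "span (range b) \<subseteq> ?V" by (intro span_minimal) auto
    then show "\<exists>y\<in>span (range e). p k (x - y) < d" if "d > 0" for x k d using b that by blast
  qed
qed

section \<open>Dual bases when every seminorm has finite rank\<close>

lemma finite_rank_triangular:
  assumes p: "seminorm sc p" and fr: "finite_rank sc p" and inf: "infinite (A :: nat set)"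
    and h: "\<And>n. n \<in> A \<Longrightarrow> dominated sc p (h n)" and one: "\<And>n. n \<in> A \<Longrightarrow> h n (e n) = 1"
    and zero: "\<And>n m. n \<in> A \<Longrightarrow> m \<in> A \<Longrightarrow> n < m \<Longrightarrow> h n (e m) = 0"
  shows False
proof -
  interpret vector_space sc by (rule seminorm_space[OF p])
  \<comment> \<open>Functionals dominated by \<open>p\<close> do not see its kernel, so the
    \<open>e n\<close> may be replaced by representatives in a finite-dimensional span. The
    triangular shape makes these independent, and there are too many of them.\<close>
  obtain F where F: "finite F" "\<And>x. \<exists>y\<in>span F. p (x - y) = 0" using fr by (auto simp: finite_rank_def)
  have "\<forall>n. \<exists>y. y \<in> span F \<and> p (e n - y) = 0" using F(2) by blast
  then obtain y where y: "\<And>n. y n \<in> span F" "\<And>n. p (e n - y n) = 0" by metis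
  have hy: "h n (y m) = h n (e m)" if "n \<in> A" for n m
    using dominated_vanish[OF h[OF that] y(2)[of m]] by (simp add: lin_diff[OF dominated_linear[OF h[OF that]]])
  \<comment> \<open>The induction inserts a new smallest index \<open>n\<close>: the functional
    \<open>h n\<close> kills all representatives already present but not \<open>y n\<close>.\<close>
  have ind: "independent (y ` S) \<and> card (y ` S) = card S" if "finite S" "S \<subseteq> A" for S
    using that
  proof (induction S rule: finite_linorder_min_induct)
    case (insert n S)
    then have n: "n \<in> A" by simp
    have "\<forall>v\<in>y ` S. h n v = 0" using insert by (auto simp: hy zero)
    then have "h n x = 0" if "x \<in> span (y ` S)" for x
      using functional_span_zero[OF dominated_linear[OF h[OF n]]] that by blast
    moreover have "h n (y n) \<noteq> 0" using hy[OF n] one[OF n] by simp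
    ultimately have y: "y n \<notin> span (y ` S)" by blast
    then have "y n \<notin> y ` S" using span_base by blast
    moreover have "n \<notin> S" using insert.hyps(2) by blast
    ultimately show ?case using insert y by (simp add: independent_insertI)
  qed (simp add: independent_empty)
  obtain S where S: "S \<subseteq> A" "finite S" "card S = Suc (card F)"
    using infinite_arbitrarily_large[OF inf] by blast
  have "y ` S \<subseteq> span F" using y(1) by blast
  then have "card (y ` S) \<le> card F"
    using independent_span_bound[OF F(1), of "y ` S"] ind[OF S(2,1)] by blast
  then show False using ind[OF S(2,1)] S(3) by simp
qed

text \<open>The earlier functionals may belong to different seminorms, so \<open>g\<close> is
  dominated only by some larger \<open>p l\<close>. On their common kernel it still agrees with a
  functional dominated by \<open>p k\<close> itself; the finite rank of \<open>p k\<close> is later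
  played against this.\<close>

lemma biorthogonal_basis_step:
  fixes p :: "nat \<Rightarrow> 'a::ab_group_add \<Rightarrow> real" and sc :: "'k::real_normed_field \<Rightarrow> 'a \<Rightarrow> 'a"
  assumes sn: "\<And>k. seminorm sc (p k)" and mono: "\<And>x. mono (\<lambda>k. p k x)"
    and hb: "\<And>k x. p k x \<noteq> 0 \<Longrightarrow> \<exists>f. dominated sc (p k) f \<and> f x = 1"
    and bi: "biorthogonal_upto sc E G n" and dom: "\<And>i. i < n \<Longrightarrow> \<exists>k. dominated sc (p k) (G i)"
    and e: "\<And>i. i < n \<Longrightarrow> G i e = 0" "p k e \<noteq> 0"
  obtains g where "\<exists>l. dominated sc (p l) g" "g e = 1" "\<And>i. i < n \<Longrightarrow> g (E i) = 0"
    "\<exists>h. dominated sc (p k) h \<and> (\<forall>w. (\<forall>i<n. G i w = 0) \<longrightarrow> h w = g w)"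
proof -
  interpret vector_space sc by (rule seminorm_space[OF sn])
  obtain h where h: "dominated sc (p k) h" "h e = 1" using hb[OF e(2)] by blast
  obtain \<kappa> where \<kappa>: "\<And>i. i < n \<Longrightarrow> dominated sc (p (\<kappa> i)) (G i)" using dom by metis
  define l where "l = k + (\<Sum>i<n. \<kappa> i)"
  have le: "p m x \<le> p l x" if "m \<le> l" for m x using monoD[OF mono that] .
  have \<kappa>l: "\<kappa> i \<le> l" if "i < n" for i
    unfolding l_def by (rule trans_le_add2) (rule member_le_sum, use that in auto)
  have "dominated sc (p l) (\<lambda>x. h (residual sc E G n x))"
  proof (rule dominated_residual[OF sn])
    show "dominated sc (p l) h" by (rule dominated_mono[OF sn h(1) le]) (simp add: l_def)
    show "dominated sc (p l) (G i)" if "i < n" for i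
      by (rule dominated_mono[OF sn \<kappa>[OF that] le[OF \<kappa>l[OF that]]])
  qed
  moreover have eq: "h (residual sc E G n w) = h w" if "\<forall>i<n. G i w = 0" for w
    using residual_fixed[OF vector_space_axioms, of n G w E] that by simp
  moreover have "h (residual sc E G n (E i)) = 0" if "i < n" for i
    using residual_basis[OF vector_space_axioms bi that] by (simp add: lin_zero[OF dominated_linear[OF h(1)]])
  ultimately show ?thesis using h e(1)
    by (intro that[of "\<lambda>x. h (residual sc E G n x)"]) (auto intro!: exI[of _ h])
qed

theorem biorthogonal_basis_exists:
  fixes p :: "nat \<Rightarrow> 'a::ab_group_add \<Rightarrow> real" and sc :: "'k::real_normed_field \<Rightarrow> 'a \<Rightarrow> 'a"
    and b :: "nat \<Rightarrow> 'a"
  assumes sn: "\<And>k. seminorm sc (p k)" and mono: "\<And>x. mono (\<lambda>k. p k x)"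
    and sep: "\<And>x. x \<noteq> 0 \<Longrightarrow> \<exists>k. p k x \<noteq> 0"
    and hb: "\<And>k x. p k x \<noteq> 0 \<Longrightarrow> \<exists>f. dominated sc (p k) f \<and> f x = 1"
    and fr: "\<And>k. finite_rank sc (p k)" and b: "module.span sc (range b) = UNIV"
    and inf: "\<And>F. finite F \<Longrightarrow> module.span sc F \<noteq> UNIV"
  obtains e g where "\<And>n. \<exists>k. dominated sc (p k) (g n)" "\<And>n m. g n (e m) = (if n = m then 1 else 0)"
    "\<And>x. \<exists>N. \<forall>n\<ge>N. residual sc e g n x = 0" "\<And>k. \<exists>N. \<forall>n\<ge>N. p k (e n) = 0"
proof -
  interpret vector_space sc by (rule seminorm_space[OF sn])
  \<comment> \<open>Even stages \<open>2 * j\<close> absorb \<open>b j\<close> into the span of the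
    \<open>e n\<close>. Odd stages serve the seminorm of index \<open>\<kappa> n\<close>, and each
    index occurs infinitely often among them.\<close>
  define \<kappa> where "\<kappa> n = fst (prod_decode (n div 2))" for n
  define E where "E f i = fst (f i)" for f :: "nat \<Rightarrow> 'a \<times> ('a \<Rightarrow> 'k)" and i
  define G where "G f i = snd (f i)" for f :: "nat \<Rightarrow> 'a \<times> ('a \<Rightarrow> 'k)" and i
  define Q where "Q f n = (\<lambda>(e, g). (\<exists>k. dominated sc (p k) g) \<and> g e = 1 \<and>
      (\<forall>i<n. g (E f i) = 0 \<and> G f i e = 0) \<and>
      (even n \<longrightarrow> residual sc (E f) (G f) n (b (n div 2)) \<noteq> 0 \<longrightarrow> e = residual sc (E f) (G f) n (b (n div 2))) \<and>
      (odd n \<longrightarrow> (\<exists>w. (\<forall>i<n. G f i w = 0) \<and> p (\<kappa> n) w \<noteq> 0) \<longrightarrow>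
        (\<exists>h. dominated sc (p (\<kappa> n)) h \<and> (\<forall>w. (\<forall>i<n. G f i w = 0) \<longrightarrow> h w = g w))))"
    for f :: "nat \<Rightarrow> 'a \<times> ('a \<Rightarrow> 'k)" and n
  have bi: "biorthogonal_upto sc (E f) (G f) n" if "\<And>i. i < n \<Longrightarrow> Q f i (f i)" for f n
    using that
  proof (induction n)
    case (Suc n)
    then have Q: "Q f n (f n)" and IH: "biorthogonal_upto sc (E f) (G f) n" by auto
    have "\<exists>k. dominated sc (p k) (G f n)" and "G f n (E f n) = 1"
      and "\<forall>i<n. G f n (E f i) = 0 \<and> G f i (E f n) = 0"
      using Q by (simp_all add: Q_def case_prod_beta E_def[of f n] G_def[of f n])
    then show ?case using IH by (intro biorthogonal_upto_Suc) (auto simp: dominated_def)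
  qed (simp add: biorthogonal_upto_def)
  have "\<exists>f. \<forall>n. Q f n (f n)"
  proof (rule dependent_wellorder_choice)
    fix r and f f' :: "nat \<Rightarrow> 'a \<times> ('a \<Rightarrow> 'k)" and n :: nat
    assume eq: "\<And>i. i < n \<Longrightarrow> f i = f' i"
    then have EG: "E f i = E f' i" "G f i = G f' i" if "i < n" for i using that by (simp_all add: E_def G_def)
    then have "residual sc (E f) (G f) n x = residual sc (E f') (G f') n x" for x
      by (intro residual_cong) simp_all
    then show "Q f n r = Q f' n r" by (simp add: Q_def EG)
  next
    fix n and f :: "nat \<Rightarrow> 'a \<times> ('a \<Rightarrow> 'k)"
    assume IH: "\<And>i. i < n \<Longrightarrow> Q f i (f i)"
    have bi': "biorthogonal_upto sc (E f) (G f) n" by (rule bi[OF IH])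
    have dom: "\<exists>k. dominated sc (p k) (G f i)" if "i < n" for i
      using IH[OF that] by (simp add: Q_def G_def case_prod_beta)
    let ?W = "\<lambda>w. \<forall>i<n. G f i w = 0"
    let ?r = "residual sc (E f) (G f) n (b (n div 2))"
    have res: "?W (residual sc (E f) (G f) n x)" for x using biorthogonal_residual[OF bi'] by blast
    have "\<exists>x. residual sc (E f) (G f) n x \<noteq> 0"
    proof -
      have "span (E f ` {..<n}) \<noteq> UNIV" by (rule inf) simp
      then obtain x where "x \<notin> span (E f ` {..<n})" by blast
      then show ?thesis using diff_residual_in_span[OF vector_space_axioms, of x "E f" "G f" n]
        by (intro exI[of _ x]) auto
    qed
    then obtain u where u: "?W u" "u \<noteq> 0" using res by blast
    have "\<exists>e k. ?W e \<and> p k e \<noteq> 0 \<and> (even n \<longrightarrow> ?r \<noteq> 0 \<longrightarrow> e = ?r) \<and>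
       (odd n \<longrightarrow> (\<exists>w. ?W w \<and> p (\<kappa> n) w \<noteq> 0) \<longrightarrow> k = \<kappa> n)"
    proof (cases "even n")
      case True
      then show ?thesis using u res[of "b (n div 2)"] sep by (cases "?r = 0") blast+
    next
      case False
      then show ?thesis using u sep by (cases "\<exists>w. ?W w \<and> p (\<kappa> n) w \<noteq> 0") blast+
    qed
    then obtain e k where e: "?W e" "p k e \<noteq> 0" "even n \<longrightarrow> ?r \<noteq> 0 \<longrightarrow> e = ?r"
       "odd n \<longrightarrow> (\<exists>w. ?W w \<and> p (\<kappa> n) w \<noteq> 0) \<longrightarrow> k = \<kappa> n" by blast
    show "\<exists>r. Q f n r"
    proof (rule biorthogonal_basis_step[OF sn mono hb bi' dom _ e(2)])
      fix g assume "\<exists>l. dominated sc (p l) g" "g e = 1" "\<And>i. i < n \<Longrightarrow> g (E f i) = 0"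
        "\<exists>h. dominated sc (p k) h \<and> (\<forall>w. ?W w \<longrightarrow> h w = g w)"
      then show ?thesis using e by (intro exI[of _ "(e, g)"]) (auto simp: Q_def)
    qed (use e in auto)
  qed
  then obtain f where f: "\<And>n. Q f n (f n)" by blast
  define e where "e = E f"
  define g where "g = G f"
  have bi: "biorthogonal_upto sc e g n" for n unfolding e_def g_def by (rule bi[OF f])
  have dom: "\<exists>k. dominated sc (p k) (g n)"
    and even: "even n \<Longrightarrow> residual sc e g n (b (n div 2)) \<noteq> 0 \<Longrightarrow> e n = residual sc e g n (b (n div 2))"
    and odd: "odd n \<Longrightarrow> (\<And>i. i < n \<Longrightarrow> g i w = 0) \<Longrightarrow> p (\<kappa> n) w \<noteq> 0 \<Longrightarrow>
        \<exists>h. dominated sc (p (\<kappa> n)) h \<and> (\<forall>w. (\<forall>i<n. g i w = 0) \<longrightarrow> h w = g n w)" for n w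
    using f[of n] by (auto simp: Q_def case_prod_beta e_def g_def E_def[of f n] G_def[of f n])
  have orth: "g n (e m) = (if n = m then 1 else 0)" for n m
    using bi[of "Suc (max n m)"] by (auto simp: biorthogonal_upto_def)
  have gl: "Vector_Spaces.linear sc (*) (g n)" for n using dom dominated_linear by blast
  show ?thesis
  proof (rule that[OF dom orth])
    let ?V = "{x. \<exists>N. \<forall>n\<ge>N. residual sc e g n x = 0}"
    have step: "residual sc e g m x = 0" if "residual sc e g n x = 0" "m \<ge> n" for m n x
      using that(2)
    proof (induction m rule: dec_induct)
      case (step m)
      have "g m (residual sc e g m x) = g m x" by (rule functional_residual_eq[OF gl]) (simp add: orth)
      then show ?case using step by (simp add: residual_Suc lin_zero[OF gl])
    qed (rule that(1))
    have "b j \<in> ?V" for j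
    proof -
      have "residual sc e g (Suc (2 * j)) (b j) = 0"
      proof (cases "residual sc e g (2 * j) (b j) = 0")
        case False
        then have r: "e (2 * j) = residual sc e g (2 * j) (b j)" using even[of "2 * j"] by simp
        have "g (2 * j) (residual sc e g (2 * j) (b j)) = g (2 * j) (b j)"
          by (rule functional_residual_eq[OF gl]) (simp add: orth)
        then have "g (2 * j) (b j) = 1" unfolding r[symmetric] by (simp add: orth)
        then show ?thesis by (simp add: residual_Suc r[symmetric])
      qed (rule step, auto)
      then show ?thesis using step by blast
    qed
    moreover have "subspace ?V"
    proof (rule subspaceI; clarsimp)
      have add: "residual sc e g n (x + y) = residual sc e g n x + residual sc e g n y" for n x y
        by (simp add: residual_def lin_add[OF gl] scale_left_distrib sum.distrib)
      have scale: "residual sc e g n (sc c x) = sc c (residual sc e g n x)" for n c x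
        by (simp add: residual_def lin_scale[OF gl] scale_right_diff_distrib scale_sum_right)
      show "\<exists>N. \<forall>n\<ge>N. residual sc e g n 0 = 0" by (simp add: residual_def lin_zero[OF gl])
      show "\<exists>N. \<forall>n\<ge>N. residual sc e g n (sc c x) = 0"
        if "\<forall>n\<ge>N. residual sc e g n x = 0" for c x N using that by (auto simp: scale)
      show "\<exists>N. \<forall>n\<ge>N. residual sc e g n (x + y) = 0"
        if "\<forall>n\<ge>N. residual sc e g n x = 0" "\<forall>n\<ge>M. residual sc e g n y = 0" for x y N M
        using that by (intro exI[of _ "max N M"]) (simp add: add)
    qed
    ultimately have "span (range b) \<subseteq> ?V" by (intro span_minimal) auto
    then show "\<exists>N. \<forall>n\<ge>N. residual sc e g n x = 0" for x using b by blast
  next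
    fix k
    have "\<exists>N. \<forall>w. (\<forall>i<N. g i w = 0) \<longrightarrow> p k w = 0"
    proof (rule ccontr)
      \<comment> \<open>If \<open>p k\<close> is nonzero on all these common kernels, every odd
        stage assigned to \<open>k\<close> yields a functional dominated by \<open>p k\<close>.
        Together with the \<open>e n\<close> these form an infinite triangular system, against
        finite rank.\<close>
      assume neg: "\<not> (\<exists>N. \<forall>w. (\<forall>i<N. g i w = 0) \<longrightarrow> p k w = 0)"
      define A where "A = range (\<lambda>l. Suc (2 * prod_encode (k, l)))"
      have "infinite A" unfolding A_def by (rule range_inj_infinite) (auto simp: inj_on_def)
      have \<kappa>: "\<kappa> n = k" "odd n" if "n \<in> A" for n using that by (auto simp: A_def \<kappa>_def)
      have "\<forall>n. \<exists>h. n \<in> A \<longrightarrow> dominated sc (p k) h \<and> (\<forall>w. (\<forall>i<n. g i w = 0) \<longrightarrow> h w = g n w)"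
      proof
        fix n
        obtain w where "\<forall>i<n. g i w = 0" "p k w \<noteq> 0" using neg by blast
        then show "\<exists>h. n \<in> A \<longrightarrow> dominated sc (p k) h \<and> (\<forall>w. (\<forall>i<n. g i w = 0) \<longrightarrow> h w = g n w)"
          using odd[of n w] \<kappa>[of n] by blast
      qed
      then obtain h where h: "\<And>n. n \<in> A \<Longrightarrow> dominated sc (p k) (h n)"
          "\<And>n w. n \<in> A \<Longrightarrow> \<forall>i<n. g i w = 0 \<Longrightarrow> h n w = g n w" by metis
      show False
        by (rule finite_rank_triangular[OF sn fr \<open>infinite A\<close> h(1), where e = e])
           (auto simp: h(2) orth)
    qed
    then obtain N where N: "\<And>w. \<forall>i<N. g i w = 0 \<Longrightarrow> p k w = 0" by blast
    show "\<exists>N. \<forall>n\<ge>N. p k (e n) = 0" by (intro exI[of _ N] allI impI N) (auto simp: orth)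
  qed
qed

section \<open>The space of absolutely summable sequences\<close>

text \<open>A type of its own, so that norm topology and completeness come from type classes.
  Completeness serves the Baire argument and the absolutely convergent series defining the
  operator.\<close>

typedef (overloaded) 'k l1 = "{a :: nat \<Rightarrow> 'k::real_normed_vector. summable (\<lambda>j. norm (a j))}"
  morphisms l1_nth Abs_l1
  by (rule exI[of _ "\<lambda>_. 0"]) simp

setup_lifting type_definition_l1

lemma summable_l1_nth: "summable (\<lambda>j. norm (l1_nth a j))"
  using l1_nth by auto

lemma l1_eqI: "(\<And>j. l1_nth a j = l1_nth b j) \<Longrightarrow> a = b"
  by (metis ext l1_nth_inject)

instantiation l1 :: (real_normed_vector) real_normed_vector
begin

lift_definition zero_l1 :: "'a l1" is "\<lambda>_. 0" by simp

lift_definition plus_l1 :: "'a l1 \<Rightarrow> 'a l1 \<Rightarrow> 'a l1" is "\<lambda>a b j. a j + b j"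
proof -
  fix a b :: "nat \<Rightarrow> 'a" assume "summable (\<lambda>j. norm (a j))" "summable (\<lambda>j. norm (b j))"
  then show "summable (\<lambda>j. norm (a j + b j))"
    by (rule summable_comparison_test'[OF summable_add, of _ _ 0]) (simp add: norm_triangle_ineq)
qed

lift_definition minus_l1 :: "'a l1 \<Rightarrow> 'a l1 \<Rightarrow> 'a l1" is "\<lambda>a b j. a j - b j"
proof -
  fix a b :: "nat \<Rightarrow> 'a" assume "summable (\<lambda>j. norm (a j))" "summable (\<lambda>j. norm (b j))"
  then show "summable (\<lambda>j. norm (a j - b j))"
    by (rule summable_comparison_test'[OF summable_add, of _ _ 0]) (simp add: norm_triangle_ineq4)
qed

lift_definition uminus_l1 :: "'a l1 \<Rightarrow> 'a l1" is "\<lambda>a j. - a j" by simp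

lift_definition scaleR_l1 :: "real \<Rightarrow> 'a l1 \<Rightarrow> 'a l1" is "\<lambda>c a j. c *\<^sub>R a j"
  by (simp add: summable_mult)

lift_definition norm_l1 :: "'a l1 \<Rightarrow> real" is "\<lambda>a. \<Sum>j. norm (a j)" .

definition sgn_l1 :: "'a l1 \<Rightarrow> 'a l1" where "sgn_l1 a = inverse (norm a) *\<^sub>R a"
definition dist_l1 :: "'a l1 \<Rightarrow> 'a l1 \<Rightarrow> real" where "dist_l1 a b = norm (a - b)"
definition uniformity_l1 :: "('a l1 \<times> 'a l1) filter"
  where "uniformity_l1 = (INF e\<in>{0<..}. principal {(x, y). dist x y < e})"
definition open_l1 :: "'a l1 set \<Rightarrow> bool"
  where "open_l1 U = (\<forall>x\<in>U. eventually (\<lambda>(x', y). x' = x \<longrightarrow> y \<in> U) uniformity)"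

instance
proof
  fix a b :: "'a l1" and r s :: real
  show "(norm a = 0) = (a = 0)"
  proof transfer
    fix a :: "nat \<Rightarrow> 'a" assume "summable (\<lambda>j. norm (a j))"
    then show "((\<Sum>j. norm (a j)) = 0) = (a = (\<lambda>_. 0))"
      by (subst suminf_eq_zero_iff) (auto simp: fun_eq_iff)
  qed
  show "norm (a + b) \<le> norm a + norm b"
  proof transfer
    fix a b :: "nat \<Rightarrow> 'a"
    assume a: "summable (\<lambda>j. norm (a j))" and b: "summable (\<lambda>j. norm (b j))"
    have "summable (\<lambda>j. norm (a j + b j))"
      by (rule summable_comparison_test'[OF summable_add[OF a b]]) (auto simp: norm_triangle_ineq)
    then have "(\<Sum>j. norm (a j + b j)) \<le> (\<Sum>j. norm (a j) + norm (b j))"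
      by (intro suminf_le norm_triangle_ineq summable_add a b)
    then show "(\<Sum>j. norm (a j + b j)) \<le> (\<Sum>j. norm (a j)) + (\<Sum>j. norm (b j))"
      by (simp add: suminf_add[OF a b])
  qed
  show "norm (r *\<^sub>R a) = \<bar>r\<bar> * norm a"
    by transfer (simp add: suminf_mult)
  show "a + b + x = a + (b + x)" "a + b = b + a" "0 + a = a" "- a + a = 0" "a - b = a + - b"
    "r *\<^sub>R (a + b) = r *\<^sub>R a + r *\<^sub>R b" "(r + s) *\<^sub>R a = r *\<^sub>R a + s *\<^sub>R a"
    "r *\<^sub>R s *\<^sub>R a = (r * s) *\<^sub>R a" "1 *\<^sub>R a = a" for x
    by (transfer; simp add: algebra_simps)+
qed (simp_all add: sgn_l1_def dist_l1_def uniformity_l1_def open_l1_def)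

end

lemma l1_nth_simps [simp]:
  "l1_nth 0 j = 0" "l1_nth (a + b) j = l1_nth a j + l1_nth b j"
  "l1_nth (a - b) j = l1_nth a j - l1_nth b j" "l1_nth (- a) j = - l1_nth a j"
  by (transfer; simp)+

lemma l1_nth_sum [simp]: "l1_nth (\<Sum>i\<in>I. f i) j = (\<Sum>i\<in>I. l1_nth (f i) j)"
  by (induction I rule: infinite_finite_induct) auto

lemma norm_l1_eq: "norm a = (\<Sum>j. norm (l1_nth a j))"
  by transfer simp

lemma norm_l1_nth_le: "norm (l1_nth a j) \<le> norm a"
proof -
  have "(\<Sum>i\<in>{j}. norm (l1_nth a i)) \<le> (\<Sum>i. norm (l1_nth a i))"
    by (rule sum_le_suminf[OF summable_l1_nth]) auto
  then show ?thesis by (simp add: norm_l1_eq)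
qed

instance l1 :: (banach) banach
proof
  fix X :: "nat \<Rightarrow> 'a l1" assume X: "Cauchy X"
  have "Cauchy (\<lambda>n. l1_nth (X n) j)" for j
  proof (rule CauchyI)
    fix e :: real assume "e > 0"
    then obtain M where M: "\<And>m n. m \<ge> M \<Longrightarrow> n \<ge> M \<Longrightarrow> norm (X m - X n) < e"
      using CauchyD[OF X] by blast
    have "norm (l1_nth (X m) j - l1_nth (X n) j) < e" if "m \<ge> M" "n \<ge> M" for m n
      using norm_l1_nth_le[of "X m - X n" j] M[OF that] by simp
    then show "\<exists>M. \<forall>m\<ge>M. \<forall>n\<ge>M. norm (l1_nth (X m) j - l1_nth (X n) j) < e" by blast
  qed
  then have "\<forall>j. \<exists>l. (\<lambda>n. l1_nth (X n) j) \<longlonglongrightarrow> l"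
    by (simp add: Cauchy_convergent_iff convergent_def)
  then obtain L where L: "\<And>j. (\<lambda>n. l1_nth (X n) j) \<longlonglongrightarrow> L j" by metis
  \<comment> \<open>Finite partial sums pass to the limit in \<open>n\<close>, with a bound
    independent of \<open>k\<close>. This gives both summability of the pointwise limit and
    convergence in norm.\<close>
  have part: "(\<Sum>j<k. norm (l1_nth (X m) j - L j)) \<le> e"
    if e: "\<And>n. n \<ge> M \<Longrightarrow> norm (X m - X n) < e" for M m e k
  proof (rule LIMSEQ_le_const2)
    show "(\<lambda>n. \<Sum>j<k. norm (l1_nth (X m) j - l1_nth (X n) j)) \<longlonglongrightarrow> (\<Sum>j<k. norm (l1_nth (X m) j - L j))"
      by (intro tendsto_intros L)
    have "(\<Sum>j<k. norm (l1_nth (X m) j - l1_nth (X n) j)) \<le> e" if "n \<ge> M" for n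
    proof -
      have "(\<Sum>j<k. norm (l1_nth (X m - X n) j)) \<le> norm (X m - X n)"
        unfolding norm_l1_eq by (rule sum_le_suminf[OF summable_l1_nth]) auto
      then show ?thesis using e[OF that] by simp
    qed
    then show "\<exists>N. \<forall>n\<ge>N. (\<Sum>j<k. norm (l1_nth (X m) j - l1_nth (X n) j)) \<le> e" by blast
  qed
  have summ: "summable (\<lambda>j. norm (l1_nth (X m) j - L j))"
    if e: "\<And>n. n \<ge> M \<Longrightarrow> norm (X m - X n) < e" for M m e
    by (rule bounded_imp_summable[of _ e]) (use part[OF e] in \<open>simp_all only: lessThan_Suc_atMost[symmetric] norm_ge_zero\<close>)
  obtain M1 where M1: "\<And>m n. m \<ge> M1 \<Longrightarrow> n \<ge> M1 \<Longrightarrow> norm (X m - X n) < 1"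
    using CauchyD[OF X, of 1] by auto
  have "summable (\<lambda>j. norm (l1_nth (X M1) j) + norm (l1_nth (X M1) j - L j))"
    by (intro summable_add summable_l1_nth summ[of M1 M1 1] M1) auto
  moreover have "norm (norm (L j)) \<le> norm (l1_nth (X M1) j) + norm (l1_nth (X M1) j - L j)" for j
    using norm_triangle_sub[of "L j" "l1_nth (X M1) j"] by (simp add: norm_minus_commute)
  ultimately have "summable (\<lambda>j. norm (L j))"
    by (rule summable_comparison_test'[of _ 0])
  then obtain a where a: "l1_nth a = L" by (metis Abs_l1_inverse mem_Collect_eq)
  have "X \<longlonglongrightarrow> a"
  proof (rule LIMSEQ_I)
    fix e :: real assume "e > 0"
    then obtain M where M: "\<And>m n. m \<ge> M \<Longrightarrow> n \<ge> M \<Longrightarrow> norm (X m - X n) < e / 2"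
      using CauchyD[OF X, of "e / 2"] by auto
    have "norm (X m - a) \<le> e / 2" if "m \<ge> M" for m
    proof -
      have M': "\<And>n. n \<ge> M \<Longrightarrow> norm (X m - X n) < e / 2" using M[OF that] .
      have "(\<Sum>j. norm (l1_nth (X m) j - L j)) \<le> e / 2"
        by (rule suminf_le_const[OF summ[OF M'] part[OF M']])
      then show ?thesis by (simp add: norm_l1_eq a)
    qed
    then show "\<exists>no. \<forall>n\<ge>no. norm (X n - a) < e" using \<open>e > 0\<close> by (force intro: exI[of _ M])
  qed
  then show "convergent X" by (auto simp: convergent_def)
qed

text \<open>Kept apart from the class operation \<open>scaleR\<close>, which scales by reals only,
  since the operators have to be linear over \<open>'k\<close>.\<close>

lift_definition l1_scale :: "'k::real_normed_field \<Rightarrow> 'k l1 \<Rightarrow> 'k l1" is "\<lambda>c a j. c * a j"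
  by (simp add: norm_mult summable_mult)

lemma l1_nth_scale [simp]: "l1_nth (l1_scale c a) j = c * l1_nth a j"
  by transfer simp

interpretation l1: vector_space l1_scale
  by unfold_locales (auto intro!: l1_eqI simp: algebra_simps)

lemma norm_l1_scale: "norm (l1_scale c a) = norm c * norm a"
  by transfer (simp add: norm_mult suminf_mult)

lemma seminorm_l1_norm: "seminorm l1_scale norm"
  by (simp add: seminorm_def l1.vector_space_axioms norm_triangle_ineq norm_l1_scale)

lift_definition l1_unit :: "nat \<Rightarrow> 'k::real_normed_field l1" is "\<lambda>i j. if j = i then 1 else 0"
proof -
  fix i :: nat
  show "summable (\<lambda>j. norm (if j = i then 1 else 0 :: 'k))"
    by (rule summable_finite[of "{i}"]) auto
qed

lemma l1_nth_unit [simp]: "l1_nth (l1_unit i) j = (if j = i then 1 else 0)"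
  by transfer simp

lemma l1_nth_truncation:
  "l1_nth (\<Sum>i<N. l1_scale (l1_nth a i) (l1_unit i)) j = (if j < N then l1_nth a j else 0)"
proof -
  have "l1_nth (\<Sum>i<N. l1_scale (l1_nth a i) (l1_unit i)) j = (\<Sum>i<N. if i = j then l1_nth a j else 0)"
    unfolding l1_nth_sum by (intro sum.cong) auto
  then show ?thesis by simp
qed

lemma l1_span_units: "l1.span (range l1_unit) = {a. \<exists>N. \<forall>j\<ge>N. l1_nth a j = 0}"
proof (intro equalityI)
  have "l1.subspace {a. \<exists>N. \<forall>j\<ge>N. l1_nth a j = (0 :: 'a)}"
    by (rule subspace_finitely_many_nonzero[OF l1.vector_space_axioms, of "\<lambda>j a. l1_nth a j"])
       (intro linear_functionalI l1.vector_space_axioms; simp)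
  then show "l1.span (range l1_unit) \<subseteq> {a. \<exists>N. \<forall>j\<ge>N. l1_nth a j = (0 :: 'a)}"
  proof (rule l1.span_minimal[rotated])
    show "range l1_unit \<subseteq> {a. \<exists>N. \<forall>j\<ge>N. l1_nth a j = (0 :: 'a)}"
    proof clarify
      show "\<exists>N. \<forall>j\<ge>N. l1_nth (l1_unit i) j = (0 :: 'a)" for i by (rule exI[of _ "Suc i"]) auto
    qed
  qed
next
  show "{a. \<exists>N. \<forall>j\<ge>N. l1_nth a j = 0} \<subseteq> l1.span (range (l1_unit :: nat \<Rightarrow> 'a l1))"
  proof clarify
    fix a :: "'a l1" and N assume N: "\<forall>j\<ge>N. l1_nth a j = 0"
    have "a = (\<Sum>i<N. l1_scale (l1_nth a i) (l1_unit i))"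
      using N by (intro l1_eqI) (simp add: l1_nth_truncation del: l1_nth_sum)
    also have "\<dots> \<in> l1.span (range l1_unit)"
      by (intro l1.span_sum l1.span_scale l1.span_base) auto
    finally show "a \<in> l1.span (range l1_unit)" .
  qed
qed

lemma l1_truncation_tendsto: "(\<lambda>N. \<Sum>i<N. l1_scale (l1_nth a i) (l1_unit i)) \<longlonglongrightarrow> a"
proof (rule tendsto_norm_zero_cancel[THEN LIM_zero_cancel])
  have "norm ((\<Sum>i<N. l1_scale (l1_nth a i) (l1_unit i)) - a) = (\<Sum>j. norm (l1_nth a (j + N)))" for N
  proof -
    have nth: "l1_nth ((\<Sum>i<N. l1_scale (l1_nth a i) (l1_unit i)) - a) j = (if j < N then 0 else - l1_nth a j)" for j
      by (simp add: l1_nth_truncation del: l1_nth_sum)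
    have "norm ((\<Sum>i<N. l1_scale (l1_nth a i) (l1_unit i)) - a) = (\<Sum>j. if j < N then 0 else norm (l1_nth a j))"
      unfolding norm_l1_eq nth by (intro suminf_cong) auto
    also have "\<dots> = (\<Sum>j. if j + N < N then 0 else norm (l1_nth a (j + N))) + (\<Sum>j<N. if j < N then 0 else norm (l1_nth a j))"
      by (rule suminf_split_initial_segment, rule summable_comparison_test'[OF summable_l1_nth[of a]]) auto
    finally show ?thesis by simp
  qed
  then show "(\<lambda>N. norm ((\<Sum>i<N. l1_scale (l1_nth a i) (l1_unit i)) - a)) \<longlonglongrightarrow> 0"
    using suminf_exist_split2[OF summable_l1_nth[of a]] by simp
qed

lemma l1_span_units_dense: "closure (l1.span (range l1_unit)) = UNIV"
proof -
  have "a \<in> closure (l1.span (range l1_unit))" for a :: "'a l1"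
    unfolding closure_sequential
    by (intro exI[of _ "\<lambda>N. \<Sum>i<N. l1_scale (l1_nth a i) (l1_unit i)"] conjI allI l1_truncation_tendsto)
       (intro l1.span_sum l1.span_scale l1.span_base, auto)
  then show ?thesis by auto
qed

lemma tendsto_l1_scale:
  assumes "(c \<longlongrightarrow> c0) F"
  shows "((\<lambda>x. l1_scale (c x) a) \<longlongrightarrow> l1_scale c0 a) F"
proof (rule tendsto_norm_zero_cancel[THEN LIM_zero_cancel])
  have "((\<lambda>x. norm (c x - c0) * norm a) \<longlongrightarrow> 0) F"
    by (intro tendsto_mult_left_zero tendsto_norm_zero LIM_zero assms)
  then show "((\<lambda>x. norm (l1_scale (c x) a - l1_scale c0 a)) \<longlongrightarrow> 0) F"
    by (simp add: l1.scale_left_diff_distrib[symmetric] norm_l1_scale)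
qed

lemma l1_countable_dense:
  obtains D :: "'k::{real_normed_field, second_countable_topology} l1 set"
  where "countable D" "closure D = UNIV"
proof -
  obtain C :: "'k set" where C: "countable C" "\<And>U. open U \<Longrightarrow> U \<noteq> {} \<Longrightarrow> \<exists>d\<in>C. d \<in> U"
    by (rule countable_dense_setE) (rule that)
  have C_dense: "\<exists>d. (\<forall>n. d n \<in> C) \<and> d \<longlonglongrightarrow> x" for x
  proof -
    have "x \<in> closure C" unfolding closure_iff_nhds_not_empty using C(2) by blast
    then show ?thesis unfolding closure_sequential .
  qed
  define D where "D = (\<lambda>l. \<Sum>i<length l. l1_scale (l ! i) (l1_unit i)) ` lists C"
  have "countable D" unfolding D_def using C(1) by (intro countable_image) simp
  moreover have "l1.span (range l1_unit) \<subseteq> closure D"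
  proof
    fix a :: "'k l1" assume "a \<in> l1.span (range l1_unit)"
    then obtain N where N: "\<And>j. j \<ge> N \<Longrightarrow> l1_nth a j = 0" by (auto simp: l1_span_units)
    have "\<forall>i. \<exists>d. (\<forall>n. d n \<in> C) \<and> d \<longlonglongrightarrow> l1_nth a i" using C_dense by blast
    then obtain d where d: "\<And>i n. d i n \<in> C" "\<And>i. d i \<longlonglongrightarrow> l1_nth a i" by metis
    have a: "a = (\<Sum>i<N. l1_scale (l1_nth a i) (l1_unit i))"
      using N by (intro l1_eqI) (simp add: l1_nth_truncation del: l1_nth_sum)
    have "(\<lambda>n. \<Sum>i<N. l1_scale (d i n) (l1_unit i)) \<longlonglongrightarrow> a"
      by (subst a) (intro tendsto_sum tendsto_l1_scale d)
    moreover have "(\<Sum>i<N. l1_scale (d i n) (l1_unit i)) \<in> D" for n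
      unfolding D_def using d(1) by (intro image_eqI[of _ _ "map (\<lambda>i. d i n) [0..<N]"]) auto
    ultimately show "a \<in> closure D" unfolding closure_sequential
      by (intro exI[of _ "\<lambda>n. \<Sum>i<N. l1_scale (d i n) (l1_unit i)"]) blast
  qed
  then have "closure D = UNIV"
    using closure_minimal[of "l1.span (range l1_unit)" "closure D"] l1_span_units_dense by auto
  ultimately show ?thesis by (rule that)
qed

text \<open>A weighted, weaker norm in which the coordinates of vectors of \<open>E\<close> can be
  controlled. The weights stay arbitrary in \<open>(0, 1]\<close> until the domination constants of
  the coordinate functionals are known.\<close>

definition l1_weak :: "(nat \<Rightarrow> real) \<Rightarrow> 'k::real_normed_field l1 \<Rightarrow> real" where
  "l1_weak \<beta> a = (\<Sum>j. \<beta> j * norm (l1_nth a j))"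

context
  fixes \<beta> :: "nat \<Rightarrow> real"
  assumes \<beta>: "\<And>j. 0 < \<beta> j" "\<And>j. \<beta> j \<le> 1"
begin

lemma summable_l1_weak: "summable (\<lambda>j. \<beta> j * norm (l1_nth (a :: 'k::real_normed_field l1) j))"
  by (rule summable_comparison_test'[OF summable_l1_nth[of a], of 0])
     (use \<beta> in \<open>auto simp: abs_mult less_imp_le mult_left_le_one_le\<close>)

lemma seminorm_l1_weak: "seminorm l1_scale (l1_weak \<beta> :: 'k::real_normed_field l1 \<Rightarrow> real)"
  unfolding seminorm_def
proof (intro conjI allI l1.vector_space_axioms)
  fix a b :: "'k l1" and c :: 'k
  have "l1_weak \<beta> (a + b) \<le> (\<Sum>j. \<beta> j * norm (l1_nth a j) + \<beta> j * norm (l1_nth b j))"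
    unfolding l1_weak_def
    by (intro suminf_le summable_add summable_l1_weak)
       (use \<beta> in \<open>auto simp: distrib_left[symmetric] less_imp_le intro!: mult_left_mono norm_triangle_ineq\<close>)
  then show "l1_weak \<beta> (a + b) \<le> l1_weak \<beta> a + l1_weak \<beta> b"
    unfolding l1_weak_def by (simp add: suminf_add summable_l1_weak)
  have "l1_weak \<beta> (l1_scale c a) = (\<Sum>j. norm c * (\<beta> j * norm (l1_nth a j)))"
    unfolding l1_weak_def by (intro suminf_cong) (simp add: norm_mult mult_ac)
  then show "l1_weak \<beta> (l1_scale c a) = norm c * l1_weak \<beta> a"
    unfolding l1_weak_def by (simp add: suminf_mult summable_l1_weak)
qed

lemma l1_weak_le_norm: "l1_weak \<beta> a \<le> norm (a :: 'k::real_normed_field l1)"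
  unfolding l1_weak_def norm_l1_eq
  by (intro suminf_le summable_l1_weak summable_l1_nth)
     (use \<beta> in \<open>auto simp: less_imp_le mult_left_le_one_le\<close>)

lemma dominated_l1_nth: "dominated l1_scale (l1_weak \<beta>) (\<lambda>a :: 'k::real_normed_field l1. l1_nth a j)"
proof -
  have "norm (l1_nth a j) \<le> (1 / \<beta> j) * l1_weak \<beta> a" for a :: "'k l1"
  proof -
    have "(\<Sum>i\<in>{j}. \<beta> i * norm (l1_nth a i)) \<le> l1_weak \<beta> a"
      unfolding l1_weak_def by (rule sum_le_suminf[OF summable_l1_weak]) (use \<beta> in \<open>auto simp: less_imp_le\<close>)
    then show ?thesis using \<beta>(1)[of j] by (simp add: field_simps)
  qed
  moreover have "Vector_Spaces.linear l1_scale (*) (\<lambda>a :: 'k l1. l1_nth a j)"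
    by (intro linear_functionalI l1.vector_space_axioms) simp_all
  ultimately show ?thesis unfolding dominated_def by blast
qed

lemma l1_weak_eq_0_iff: "l1_weak \<beta> a = 0 \<longleftrightarrow> (a :: 'k::real_normed_field l1) = 0"
  using dominated_vanish[OF dominated_l1_nth] seminorm_zero[OF seminorm_l1_weak]
  by (metis l1_eqI l1_nth_simps(1))

end

section \<open>Translation on polynomials as a hypercyclic operator\<close>

text \<open>The polynomial \<open>(1 - X^M)^M\<close> works: the inner power makes it flat at 0, the
  outer power gives a zero of order at least \<open>M\<close> at 1.\<close>

lemma bump_poly_exists:
  obtains A U V :: "'k::comm_ring_1 poly"
  where "A = 1 + monom 1 M * U" "pcompose A [:1, -1:] = monom 1 M * V"
proof -
  define Y where "Y = (monom 1 M :: 'k poly)"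
  define A where "A = (1 - Y) ^ M"
  have "A - 1 = - Y * (\<Sum>i<M. (1 - Y) ^ i)"
    unfolding A_def by (simp add: power_diff_1_eq)
  then have 1: "A = 1 + Y * (- (\<Sum>i<M. (1 - Y) ^ i))"
    by (simp add: algebra_simps)
  have "poly (pcompose (1 - Y) [:1, -1:]) 0 = 0"
    by (simp add: poly_pcompose Y_def poly_monom)
  then have "[:0, 1:] dvd pcompose (1 - Y) [:1, -1:]"
    using poly_eq_0_iff_dvd[of "pcompose (1 - Y) [:1, -1:]" 0] by simp
  then have "[:0, 1:] ^ M dvd pcompose (1 - Y) [:1, -1:] ^ M" by (rule dvd_power_same)
  moreover have "pcompose A [:1, -1:] = pcompose (1 - Y) [:1, -1:] ^ M"
    unfolding A_def by (induction M) (simp_all add: pcompose_1 pcompose_mult)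
  ultimately obtain V where "pcompose A [:1, -1:] = monom 1 M * V"
    by (auto simp: monom_altdef elim: dvdE)
  then show ?thesis using 1 that unfolding Y_def by blast
qed

text \<open>Translating a polynomial of degree below \<open>M\<close> by \<nu> produces coefficients
  of order at most \<open>M - 1\<close> in \<nu>. The induction peels off the constant term, as in
  Horner's scheme.\<close>

lemma coeff_pcompose_shift_small:
  fixes d :: "'k::real_normed_field poly" and \<nu> :: "nat \<Rightarrow> 'k"
  assumes \<nu>: "\<And>n. \<nu> n \<noteq> 0" "(\<lambda>n. inverse (\<nu> n)) \<longlonglongrightarrow> 0"
    and "\<And>i. i \<ge> M \<Longrightarrow> coeff d i = 0"
  shows "(\<lambda>n. coeff (pcompose d [:- \<nu> n, 1:]) k * inverse (\<nu> n) ^ M) \<longlonglongrightarrow> 0"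
  using assms(3)
proof (induction M arbitrary: d k)
  case 0
  then have "d = 0" by (simp add: poly_eq_iff)
  then show ?case by simp
next
  case (Suc M)
  obtain a d' where d: "d = pCons a d'" by (cases d)
  have d': "coeff d' i = 0" if "i \<ge> M" for i using Suc.prems[of "Suc i"] that by (simp add: d)
  define c where "c n i = coeff (pcompose d' [:- \<nu> n, 1:]) i" for n i
  have lim: "(\<lambda>n. c n i * inverse (\<nu> n) ^ M) \<longlonglongrightarrow> 0" for i
    unfolding c_def by (rule Suc.IH[OF d'])
  have eq: "coeff (pcompose d [:- \<nu> n, 1:]) k * inverse (\<nu> n) ^ Suc M =
      (if k = 0 then a else 0) * inverse (\<nu> n) ^ Suc M - c n k * inverse (\<nu> n) ^ M
      + (if k = 0 then 0 else inverse (\<nu> n) * (c n (k - 1) * inverse (\<nu> n) ^ M))" for n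
    using \<nu>(1)[of n]
    by (cases k) (simp_all add: d pcompose_pCons c_def mult_pCons_left coeff_pCons field_simps)
  have 1: "(\<lambda>n. (if k = 0 then a else 0) * inverse (\<nu> n) ^ Suc M) \<longlonglongrightarrow> 0"
    using tendsto_power[OF \<nu>(2), of "Suc M"] by (intro tendsto_mult_right_zero) simp
  have 2: "(\<lambda>n. if k = 0 then 0 else inverse (\<nu> n) * (c n (k - 1) * inverse (\<nu> n) ^ M)) \<longlonglongrightarrow> 0"
    using tendsto_mult_zero[OF \<nu>(2) lim] by (cases "k = 0") simp_all
  show ?case unfolding eq using tendsto_add[OF tendsto_diff[OF 1 lim] 2] by simp
qed

text \<open>If \<open>A\<close> agrees to high order with \<open>1\<close> at the origin and with \<open>0\<close> at the point \<open>1\<close>, then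
  for large \<open>\<nu>\<close> the polynomial below is coefficientwise close to \<open>s\<close>, and its translate by
  \<open>\<nu>\<close> is close to \<open>d\<close>.\<close>

definition interpolant :: "'k::field poly \<Rightarrow> 'k \<Rightarrow> 'k poly \<Rightarrow> 'k poly \<Rightarrow> 'k poly" where
  "interpolant A \<nu> s d = s * pcompose A [:0, inverse \<nu>:] +
     pcompose d [:- \<nu>, 1:] * pcompose A [:1, - inverse \<nu>:]"

text \<open>Translation by \<nu> exchanges the roles of \<open>s\<close> and \<open>d\<close> and
  the sign of \<nu>, so the limit of the translates needs no separate computation.\<close>

lemma interpolant_shift:
  assumes "\<nu> \<noteq> 0"
  shows "pcompose (interpolant A \<nu> s d) [:\<nu>, 1:] = interpolant A (- \<nu>) d s"
proof -
  have "pcompose [:0, inverse \<nu>:] [:\<nu>, 1:] = [:1, inverse \<nu>:]"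
    "pcompose [:- \<nu>, 1:] [:\<nu>, 1:] = [:0, 1:]"
    "pcompose [:1, - inverse \<nu>:] [:\<nu>, 1:] = [:0, - inverse \<nu>:]"
    using assms by (simp_all add: pcompose_pCons)
  then show ?thesis
    by (simp add: interpolant_def pcompose_add pcompose_mult flip: pcompose_assoc)
qed

lemma degree_interpolant: "degree (interpolant A \<nu> s d) \<le> degree s + degree d + degree A"
proof -
  have *: "degree (pcompose p [:a, b:]) \<le> degree p" for p :: "'a poly" and a b
    using degree_pcompose_le[of p "[:a, b:]"] by (rule order_trans) (simp add: degree_pCons_eq_if)
  have "degree (s * pcompose A [:0, inverse \<nu>:]) \<le> degree s + degree A"
    by (rule order_trans[OF degree_mult_le add_left_mono[OF *]])
  moreover have "degree (pcompose d [:- \<nu>, 1:] * pcompose A [:1, - inverse \<nu>:]) \<le> degree d + degree A"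
    by (rule order_trans[OF degree_mult_le add_mono[OF * *]])
  ultimately show ?thesis unfolding interpolant_def by (intro degree_add_le) auto
qed

text \<open>In the first summand \<open>A\<close> at \<open>x / \<nu>\<close> tends to
  \<open>A\<close> at 0, which is 1. In the second, \<open>A\<close> at \<open>1 - x / \<nu>\<close>
  only has terms of order at least \<open>M\<close> in \<open>x / \<nu>\<close>, and their factor
  \<open>inverse \<nu> ^ M\<close> beats the growth of the translate of \<open>d\<close>.\<close>

lemma coeff_interpolant_tendsto:
  fixes s d A :: "'k::real_normed_field poly" and \<nu> :: "nat \<Rightarrow> 'k"
  assumes \<nu>: "\<And>n. \<nu> n \<noteq> 0" "(\<lambda>n. inverse (\<nu> n)) \<longlonglongrightarrow> 0"
    and A: "A = 1 + monom 1 M * U" "pcompose A [:1, -1:] = monom 1 M * V"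
    and M: "M > 0" "\<And>i. i \<ge> M \<Longrightarrow> coeff d i = 0"
  shows "(\<lambda>n. coeff (interpolant A (\<nu> n) s d) i) \<longlonglongrightarrow> coeff s i"
proof -
  have A0: "coeff A 0 = 1" using M(1) by (simp add: A(1) coeff_mult)
  have "(\<lambda>n. \<Sum>j\<le>i. coeff s j * (inverse (\<nu> n) ^ (i - j) * coeff A (i - j)))
      \<longlonglongrightarrow> (\<Sum>j\<le>i. coeff s j * (0 ^ (i - j) * coeff A (i - j)))"
    by (intro tendsto_intros \<nu>(2))
  also have "(\<Sum>j\<le>i. coeff s j * (0 ^ (i - j) * coeff A (i - j))) = (\<Sum>j\<le>i. if j = i then coeff s i else 0)"
    by (intro sum.cong) (auto simp: A0)
  also have "\<dots> = coeff s i" by simp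
  finally have 1: "(\<lambda>n. coeff (s * pcompose A [:0, inverse (\<nu> n):]) i) \<longlonglongrightarrow> coeff s i"
    by (simp add: coeff_mult coeff_pcompose_linear)
  have comp: "pcompose A [:1, - inverse (\<nu> n):] = pcompose (monom 1 M * V) [:0, inverse (\<nu> n):]" for n
    unfolding A(2)[symmetric] pcompose_assoc[symmetric] by (simp add: pcompose_pCons)
  define W where "W = monom 1 M * V"
  have W: "coeff W j = 0" if "j < M" for j using that by (simp add: W_def coeff_monom_mult)
  have "(\<lambda>n. coeff (pcompose d [:- \<nu> n, 1:]) j * (inverse (\<nu> n) ^ (i - j) * coeff W (i - j))) \<longlonglongrightarrow> 0" for j
  proof (cases "i - j < M")
    case True
    then show ?thesis by (simp add: W)
  next
    case False
    then have "inverse (\<nu> n) ^ (i - j) = inverse (\<nu> n) ^ M * inverse (\<nu> n) ^ (i - j - M)" for n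
      by (metis le_add_diff_inverse linorder_not_less power_add)
    then have eq: "coeff (pcompose d [:- \<nu> n, 1:]) j * (inverse (\<nu> n) ^ (i - j) * coeff W (i - j)) =
       (coeff (pcompose d [:- \<nu> n, 1:]) j * inverse (\<nu> n) ^ M) * (inverse (\<nu> n) ^ (i - j - M) * coeff W (i - j))" for n
      by simp
    have "(\<lambda>n. (coeff (pcompose d [:- \<nu> n, 1:]) j * inverse (\<nu> n) ^ M) * (inverse (\<nu> n) ^ (i - j - M) * coeff W (i - j)))
        \<longlonglongrightarrow> 0 * (0 ^ (i - j - M) * coeff W (i - j))"
      by (intro tendsto_intros \<nu>(2) coeff_pcompose_shift_small[OF \<nu> M(2)])
    then show ?thesis unfolding eq by simp
  qed
  then have "(\<lambda>n. \<Sum>j\<le>i. coeff (pcompose d [:- \<nu> n, 1:]) j * (inverse (\<nu> n) ^ (i - j) * coeff W (i - j))) \<longlonglongrightarrow> 0"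
    by (rule tendsto_null_sum)
  then have 2: "(\<lambda>n. coeff (pcompose d [:- \<nu> n, 1:] * pcompose A [:1, - inverse (\<nu> n):]) i) \<longlonglongrightarrow> 0"
    by (simp add: comp coeff_mult coeff_pcompose_linear flip: W_def)
  show ?thesis using tendsto_add[OF 1 2] by (simp add: interpolant_def)
qed

text \<open>The common degree bound is recorded because it upgrades coefficientwise convergence to
  convergence in \<open>l1\<close>, whatever weights the monomials carry.\<close>

lemma translation_transitive:
  fixes s d :: "'k::real_normed_field poly"
  obtains f D where "\<And>n. degree (f n) \<le> D" "\<And>n. degree (pcompose (f n) [:of_nat n, 1:]) \<le> D"
    "\<And>i. (\<lambda>n. coeff (f n) i) \<longlonglongrightarrow> coeff s i"
    "\<And>i. (\<lambda>n. coeff (pcompose (f n) [:of_nat n, 1:]) i) \<longlonglongrightarrow> coeff d i"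
proof -
  \<comment> \<open>Larger than both degrees, since \<open>s\<close> and \<open>d\<close> trade
    places under translation.\<close>
  define M where "M = Suc (max (degree s) (degree d))"
  have M: "M > 0" "coeff s i = 0" "coeff d i = 0" if "i \<ge> M" for i
    using that by (auto simp: M_def intro!: coeff_eq_0)
  obtain A U V :: "'k poly" where A: "A = 1 + monom 1 M * U" "pcompose A [:1, -1:] = monom 1 M * V"
    by (rule bump_poly_exists)
  \<comment> \<open>Starting at 1 keeps the translation length nonzero;
    \<open>LIMSEQ_imp_Suc\<close> shifts the index back at the end.\<close>
  define \<nu> where "\<nu> n = (of_nat (Suc n) :: 'k)" for n
  have \<nu>: "\<nu> n \<noteq> 0" "(\<lambda>n. inverse (\<nu> n)) \<longlonglongrightarrow> 0"
    "- \<nu> n \<noteq> 0" "(\<lambda>n. inverse (- \<nu> n)) \<longlonglongrightarrow> 0" for n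
  proof -
    show 1: "(\<lambda>n. inverse (\<nu> n)) \<longlonglongrightarrow> 0"
      using LIMSEQ_Suc[OF lim_1_over_n[where ?'a = 'k]] by (simp add: \<nu>_def inverse_eq_divide)
    show "(\<lambda>n. inverse (- \<nu> n)) \<longlonglongrightarrow> 0" using tendsto_minus[OF 1] by simp
    show "\<nu> n \<noteq> 0" "- \<nu> n \<noteq> 0" by (simp_all only: \<nu>_def neg_equal_0_iff_equal of_nat_eq_0_iff nat.simps not_False_eq_True)
  qed
  define f where "f n = interpolant A (of_nat n) s d" for n
  have shift: "pcompose (f n) [:of_nat n, 1:] = interpolant A (- of_nat n) d s" if "n > 0" for n
    unfolding f_def using that by (intro interpolant_shift) simp
  show ?thesis
  proof (rule that)
    show "degree (f n) \<le> degree s + degree d + degree A" for n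
      unfolding f_def by (rule degree_interpolant)
    show "degree (pcompose (f n) [:of_nat n, 1:]) \<le> degree s + degree d + degree A" for n
      using degree_pcompose_le[of "f n" "[:of_nat n, 1:]"] degree_interpolant[of A "of_nat n" s d]
      by (simp add: f_def)
    fix i
    have "(\<lambda>n. coeff (interpolant A (\<nu> n) s d) i) \<longlonglongrightarrow> coeff s i"
      by (rule coeff_interpolant_tendsto[OF \<nu>(1,2) A]) (use M in auto)
    then show "(\<lambda>n. coeff (f n) i) \<longlonglongrightarrow> coeff s i"
      unfolding f_def \<nu>_def by (rule LIMSEQ_imp_Suc)
    have "(\<lambda>n. coeff (interpolant A (- \<nu> n) d s) i) \<longlonglongrightarrow> coeff d i"
      by (rule coeff_interpolant_tendsto[OF \<nu>(3,4) A]) (use M in auto)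
    then have "(\<lambda>n. coeff (pcompose (f (Suc n)) [:of_nat (Suc n), 1:]) i) \<longlonglongrightarrow> coeff d i"
      by (simp only: shift zero_less_Suc \<nu>_def)
    then show "(\<lambda>n. coeff (pcompose (f n) [:of_nat n, 1:]) i) \<longlonglongrightarrow> coeff d i"
      by (rule LIMSEQ_imp_Suc)
  qed
qed

section \<open>Polynomials as vectors of \<open>l1\<close> with weighted monomials\<close>

lift_definition l1_of_poly :: "(nat \<Rightarrow> real) \<Rightarrow> 'k::real_normed_field poly \<Rightarrow> 'k l1" is
  "\<lambda>\<kappa> p j. coeff p j * of_real (\<kappa> j)"
proof -
  fix \<kappa> :: "nat \<Rightarrow> real" and p :: "'k poly"
  show "summable (\<lambda>j. norm (coeff p j * of_real (\<kappa> j)))"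
    by (rule summable_finite[of "{..degree p}"]) (auto simp: coeff_eq_0)
qed

lemma l1_nth_of_poly [simp]: "l1_nth (l1_of_poly \<kappa> p) j = coeff p j * of_real (\<kappa> j)"
  by transfer simp

lemma l1_of_poly_eq_sum:
  assumes "degree p \<le> D"
  shows "l1_of_poly \<kappa> p = (\<Sum>i\<le>D. l1_scale (coeff p i) (l1_scale (of_real (\<kappa> i)) (l1_unit i)))"
proof (rule l1_eqI)
  fix j
  have "l1_nth (\<Sum>i\<le>D. l1_scale (coeff p i) (l1_scale (of_real (\<kappa> i)) (l1_unit i))) j
     = (\<Sum>i\<le>D. if i = j then coeff p j * of_real (\<kappa> j) else 0)"
    unfolding l1_nth_sum by (intro sum.cong) auto
  then show "l1_nth (l1_of_poly \<kappa> p) j =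
      l1_nth (\<Sum>i\<le>D. l1_scale (coeff p i) (l1_scale (of_real (\<kappa> i)) (l1_unit i))) j"
    using assms by (auto simp: coeff_eq_0)
qed

lemma l1_of_poly_tendsto:
  fixes p :: "'k::real_normed_field poly"
  assumes "\<And>n. degree (f n) \<le> D" "\<And>i. (\<lambda>n. coeff (f n) i) \<longlonglongrightarrow> coeff p i"
  shows "(\<lambda>n. l1_of_poly \<kappa> (f n)) \<longlonglongrightarrow> l1_of_poly \<kappa> p"
proof -
  define D' where "D' = max D (degree p)"
  have "degree (f n) \<le> D'" for n unfolding D'_def using assms(1)[of n] by simp
  moreover have "degree p \<le> D'" by (simp add: D'_def)
  ultimately show ?thesis
    by (simp only: l1_of_poly_eq_sum[of _ D'])
       (intro tendsto_sum tendsto_l1_scale assms(2))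
qed

lemma l1_of_poly_dense:
  fixes \<kappa> :: "nat \<Rightarrow> real"
  assumes "\<And>j. \<kappa> j > 0"
  shows "closure (range (l1_of_poly \<kappa> :: 'k::real_normed_field poly \<Rightarrow> 'k l1)) = UNIV"
proof -
  have "l1.span (range l1_unit) \<subseteq> range (l1_of_poly \<kappa> :: 'k poly \<Rightarrow> 'k l1)"
  proof
    fix a :: "'k l1" assume "a \<in> l1.span (range l1_unit)"
    then obtain N where N: "\<And>j. j \<ge> N \<Longrightarrow> l1_nth a j = 0" by (auto simp: l1_span_units)
    define p where "p = (\<Sum>i<N. monom (l1_nth a i / of_real (\<kappa> i)) i)"
    have "coeff p j = (\<Sum>i<N. if i = j then l1_nth a j / of_real (\<kappa> j) else 0)" for j
      unfolding p_def coeff_sum by (intro sum.cong) (auto simp: coeff_monom)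
    moreover have "\<kappa> j \<noteq> 0" for j using assms[of j] by simp
    ultimately have "a = l1_of_poly \<kappa> p" using N by (intro l1_eqI) auto
    then show "a \<in> range (l1_of_poly \<kappa>)" by simp
  qed
  from closure_mono[OF this] show ?thesis by (simp add: l1_span_units_dense top.extremum_unique)
qed


section \<open>Birkhoff's transitivity theorem\<close>

lemma LIMSEQ_eventually_in_open:
  assumes "X \<longlonglongrightarrow> x" "open U" "x \<in> U"
  shows "\<exists>N. \<forall>n\<ge>N. X n \<in> U"
  using topological_tendstoD[OF assms] by (simp add: eventually_sequentially)

text \<open>\<open>G d m\<close> collects the points whose orbit enters the ball of radius
  \<open>1 / (m + 1)\<close> about \<open>d\<close>. It is open by continuity and dense by
  transitivity, so by Baire some point lies in all of these countably many sets, and its orbit is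
  dense.\<close>

lemma hypercyclic_vector_exists:
  fixes T :: "'y::{real_normed_vector, complete_space} \<Rightarrow> 'y" and D :: "'y set"
  assumes cont: "continuous_on UNIV T" and D: "countable D" "closure D = UNIV"
    and trans: "\<And>U V. open U \<Longrightarrow> open V \<Longrightarrow> U \<noteq> {} \<Longrightarrow> V \<noteq> {} \<Longrightarrow> \<exists>n. \<exists>x\<in>U. (T ^^ n) x \<in> V"
  obtains y where "closure (range (\<lambda>n. (T ^^ n) y)) = UNIV"
proof -
  have contn: "continuous_on UNIV (T ^^ n)" for n
  proof (induction n)
    case (Suc n)
    show ?case unfolding funpow.simps
      by (rule continuous_on_compose[OF Suc continuous_on_subset[OF cont]]) simp
  qed (simp add: id_def)
  define G where "G d m = (\<Union>n. (T ^^ n) -` ball d (inverse (Suc m)))" for d and m :: nat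
  have "euclidean closure_of \<Inter>(case_prod G ` (D \<times> UNIV)) = topspace (euclidean :: 'y topology)"
  proof (rule Baire_category)
    show "completely_metrizable_space (euclidean :: 'y topology) \<or>
        locally_compact_space (euclidean :: 'y topology) \<and> regular_space (euclidean :: 'y topology)"
      using completely_metrizable_space_euclidean by blast
    show "countable (case_prod G ` (D \<times> UNIV))" using D(1) by simp
    fix S assume "S \<in> case_prod G ` (D \<times> UNIV)"
    then obtain d m where S: "S = G d m" by auto
    have "open S" unfolding S G_def by (intro open_UN ballI open_vimage contn open_ball)
    moreover have "x \<in> closure S" for x
      unfolding closure_iff_nhds_not_empty
    proof (intro allI impI)
      fix A V assume "V \<subseteq> A" "open V" "x \<in> V"
      moreover obtain n z where "z \<in> V" "(T ^^ n) z \<in> ball d (inverse (Suc m))"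
        using trans[of V "ball d (inverse (Suc m))"] \<open>open V\<close> \<open>x \<in> V\<close> by auto
      ultimately show "S \<inter> A \<noteq> {}" unfolding S G_def by blast
    qed
    ultimately show "openin euclidean S \<and> euclidean closure_of S = topspace euclidean"
      by (auto simp: euclidean_closure_of)
  qed
  then have "\<Inter>(case_prod G ` (D \<times> UNIV)) \<noteq> {}" by auto
  then obtain y where y: "\<And>d m. d \<in> D \<Longrightarrow> y \<in> G d m" by auto
  have "D \<subseteq> closure (range (\<lambda>n. (T ^^ n) y))"
  proof
    fix d assume d: "d \<in> D"
    show "d \<in> closure (range (\<lambda>n. (T ^^ n) y))"
      unfolding closure_approachable
    proof (intro allI impI)
      fix e :: real assume "e > 0"
      then obtain m where m: "inverse (real (Suc m)) < e" using reals_Archimedean by blast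
      obtain n where "(T ^^ n) y \<in> ball d (inverse (Suc m))" using y[OF d, of m] by (auto simp: G_def)
      then show "\<exists>z\<in>range (\<lambda>n. (T ^^ n) y). dist z d < e" using m by (auto simp: dist_commute intro: exI[of _ n])
    qed
  qed
  then have "closure (range (\<lambda>n. (T ^^ n) y)) = UNIV"
    using closure_minimal[of D "closure (range (\<lambda>n. (T ^^ n) y))"] D(2) by auto
  then show ?thesis by (rule that)
qed

text \<open>Translation on polynomials, in rapidly growing weights on the monomials, is the identity plus a
  perturbation that is small even with respect to the weak norm.\<close>

theorem hypercyclic_perturbation_of_identity:
  fixes \<beta> :: "nat \<Rightarrow> real"
  assumes \<beta>: "\<And>j. 0 < \<beta> j" "\<And>j. \<beta> j \<le> 1"
  obtains T :: "'k::{real_normed_field, banach, second_countable_topology} l1 \<Rightarrow> 'k l1" and y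
  where "Vector_Spaces.linear l1_scale l1_scale T" "\<And>a. norm (T a - a) \<le> l1_weak \<beta> a"
    "closure (range (\<lambda>n. (T ^^ n) y)) = UNIV"
proof -
  \<comment> \<open>The effect of translation minus identity on \<open>X^j\<close>. The leading
    terms cancel, so only coefficients below \<open>j\<close> remain.\<close>
  define w where "w j = pcompose (monom 1 j) [:1, 1:] - (monom 1 j :: 'k poly)" for j
  define M where "M j = (\<Sum>i\<le>j. norm (coeff (w j) i))" for j
  \<comment> \<open>Chosen so that
    \<open>M j * \<kappa> (j - 1) \<le> \<beta> j * \<kappa> j\<close> for \<open>j > 0\<close>; as
    \<open>w j\<close> has only coefficients below \<open>j\<close>, the left side bounds the norm
    of its image.\<close>
  define \<kappa> where "\<kappa> = rec_nat 1 (\<lambda>j r. r * (1 + M (Suc j) / \<beta> (Suc j)))"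
  have M: "M j \<ge> 0" for j by (simp add: M_def sum_nonneg)
  have \<kappa>_Suc: "\<kappa> (Suc j) = \<kappa> j * (1 + M (Suc j) / \<beta> (Suc j))" for j by (simp add: \<kappa>_def)
  have fac: "1 + M j / \<beta> j \<ge> 1" for j using M[of j] \<beta>(1)[of j] by simp
  have \<kappa>_pos: "\<kappa> j > 0" for j
  proof (induction j)
    case (Suc j)
    then show ?case using fac[of "Suc j"] by (simp add: \<kappa>_Suc)
  qed (simp add: \<kappa>_def)
  have \<kappa>_mono: "mono \<kappa>"
  proof (rule incseq_SucI)
    show "\<kappa> j \<le> \<kappa> (Suc j)" for j
      unfolding \<kappa>_Suc using mult_left_mono[OF fac[of "Suc j"], of "\<kappa> j"] \<kappa>_pos[of j] by simp
  qed
  have w_coeff: "coeff (w j) i = 0" if "i \<ge> j" for i j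
  proof (cases "i = j")
    case True
    have "lead_coeff (pcompose (monom (1::'k) j) [:1, 1:]) = 1"
      by (subst lead_coeff_comp) (simp_all add: degree_monom_eq)
    moreover have "degree (pcompose (monom (1::'k) j) [:1, 1:]) = j"
      by (simp add: degree_pcompose degree_monom_eq)
    ultimately show ?thesis using True by (simp add: w_def)
  next
    case False
    have "degree (w j) \<le> j" unfolding w_def
      by (intro degree_diff_le) (simp_all add: degree_pcompose degree_monom_eq)
    then show ?thesis using False that by (intro coeff_eq_0) simp
  qed
  define N where "N = (l1_of_poly \<kappa> :: 'k poly \<Rightarrow> 'k l1)"
  \<comment> \<open>The intended image of the \<open>j\<close>-th unit vector under
    \<open>T - I\<close>, because \<open>N\<close> sends \<open>X^j\<close> to
    \<open>\<kappa> j\<close> times that vector. The bound by \<open>\<beta> j\<close> is what makes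
    \<open>T - I\<close> small in the weak norm.\<close>
  define v where "v j = l1_scale (of_real (1 / \<kappa> j)) (N (w j))" for j
  have norm_v: "norm (v j) \<le> \<beta> j" for j
  proof -
    have "norm (N (w j)) = (\<Sum>i. norm (coeff (w j) i) * \<kappa> i)"
      unfolding N_def norm_l1_eq
      by (intro suminf_cong) (simp add: norm_mult less_imp_le[OF \<kappa>_pos])
    also have "\<dots> = (\<Sum>i<j. norm (coeff (w j) i) * \<kappa> i)"
      by (rule suminf_finite) (auto simp: w_coeff)
    also have "\<dots> \<le> \<beta> j * \<kappa> j"
    proof (cases j)
      case 0
      then show ?thesis using \<beta>(1)[of 0] \<kappa>_pos[of 0] by simp
    next
      case (Suc i)
      have "(\<Sum>l<j. norm (coeff (w j) l) * \<kappa> l) \<le> (\<Sum>l<j. norm (coeff (w j) l) * \<kappa> i)"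
        using Suc by (intro sum_mono mult_left_mono monoD[OF \<kappa>_mono]) auto
      also have "\<dots> = (\<Sum>l<j. norm (coeff (w j) l)) * \<kappa> i" by (simp add: sum_distrib_right)
      also have "\<dots> \<le> M j * \<kappa> i"
        unfolding M_def by (intro mult_right_mono sum_mono2) (auto simp: less_imp_le[OF \<kappa>_pos])
      also have "\<dots> \<le> \<beta> j * \<kappa> j"
        using \<beta>(1)[of j] \<kappa>_pos[of i] by (simp add: Suc \<kappa>_Suc field_simps)
      finally show ?thesis .
    qed
    finally show ?thesis using \<kappa>_pos[of j]
      by (simp add: v_def norm_l1_scale field_simps norm_divide)
  qed
  define S where "S a = (\<Sum>j. l1_scale (l1_nth a j) (v j))" for a
  have norm_term: "norm (l1_scale (l1_nth a j) (v j)) \<le> \<beta> j * norm (l1_nth a j)" for a j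
    using mult_left_mono[OF norm_v[of j], of "norm (l1_nth a j)"] by (simp add: norm_l1_scale mult.commute)
  have summ: "summable (\<lambda>j. norm (l1_scale (l1_nth a j) (v j)))" for a
    by (rule summable_comparison_test'[OF summable_l1_weak[where \<beta> = \<beta>, OF \<beta>, of a], of 0]) (use norm_term in simp)
  note summ' = summable_norm_cancel[OF summ]
  have norm_S: "norm (S a) \<le> l1_weak \<beta> a" for a
    unfolding S_def l1_weak_def
    by (rule order_trans[OF summable_norm[OF summ] suminf_le[OF norm_term summ summable_l1_weak[where \<beta> = \<beta>, OF \<beta>]]])
  have S_add: "S (a + b) = S a + S b" for a b
    unfolding S_def by (simp add: suminf_add[OF summ' summ'] l1.scale_left_distrib)
  have S_scale: "S (l1_scale c a) = l1_scale c (S a)" for c a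
  proof -
    have "bounded_linear (l1_scale c :: 'k l1 \<Rightarrow> 'k l1)"
      by (rule bounded_linear_intro[where K = "norm c"])
         (auto simp: l1.scale_right_distrib norm_l1_scale intro!: l1_eqI simp: scaleR_l1.rep_eq)
    from bounded_linear.suminf[OF this summ'] show ?thesis
      unfolding S_def by simp
  qed
  define T where "T a = a + S a" for a
  have T_linear: "Vector_Spaces.linear l1_scale l1_scale T"
    by (auto simp: Vector_Spaces.linear_iff l1.vector_space_axioms T_def S_add S_scale l1.scale_right_distrib)
  have T_diff: "norm (T a - a) \<le> l1_weak \<beta> a" for a using norm_S by (simp add: T_def)
  have N_add: "N (p + q) = N p + N q" for p q by (intro l1_eqI) (simp add: N_def algebra_simps)
  have N_smult: "N (smult c p) = l1_scale c (N p)" for c p by (intro l1_eqI) (simp add: N_def)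
  have TN_monom: "T (N (monom c j)) = N (pcompose (monom c j) [:1, 1:])" for c j
  proof -
    have nth: "l1_nth (N (monom c j)) i = (if i = j then c * of_real (\<kappa> j) else 0)" for i
      by (simp add: N_def)
    have "S (N (monom c j)) = (\<Sum>i\<in>{j}. l1_scale (l1_nth (N (monom c j)) i) (v i))"
      unfolding S_def by (rule suminf_finite) (auto simp: nth)
    also have "\<dots> = l1_scale c (N (w j))"
      using \<kappa>_pos[of j] by (simp add: nth v_def)
    also have "\<dots> = N (pcompose (monom c j) [:1, 1:] - monom c j)"
    proof -
      have "smult c (w j) = pcompose (monom c j) [:1, 1:] - monom c j"
        by (simp add: w_def smult_diff_right smult_monom flip: pcompose_smult)
      then show ?thesis by (simp flip: N_smult)
    qed
    finally show ?thesis by (simp add: T_def flip: N_add)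
  qed
  \<comment> \<open>\<open>N\<close> intertwines translation by 1 with \<open>T\<close>, so on the
    dense range of \<open>N\<close> the iterates of \<open>T\<close> are the translations by
    \<open>n\<close>.\<close>
  have TN: "T (N p) = N (pcompose p [:1, 1:])" for p
  proof -
    have sum: "N (\<Sum>i\<in>I. f i) = (\<Sum>i\<in>I. N (f i))" for I and f :: "nat \<Rightarrow> 'k poly"
      by (intro l1_eqI) (simp add: N_def coeff_sum sum_distrib_right)
    have "T (N (\<Sum>i\<le>degree p. monom (coeff p i) i)) = N (pcompose (\<Sum>i\<le>degree p. monom (coeff p i) i) [:1, 1:])"
      by (simp add: sum lin_sum[OF T_linear] TN_monom pcompose_sum)
    then show ?thesis by (simp add: poly_as_sum_of_monoms)
  qed
  have TnN: "(T ^^ n) (N p) = N (pcompose p [:of_nat n, 1:])" for n p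
  proof (induction n)
    case (Suc n)
    have "pcompose [:of_nat n, 1:] [:1, 1:] = [:of_nat (Suc n), 1 :: 'k:]"
      by (simp add: pcompose_pCons add.commute)
    then show ?case using Suc by (simp add: TN flip: pcompose_assoc)
  qed simp
  have T_cont: "continuous_on UNIV T"
  proof -
    have "norm (T x - T z) \<le> 2 * norm (x - z)" for x z
    proof -
      have "T x - T z = (x - z) + (T (x - z) - (x - z))" by (simp add: lin_diff[OF T_linear])
      then have "norm (T x - T z) \<le> norm (x - z) + norm (T (x - z) - (x - z))"
        by (metis norm_triangle_ineq)
      then show ?thesis using T_diff[of "x - z"] l1_weak_le_norm[where \<beta> = \<beta>, OF \<beta>, of "x - z"] by simp
    qed
    then have "2-lipschitz_on UNIV T" by (intro lipschitz_onI) (auto simp: dist_norm)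
    then show ?thesis by (rule lipschitz_on_continuous_on)
  qed
  have dense: "\<exists>p. N p \<in> U" if U: "open U" "U \<noteq> {}" for U
  proof -
    obtain x where "x \<in> U" using U(2) by blast
    have "x \<in> closure (range N)" unfolding N_def by (subst l1_of_poly_dense[where \<kappa> = \<kappa>, OF \<kappa>_pos]) simp
    then show ?thesis using \<open>x \<in> U\<close> U(1) unfolding closure_iff_nhds_not_empty by blast
  qed
  have trans: "\<exists>n. \<exists>x\<in>U. (T ^^ n) x \<in> V" if UV: "open U" "open V" "U \<noteq> {}" "V \<noteq> {}" for U V
  proof -
    obtain s d where sd: "N s \<in> U" "N d \<in> V" using dense UV by metis
    obtain f D where f: "\<And>n. degree (f n) \<le> D" "\<And>n. degree (pcompose (f n) [:of_nat n, 1:]) \<le> D"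
      "\<And>i. (\<lambda>n. coeff (f n) i) \<longlonglongrightarrow> coeff s i"
      "\<And>i. (\<lambda>n. coeff (pcompose (f n) [:of_nat n, 1:]) i) \<longlonglongrightarrow> coeff d i"
      using translation_transitive[of s d] by blast
    have lim1: "(\<lambda>n. N (f n)) \<longlonglongrightarrow> N s" unfolding N_def by (rule l1_of_poly_tendsto[OF f(1,3)])
    have lim2: "(\<lambda>n. (T ^^ n) (N (f n))) \<longlonglongrightarrow> N d"
      unfolding TnN unfolding N_def by (rule l1_of_poly_tendsto[OF f(2,4)])
    obtain n1 where "\<forall>n\<ge>n1. N (f n) \<in> U" using LIMSEQ_eventually_in_open[OF lim1 UV(1) sd(1)] by blast
    moreover obtain n2 where "\<forall>n\<ge>n2. (T ^^ n) (N (f n)) \<in> V"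
      using LIMSEQ_eventually_in_open[OF lim2 UV(2) sd(2)] by blast
    ultimately have "N (f (max n1 n2)) \<in> U" "(T ^^ (max n1 n2)) (N (f (max n1 n2))) \<in> V" by auto
    then show ?thesis by blast
  qed
  obtain D :: "'k l1 set" where D: "countable D" "closure D = UNIV" by (rule l1_countable_dense)
  obtain y where "closure (range (\<lambda>n. (T ^^ n) y)) = UNIV"
    by (rule hypercyclic_vector_exists[OF T_cont D trans])
  then show ?thesis by (rule that[OF T_linear T_diff])
qed

section \<open>Isomorphisms between dense subspaces of countable dimension\<close>

text \<open>Back-and-forth: a bijection between two dense subspaces of countable dimension is built from
  rank-one perturbations of the identity that are small relative to a weaker seminorm.\<close>

lemma separating_functional:
  fixes sY :: "'k::real_normed_field \<Rightarrow> 'y::ab_group_add \<Rightarrow> 'y"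
  assumes q: "seminorm sY q" and sep: "\<And>x. x \<noteq> 0 \<Longrightarrow> \<exists>f. dominated sY q f \<and> f x = 1"
    and "finite V" "x \<notin> module.span sY V"
  shows "\<exists>f. dominated sY q f \<and> (\<forall>v\<in>V. f v = 0) \<and> f x = 1"
  using assms(3,4)
proof (induction V arbitrary: x rule: finite_induct)
  case empty
  interpret vector_space sY by (rule seminorm_space[OF q])
  show ?case using empty sep by simp
next
  case (insert a V)
  interpret vector_space sY by (rule seminorm_space[OF q])
  show ?case
  proof (cases "a \<in> span V")
    case True
    then have "span (insert a V) = span V" by (rule span_redundant)
    then obtain f where f: "dominated sY q f" "\<forall>v\<in>V. f v = 0" "f x = 1" using insert by metis
    have "f a = 0" using functional_span_zero[OF dominated_linear[OF f(1)] f(2) True] .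
    then show ?thesis using f by blast
  next
    case False
    obtain g where g: "dominated sY q g" "\<forall>v\<in>V. g v = 0" "g a = 1" using insert.IH[OF False] by blast
    note gl = dominated_linear[OF g(1)]
    \<comment> \<open>Subtracting the \<open>a\<close>-component measured by \<open>g\<close> sends
      \<open>a\<close> to 0 and fixes \<open>V\<close>. A functional that kills \<open>V\<close>,
      composed with this map, therefore kills \<open>insert a V\<close>.\<close>
    have "x - sY (g x) a \<notin> span V" using insert.prems by (simp add: span_insert)
    then obtain f where f: "dominated sY q f" "\<forall>v\<in>V. f v = 0" "f (x - sY (g x) a) = 1"
      using insert.IH by blast
    note fl = dominated_linear[OF f(1)]
    have "dominated sY q (\<lambda>z. f (residual sY (\<lambda>_. a) (\<lambda>_. g) (Suc 0) z))"
      by (rule dominated_residual[OF q f(1) g(1)])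
    moreover have eq: "residual sY (\<lambda>_. a) (\<lambda>_. g) (Suc 0) z = z - sY (g z) a" for z
      by (simp add: residual_def)
    ultimately have "dominated sY q (\<lambda>z. f (z - sY (g z) a))" by simp
    then show ?thesis using f g
      by (intro exI[of _ "\<lambda>z. f (z - sY (g z) a)"]) (auto simp: lin_zero[OF fl])
  qed
qed

locale dense_subspaces =
  fixes sY :: "'k::real_normed_field \<Rightarrow> 'y::real_normed_vector \<Rightarrow> 'y"
    and q :: "'y \<Rightarrow> real" and F G :: "'y set"
  assumes norm_seminorm: "seminorm sY norm"
    and q: "seminorm sY q" and q_le: "\<And>x. q x \<le> norm x"
    and sep: "\<And>x. x \<noteq> 0 \<Longrightarrow> \<exists>f. dominated sY q f \<and> f x = 1"
    and F: "module.subspace sY F" "closure F = UNIV"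
    and G: "module.subspace sY G" "closure G = UNIV"
begin

sublocale vector_space sY by (rule seminorm_space[OF q])

definition partial_iso :: "('y \<Rightarrow> 'y) \<Rightarrow> 'y set \<Rightarrow> bool" where
  "partial_iso L W \<longleftrightarrow> Vector_Spaces.linear sY sY L \<and> closure (L ` F) = UNIV \<and>
     finite W \<and> W \<subseteq> F \<and> L ` W \<subseteq> G"

lemma approximate_in_dense:
  assumes "closure S = UNIV" "d > 0"
  obtains x where "x \<in> S" "norm (x - z) < d"
proof -
  have "z \<in> closure S" using assms by simp
  then obtain x where "x \<in> S" "dist x z < d" using assms(2) unfolding closure_approachable by blast
  then show ?thesis using that by (simp add: dist_norm)
qed

lemma rank_one_perturbation:
  assumes L: "partial_iso L W" and g: "Vector_Spaces.linear sY (*) g" "\<And>x. norm (g x) \<le> D * q x" "D > 0"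
    and gW: "\<forall>v\<in>L ` W. g v = 0" and c: "D * norm c \<le> d" "d < 1"
    and w: "w \<in> F" "L w + sY (g (L w)) c \<in> G"
  defines "L' \<equiv> \<lambda>z. L z + sY (g (L z)) c"
  shows "partial_iso L' (insert w W)" "\<forall>z\<in>span W. L' z = L z" "\<And>z. norm (L' z - L z) \<le> d * q (L z)"
proof -
  have Ll: "Vector_Spaces.linear sY sY L" using L by (simp add: partial_iso_def)
  have norm_scale: "norm (sY a x) = norm a * norm x" for a x by (rule seminorm_scale[OF norm_seminorm])
  show small: "norm (L' z - L z) \<le> d * q (L z)" for z
  proof -
    have "norm (L' z - L z) = norm (g (L z)) * norm c" by (simp add: L'_def norm_scale)
    also have "\<dots> \<le> (D * q (L z)) * norm c" by (intro mult_right_mono g) auto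
    also have "\<dots> \<le> d * q (L z)"
      using mult_right_mono[OF c(1) seminorm_nonneg[OF q, of "L z"]] by (simp add: mult_ac)
    finally show ?thesis .
  qed
  have gc: "norm (g c) < 1"
  proof -
    have "norm (g c) \<le> D * q c" by (rule g)
    also have "\<dots> \<le> D * norm c" using g(3) by (intro mult_left_mono q_le) auto
    finally show ?thesis using c by simp
  qed
  have L'l: "Vector_Spaces.linear sY sY L'"
    using vector_space_axioms
    by (simp add: Vector_Spaces.linear_iff L'_def lin_add[OF Ll] lin_scale[OF Ll] lin_add[OF g(1)]
        lin_scale[OF g(1)] scale_left_distrib scale_right_distrib)
  have dense: "closure (L' ` F) = UNIV"
  proof -
    define R where "R z = z + sY (g z) c" for z
    have R_diff: "norm (R x - R z) \<le> 2 * norm (x - z)" for x z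
    proof -
      have "R x - R z = (x - z) + sY (g (x - z)) c"
        by (simp add: R_def lin_diff[OF g(1)] scale_left_diff_distrib)
      then have "norm (R x - R z) \<le> norm (x - z) + norm (g (x - z)) * norm c"
        by (metis norm_triangle_ineq norm_scale)
      also have "norm (g (x - z)) * norm c \<le> D * q (x - z) * norm c" by (intro mult_right_mono g) auto
      also have "\<dots> = (D * norm c) * q (x - z)" by simp
      also have "\<dots> \<le> 1 * norm (x - z)"
        using c g(3) by (intro mult_mono q_le seminorm_nonneg[OF q]) auto
      finally show ?thesis by simp
    qed
    have "z \<in> closure (L' ` F)" for z
      unfolding closure_approachable
    proof (intro allI impI)
      fix e :: real assume e: "e > 0"
      have nz: "1 + g c \<noteq> 0"
      proof
        assume "1 + g c = 0"
        then have "g c = - 1" by (simp add: add_eq_0_iff)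
        then show False using gc by simp
      qed
      \<comment> \<open>The preimage of \<open>z\<close> under \<open>R\<close>, by the rank-one
        inversion (Sherman-Morrison) formula.\<close>
      define x where "x = z - sY (g z / (1 + g c)) c"
      have "g z - g z / (1 + g c) * g c = g z / (1 + g c)" using nz by (simp add: field_simps)
      then have Rx: "R x = z"
        by (simp add: R_def x_def lin_diff[OF g(1)] lin_scale[OF g(1)])
      have "e / 2 > 0" using e by simp
      moreover have "closure (L ` F) = UNIV" using L by (simp add: partial_iso_def)
      ultimately obtain v where v: "v \<in> L ` F" "norm (v - x) < e / 2" using approximate_in_dense by metis
      then obtain u where u: "u \<in> F" "v = L u" by blast
      have "norm (R v - R x) < e" using R_diff[of v x] v(2) by simp
      moreover have "R v = L' u" by (simp add: R_def L'_def u)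
      ultimately show "\<exists>y\<in>L' ` F. dist y z < e" using u Rx by (auto simp: dist_norm)
    qed
    then show ?thesis by auto
  qed
  have fix_W: "L' v = L v" if "v \<in> W" for v using gW that by (simp add: L'_def)
  show "partial_iso L' (insert w W)"
    using L L'l dense w fix_W by (auto simp: partial_iso_def) (simp add: L'_def)
  show "\<forall>z\<in>span W. L' z = L z"
  proof
    fix z assume "z \<in> span W"
    then have "L z \<in> span (L ` W)" using module_hom.span_image[OF linear_module_hom[OF Ll]] by blast
    then have "g (L z) = 0" using functional_span_zero[OF g(1) gW] by blast
    then show "L' z = L z" by (simp add: L'_def)
  qed
qed

lemma partial_iso_forth:
  assumes L: "partial_iso L W" and w: "w \<in> F" and d: "0 < d" "d < 1"
  shows "\<exists>L'. partial_iso L' (insert w W) \<and> (\<forall>z\<in>span W. L' z = L z) \<and>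
    (\<forall>z. norm (L' z - L z) \<le> d * q (L z))"
proof (cases "L w \<in> span (L ` W)")
  case True
  have "span (L ` W) \<subseteq> G" using L G by (intro span_minimal) (auto simp: partial_iso_def)
  then have "partial_iso L (insert w W)" using L w True by (auto simp: partial_iso_def)
  then show ?thesis using d seminorm_nonneg[OF q] by (intro exI[of _ L]) auto
next
  case False
  have "finite (L ` W)" using L by (simp add: partial_iso_def)
  then obtain g where g: "dominated sY q g" "\<forall>v\<in>L ` W. g v = 0" "g (L w) = 1"
    using separating_functional[OF q sep _ False] by blast
  obtain D where D: "D > 0" "\<And>x. norm (g x) \<le> D * q x" using dominatedE[OF q g(1)] by metis
  obtain x where x: "x \<in> G" "norm (x - L w) < d / D"
    using approximate_in_dense[OF G(2), of "d / D"] D(1) d by auto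
  have "D * norm (x - L w) \<le> d" using x(2) D(1) by (simp add: field_simps)
  note * = rank_one_perturbation[OF L dominated_linear[OF g(1)] D(2,1) g(2) this d(2) w]
  show ?thesis
    by (rule exI[of _ "\<lambda>z. L z + sY (g (L z)) (x - L w)"]) (use * x g(3) in simp)
qed

text \<open>A preimage of \<open>x\<close> is forced by moving a nearby \<open>L w\<close> onto
  \<open>x\<close>. How near \<open>L w\<close> must be depends on the bound of the functional, so
  the functional is first chosen at \<open>x\<close> and later renormalised at
  \<open>L w\<close>.\<close>

lemma partial_iso_back:
  assumes L: "partial_iso L W" and x: "x \<in> G" and d: "0 < d" "d < 1"
  shows "\<exists>L' w. partial_iso L' (insert w W) \<and> (\<forall>z\<in>span W. L' z = L z) \<and>
    (\<forall>z. norm (L' z - L z) \<le> d * q (L z)) \<and> x \<in> L' ` span (insert w W)"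
proof (cases "x \<in> span (L ` W)")
  case True
  have "Vector_Spaces.linear sY sY L" using L by (simp add: partial_iso_def)
  then have "span (L ` W) = L ` span W" by (rule module_hom.span_image[OF linear_module_hom])
  also have "\<dots> \<subseteq> L ` span (insert 0 W)" by (intro image_mono span_mono) auto
  finally have "x \<in> L ` span (insert 0 W)" using True by blast
  \<comment> \<open>Nothing has to change here; the vector 0 merely fills the slot of
    \<open>w\<close>.\<close>
  moreover have "partial_iso L (insert 0 W)"
    using L subspace_0[OF F(1)] subspace_0[OF G(1)] by (auto simp: partial_iso_def lin_zero)
  ultimately show ?thesis using d seminorm_nonneg[OF q] by (intro exI[of _ L] exI[of _ 0]) auto
next
  case False
  have "finite (L ` W)" using L by (simp add: partial_iso_def)
  then obtain g where g: "dominated sY q g" "\<forall>v\<in>L ` W. g v = 0" "g x = 1"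
    using separating_functional[OF q sep _ False] by blast
  note gl = dominated_linear[OF g(1)]
  obtain D where D: "D > 0" "\<And>x. norm (g x) \<le> D * q x" using dominatedE[OF q g(1)] by metis
  \<comment> \<open>Half of what the bound \<open>D\<close> would allow: since
    \<open>norm (g (L w)) > 1/2\<close>, renormalising at \<open>L w\<close> at most doubles that
    bound.\<close>
  define e where "e = d / (2 * D)"
  have e: "e > 0" "D * e < 1 / 2" "2 * D * e = d" using D d by (simp_all add: e_def)
  have "closure (L ` F) = UNIV" using L by (simp add: partial_iso_def)
  then obtain v where "v \<in> L ` F" "norm (v - x) < e" using approximate_in_dense e(1) by metis
  then obtain w where w: "w \<in> F" "norm (L w - x) < e" by blast
  have "norm (g (L w - x)) \<le> D * e"
    using D(2)[of "L w - x"] mult_left_mono[of "q (L w - x)" e D] q_le[of "L w - x"] w(2) D(1) by linarith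
  then have "norm (g (L w) - 1) < 1 / 2" using e(2) g(3) by (simp add: lin_diff[OF gl])
  then have gw: "norm (g (L w)) > 1 / 2"
    using norm_triangle_ineq2[of 1 "1 - g (L w)"] by (simp add: norm_minus_commute)
  then have nz: "g (L w) \<noteq> 0" by auto
  define h where "h z = g z / g (L w)" for z
  have hl: "Vector_Spaces.linear sY (*) h"
    using vector_space_axioms
    by (intro linear_functionalI) (simp_all add: h_def lin_add[OF gl] lin_scale[OF gl] add_divide_distrib)
  have hD: "norm (h z) \<le> (2 * D) * q z" for z
  proof -
    have "norm (g z) * 1 \<le> norm (g z) * (2 * norm (g (L w)))"
      using gw by (intro mult_left_mono) auto
    then have "norm (h z) \<le> 2 * norm (g z)" using nz by (simp add: h_def norm_divide field_simps)
    then show ?thesis using D(2)[of z] by simp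
  qed
  have hw: "h (L w) = 1" using nz by (simp add: h_def)
  have "2 * D * norm (x - L w) \<le> 2 * D * e"
    using w(2) D(1) by (intro mult_left_mono) (auto simp: norm_minus_commute)
  then have small: "2 * D * norm (x - L w) \<le> d" using e(3) by simp
  have D2: "2 * D > 0" using D(1) by simp
  have hW: "\<forall>v\<in>L ` W. h v = 0" using g(2) by (simp add: h_def)
  note * = rank_one_perturbation[OF L hl hD D2 hW small d(2) w(1)]
  have "x \<in> (\<lambda>z. L z + sY (h (L z)) (x - L w)) ` span (insert w W)"
    by (intro image_eqI[of _ _ w] span_base) (simp_all add: hw)
  then show ?thesis
    by (intro exI[of _ "\<lambda>z. L z + sY (h (L z)) (x - L w)"] exI[of _ w]) (use * x hw in simp)
qed

text \<open>The estimates use different norms on purpose. If \<open>norm (S x - x) \<le> q x\<close>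
  on an \<open>S\<close>-invariant \<open>F\<close>, they bound the conjugated perturbation in
  \<open>norm\<close> by a multiple of \<open>q\<close>; the lower one also gives
  injectivity.\<close>

theorem dense_subspaces_isomorphism:
  assumes "F = span (range (f :: nat \<Rightarrow> 'y))" "G = span (range (u :: nat \<Rightarrow> 'y))"
  obtains L where "\<And>x y. x \<in> F \<Longrightarrow> y \<in> F \<Longrightarrow> L (x + y) = L x + L y"
    "\<And>c x. x \<in> F \<Longrightarrow> L (sY c x) = sY c (L x)" "L ` F = G"
    "\<And>x. x \<in> F \<Longrightarrow> norm (L x) \<le> 2 * norm x" "\<And>x. x \<in> F \<Longrightarrow> q x \<le> 2 * q (L x)"
proof -
  \<comment> \<open>Steps of relative size \<open>t n / 4\<close> preserve the factors
    \<open>2 - t n\<close> above and \<open>1/2 + t n / 2\<close> below, so that 2 and 1/2 remain in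
    the limit.\<close>
  define t where "t n = (1 / 2 :: real) ^ n" for n
  have t: "0 < t n" "t n \<le> 1" "t (Suc n) = t n / 2" for n by (simp_all add: t_def power_le_one)
  define step where "step n = (\<lambda>(L, W) (L', W'). W \<subseteq> W' \<and> (\<forall>z\<in>span W. L' z = L z) \<and>
      (\<forall>z. norm (L' z - L z) \<le> t n / 4 * q (L z)) \<and> f n \<in> W' \<and> u n \<in> L' ` span W')" for n
  have "\<exists>s. \<forall>n. (case_prod partial_iso (s n) \<and> (n = 0 \<longrightarrow> fst (s n) = (\<lambda>x. x))) \<and> step n (s n) (s (Suc n))"
  proof (rule dependent_nat_choice)
    have "Vector_Spaces.linear sY sY (\<lambda>x. x)" using linear_id by (simp add: id_def)
    then have "partial_iso (\<lambda>x. x) {}" using F(2) by (simp add: partial_iso_def)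
    then show "\<exists>s. case_prod partial_iso s \<and> (0 = (0::nat) \<longrightarrow> fst s = (\<lambda>x. x))"
      by (intro exI[of _ "(\<lambda>x. x, {})"]) simp
  next
    fix s :: "('y \<Rightarrow> 'y) \<times> 'y set" and n :: nat
    assume "case_prod partial_iso s \<and> (n = 0 \<longrightarrow> fst s = (\<lambda>x. x))"
    then obtain L W where s: "s = (L, W)" and L: "partial_iso L W" by (cases s) auto
    \<comment> \<open>The forth step costs \<open>r\<close>. The back step is measured at
      \<open>L1 z\<close>, where \<open>q\<close> has at most doubled, and costs
      \<open>2 * r\<close>; together this is \<open>3 * r = t n / 4\<close>.\<close>
    define r where "r = t n / 12"
    have r: "0 < r" "r < 1" using t[of n] by (simp_all add: r_def)
    have fn: "f n \<in> F" "u n \<in> G" using assms span_base by auto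
    obtain L1 where L1: "partial_iso L1 (insert (f n) W)" "\<forall>z\<in>span W. L1 z = L z"
      "\<And>z. norm (L1 z - L z) \<le> r * q (L z)"
      using partial_iso_forth[OF L fn(1) r] by blast
    obtain L2 w where L2: "partial_iso L2 (insert w (insert (f n) W))"
      "\<forall>z\<in>span (insert (f n) W). L2 z = L1 z" "\<And>z. norm (L2 z - L1 z) \<le> r * q (L1 z)"
      "u n \<in> L2 ` span (insert w (insert (f n) W))"
      using partial_iso_back[OF L1(1) fn(2) r] by blast
    have "span W \<subseteq> span (insert (f n) W)" by (intro span_mono) auto
    then have "\<forall>z\<in>span W. L2 z = L z" using L1(2) L2(2) by auto
    moreover have "norm (L2 z - L z) \<le> t n / 4 * q (L z)" for z
    proof -
      have nn: "q (L z) \<ge> 0" by (rule seminorm_nonneg[OF q])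
      have "q (L1 z) \<le> q (L z) + q (L1 z - L z)"
        using seminorm_triangle[OF q, of "L z" "L1 z - L z"] by simp
      also have "\<dots> \<le> q (L z) + r * q (L z)" using q_le L1(3) order_trans by (intro add_left_mono) blast
      also have "\<dots> \<le> 2 * q (L z)" using r nn mult_right_mono[of r 1 "q (L z)"] by simp
      finally have "r * q (L1 z) \<le> r * (2 * q (L z))" using r by simp
      moreover have "norm (L2 z - L z) \<le> norm (L2 z - L1 z) + norm (L1 z - L z)"
        using norm_triangle_ineq[of "L2 z - L1 z" "L1 z - L z"] by simp
      ultimately have "norm (L2 z - L z) \<le> 3 * r * q (L z)" using L2(3)[of z] L1(3)[of z] by linarith
      then show ?thesis by (simp add: r_def)
    qed
    ultimately have "step n s (L2, insert w (insert (f n) W))"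
      using L2(4) by (auto simp: step_def s)
    then show "\<exists>s'. (case_prod partial_iso s' \<and> (Suc n = 0 \<longrightarrow> fst s' = (\<lambda>x. x))) \<and> step n s s'"
      using L2(1) by (intro exI[of _ "(L2, insert w (insert (f n) W))"]) simp
  qed
  then obtain s where "\<forall>n. (case_prod partial_iso (s n) \<and> (n = 0 \<longrightarrow> fst (s n) = (\<lambda>x. x))) \<and> step n (s n) (s (Suc n))"
    by (rule exE)
  then have s: "\<And>n. case_prod partial_iso (s n)" "\<And>n. step n (s n) (s (Suc n))" "fst (s 0) = (\<lambda>x. x)"
    by simp_all
  define L where "L n = fst (s n)" for n
  define W where "W n = snd (s n)" for n
  have L0: "L 0 z = z" for z using s(3) by (simp add: L_def)
  have iso: "partial_iso (L n) (W n)" for n using s(1)[of n] by (simp add: L_def W_def case_prod_beta)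
  have Ll: "Vector_Spaces.linear sY sY (L n)" for n using iso by (simp add: partial_iso_def)
  have W_Suc: "W n \<subseteq> W (Suc n)" and L_Suc: "z \<in> span (W n) \<Longrightarrow> L (Suc n) z = L n z"
    and L_diff: "norm (L (Suc n) z - L n z) \<le> t n / 4 * q (L n z)"
    and fW: "f n \<in> W (Suc n)" and uW: "u n \<in> L (Suc n) ` span (W (Suc n))" for n z
    using s(2)[of n] by (auto simp: step_def L_def W_def case_prod_beta)
  have W_mono: "W n \<subseteq> W m" if "n \<le> m" for n m using W_Suc that by (rule lift_Suc_mono_le)
  have L_eq: "L m z = L n z" if "n \<le> m" "z \<in> span (W n)" for n m z
    using that(1)
  proof (induction m rule: dec_induct)
    case (step m)
    have "z \<in> span (W m)" using that(2) span_mono[OF W_mono[OF step.hyps(1)]] by blast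
    then show ?case using L_Suc step.IH by simp
  qed simp
  have union: "x \<in> F \<longleftrightarrow> (\<exists>n. x \<in> span (W n))" for x
  proof
    have "subspace {x. \<exists>n. x \<in> span (W n)}"
    proof (rule subspaceI; clarsimp)
      show "\<exists>n. 0 \<in> span (W n)" using span_zero by blast
      show "\<exists>n. sY c x \<in> span (W n)" if "x \<in> span (W n)" for c x n using span_scale[OF that] by blast
      show "\<exists>n. x + y \<in> span (W n)" if "x \<in> span (W n)" "y \<in> span (W m)" for x y n m
      proof -
        have "span (W n) \<subseteq> span (W (max n m))" "span (W m) \<subseteq> span (W (max n m))"
          by (intro span_mono W_mono; simp)+
        then show ?thesis using that by (intro exI[of _ "max n m"] span_add) auto
      qed
    qed
    moreover have "range f \<subseteq> {x. \<exists>n. x \<in> span (W n)}" using fW span_base by blast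
    ultimately have "F \<subseteq> {x. \<exists>n. x \<in> span (W n)}" unfolding assms(1) by (intro span_minimal)
    then show "x \<in> F \<Longrightarrow> \<exists>n. x \<in> span (W n)" by blast
    have "span (W n) \<subseteq> F" for n using iso[of n] F(1) by (intro span_minimal) (auto simp: partial_iso_def)
    then show "\<exists>n. x \<in> span (W n) \<Longrightarrow> x \<in> F" by blast
  qed
  \<comment> \<open>On the span of \<open>W n\<close> the maps are constant from stage
    \<open>n\<close> on, and these spans exhaust \<open>F\<close>. The limit is therefore stationary
    at each point, and no convergence in the whole space is involved.\<close>
  define M where "M x = L (LEAST n. x \<in> span (W n)) x" for x
  have M: "M x = L n x" if "x \<in> span (W n)" for x n
  proof -
    have "(LEAST n. x \<in> span (W n)) \<le> n" using that by (rule Least_le)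
    moreover have "x \<in> span (W (LEAST n. x \<in> span (W n)))" using that by (rule LeastI)
    ultimately have "L n x = L (LEAST n. x \<in> span (W n)) x" by (rule L_eq)
    then show ?thesis by (simp add: M_def)
  qed
  have two: "\<exists>n. x \<in> span (W n) \<and> y \<in> span (W n)" if xy: "x \<in> F" "y \<in> F" for x y
  proof -
    obtain n m where "x \<in> span (W n)" "y \<in> span (W m)" using xy union by blast
    moreover have "span (W n) \<subseteq> span (W (max n m))" "span (W m) \<subseteq> span (W (max n m))"
      by (intro span_mono W_mono; simp)+
    ultimately show ?thesis by blast
  qed
  have norm_L: "norm (L n z) \<le> (2 - t n) * norm (L 0 z)" for n z
  proof (induction n)
    case (Suc n)
    have "norm (L (Suc n) z) \<le> norm (L n z) + norm (L (Suc n) z - L n z)"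
      using norm_triangle_ineq[of "L n z" "L (Suc n) z - L n z"] by simp
    also have "\<dots> \<le> norm (L n z) + t n / 4 * norm (L n z)"
    proof -
      have "t n / 4 * q (L n z) \<le> t n / 4 * norm (L n z)"
        using t(1)[of n] by (intro mult_left_mono q_le) simp
      then show ?thesis using L_diff[of n z] by linarith
    qed
    also have "\<dots> = (1 + t n / 4) * norm (L n z)" by (simp add: algebra_simps)
    also have "\<dots> \<le> (1 + t n / 4) * ((2 - t n) * norm (L 0 z))"
      using Suc t(1)[of n] by (intro mult_left_mono) auto
    also have "\<dots> = ((1 + t n / 4) * (2 - t n)) * norm (L 0 z)" by simp
    also have "\<dots> \<le> (2 - t (Suc n)) * norm (L 0 z)"
      by (intro mult_right_mono) (simp_all add: t(3) algebra_simps)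
    finally show ?case .
  qed (simp add: t_def)
  have q_L: "(1 / 2 + t n / 2) * q (L 0 z) \<le> q (L n z)" for n z
  proof (induction n)
    case (Suc n)
    have "(1 / 2 + t (Suc n) / 2) * q (L 0 z) \<le> ((1 - t n / 4) * (1 / 2 + t n / 2)) * q (L 0 z)"
    proof (intro mult_right_mono seminorm_nonneg[OF q])
      have "t n * t n \<le> t n" using t(1,2)[of n] mult_left_mono[of "t n" 1 "t n"] by simp
      then show "1 / 2 + t (Suc n) / 2 \<le> (1 - t n / 4) * (1 / 2 + t n / 2)"
        by (simp add: t(3) algebra_simps)
    qed
    also have "\<dots> = (1 - t n / 4) * ((1 / 2 + t n / 2) * q (L 0 z))" by simp
    also have "\<dots> \<le> (1 - t n / 4) * q (L n z)"
      using Suc t(2)[of n] by (intro mult_left_mono) auto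
    also have "\<dots> = q (L n z) - t n / 4 * q (L n z)" by (simp add: algebra_simps)
    also have "\<dots> \<le> q (L n z) - q (L n z - L (Suc n) z)"
      using L_diff[of n z] q_le[of "L n z - L (Suc n) z"] by (simp add: norm_minus_commute)
    also have "\<dots> \<le> q (L (Suc n) z)" using seminorm_triangle[OF q, of "L n z - L (Suc n) z" "L (Suc n) z"] by simp
    finally show ?case .
  qed (simp add: t_def)
  show ?thesis
  proof (rule that[of M])
    fix x y assume "x \<in> F" "y \<in> F"
    then obtain n where n: "x \<in> span (W n)" "y \<in> span (W n)" using two by blast
    then show "M (x + y) = M x + M y"
      by (simp only: M[OF n(1)] M[OF n(2)] M[OF span_add[OF n]] lin_add[OF Ll])
  next
    fix c x assume "x \<in> F"
    then obtain n where n: "x \<in> span (W n)" using two by blast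
    then show "M (sY c x) = sY c (M x)" by (simp only: M[OF n] M[OF span_scale[OF n]] lin_scale[OF Ll])
  next
    show "M ` F = G"
    proof
      show "M ` F \<subseteq> G"
      proof clarify
        fix x assume "x \<in> F"
        then obtain n where n: "x \<in> span (W n)" using union by blast
        then have "L n x \<in> span (L n ` W n)" using module_hom.span_image[OF linear_module_hom[OF Ll]] by blast
        moreover have "span (L n ` W n) \<subseteq> G"
          using iso[of n] G(1) by (intro span_minimal) (auto simp: partial_iso_def)
        ultimately show "M x \<in> G" using M[OF n] by auto
      qed
      have add: "M x + M y \<in> M ` F" if "x \<in> F" "y \<in> F" for x y
      proof -
        obtain n where n: "x \<in> span (W n)" "y \<in> span (W n)" using two \<open>x \<in> F\<close> \<open>y \<in> F\<close> by blast
        then have "M (x + y) = M x + M y"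
          by (simp only: M[OF n(1)] M[OF n(2)] M[OF span_add[OF n]] lin_add[OF Ll])
        then show ?thesis using subspace_add[OF F(1) that] by (metis imageI)
      qed
      have "subspace (M ` F)"
      proof (rule subspaceI)
        have "M 0 = 0" by (simp only: M[OF span_zero[of "W 0"]] lin_zero[OF Ll])
        then show "0 \<in> M ` F" using subspace_0[OF F(1)] by (metis imageI)
        fix c x assume "x \<in> M ` F"
        then obtain y where y: "y \<in> F" "x = M y" by blast
        then obtain n where n: "y \<in> span (W n)" using union by blast
        then have "M (sY c y) = sY c x" by (simp only: y(2) M[OF n] M[OF span_scale[OF n]] lin_scale[OF Ll])
        then show "sY c x \<in> M ` F" using subspace_scale[OF F(1) y(1)] by (metis imageI)
      qed (use add in blast)
      moreover have "range u \<subseteq> M ` F"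
      proof clarify
        fix n
        obtain x where x: "x \<in> span (W (Suc n))" "u n = L (Suc n) x" using uW by blast
        then have "x \<in> F" using union by blast
        then show "u n \<in> M ` F" using M[OF x(1)] x(2) by (metis imageI)
      qed
      ultimately show "G \<subseteq> M ` F" unfolding assms(2) by (intro span_minimal)
    qed
  next
    fix x assume "x \<in> F"
    then obtain n where n: "x \<in> span (W n)" using union by blast
    have "(2 - t n) * norm x \<le> 2 * norm x" using t(1)[of n] by (intro mult_right_mono) auto
    then show "norm (M x) \<le> 2 * norm x" using norm_L[of n x] M[OF n] by (simp add: L0)
    have "1 / 2 * q x \<le> (1 / 2 + t n / 2) * q x"
      using t(1)[of n] by (intro mult_right_mono seminorm_nonneg[OF q]) auto
    then show "q x \<le> 2 * q (M x)" using q_L[of n x] M[OF n] by (simp add: L0)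
  qed
qed

end

section \<open>Spaces with a continuous seminorm of infinite rank\<close>

text \<open>\<open>T\<close> is \<open>S\<close>, restricted to the span of its dense orbit,
  conjugated by the isomorphism onto \<open>G\<close>. The factor 4 collects 2 from \<open>L\<close>
  in the norm and 2 from its inverse in the weak norm. All claims stay within \<open>G\<close>
  because \<open>inv_into F L\<close> is meaningful only there.\<close>

theorem hypercyclic_on_finite_sequences:
  fixes \<beta> :: "nat \<Rightarrow> real"
  assumes \<beta>: "\<And>j. 0 < \<beta> j" "\<And>j. \<beta> j \<le> 1"
  defines "G \<equiv> l1.span (range (l1_unit :: nat \<Rightarrow> 'k::{real_normed_field, banach, second_countable_topology} l1))"
  obtains T x where "\<And>a. a \<in> G \<Longrightarrow> T a \<in> G"
    "\<And>a b. a \<in> G \<Longrightarrow> b \<in> G \<Longrightarrow> T (a + b) = T a + T b"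
    "\<And>c a. a \<in> G \<Longrightarrow> T (l1_scale c a) = l1_scale c (T a)"
    "\<And>a. a \<in> G \<Longrightarrow> norm (T a - a) \<le> 4 * l1_weak \<beta> a"
    "x \<in> G" "\<And>z d. z \<in> G \<Longrightarrow> d > 0 \<Longrightarrow> \<exists>n. norm ((T ^^ n) x - z) < d"
proof -
  obtain S :: "'k l1 \<Rightarrow> 'k l1" and y where S: "Vector_Spaces.linear l1_scale l1_scale S"
    "\<And>a. norm (S a - a) \<le> l1_weak \<beta> a" "closure (range (\<lambda>n. (S ^^ n) y)) = UNIV"
    using hypercyclic_perturbation_of_identity[where \<beta> = \<beta>, OF \<beta>] by blast
  define f where "f n = (S ^^ n) y" for n
  define F where "F = l1.span (range f)"
  note q = seminorm_l1_weak[where \<beta> = \<beta> and ?'k = 'k, OF \<beta>]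
  have F_dense: "closure F = UNIV"
  proof -
    have "closure (range f) = UNIV" using S(3) by (simp add: f_def)
    then show ?thesis using closure_mono[OF l1.span_superset[of "range f"]] by (auto simp: F_def)
  qed
  have sep: "\<exists>h. dominated l1_scale (l1_weak \<beta>) h \<and> h a = 1" if "a \<noteq> 0" for a :: "'k l1"
  proof -
    obtain j where "l1_nth a j \<noteq> 0" using \<open>a \<noteq> 0\<close> l1_eqI[of a 0] by auto
    then show ?thesis by (rule dominated_normalize[OF dominated_l1_nth[where \<beta> = \<beta>, OF \<beta>]])
  qed
  have F_sub: "l1.subspace F" and G_sub: "l1.subspace G"
    by (simp_all only: F_def G_def l1.subspace_span)
  have G_dense: "closure G = UNIV" unfolding G_def by (rule l1_span_units_dense)
  interpret ds: dense_subspaces l1_scale "l1_weak \<beta>" F G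
    by (rule dense_subspaces.intro[OF seminorm_l1_norm q l1_weak_le_norm[where \<beta> = \<beta>, OF \<beta>] sep
          F_sub F_dense G_sub G_dense])
  obtain L where L: "\<And>x y. x \<in> F \<Longrightarrow> y \<in> F \<Longrightarrow> L (x + y) = L x + L y"
    "\<And>c x. x \<in> F \<Longrightarrow> L (l1_scale c x) = l1_scale c (L x)" "L ` F = G"
    "\<And>x. x \<in> F \<Longrightarrow> norm (L x) \<le> 2 * norm x"
    "\<And>x. x \<in> F \<Longrightarrow> l1_weak \<beta> x \<le> 2 * l1_weak \<beta> (L x)"
    using ds.dense_subspaces_isomorphism[OF F_def meta_eq_to_obj_eq[OF G_def]] by blast
  have L_diff: "L (x - z) = L x - L z" if "x \<in> F" "z \<in> F" for x z
    using L(1)[of x "- z"] L(2)[of z "- 1"] that l1.subspace_neg[OF F_sub] by simp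
  have L_inj: "inj_on L F"
  proof (rule inj_onI)
    fix x z assume xz: "x \<in> F" "z \<in> F" "L x = L z"
    then have "L (x - z) = 0" using L_diff by simp
    then have "l1_weak \<beta> (x - z) \<le> 0"
      using L(5)[of "x - z"] xz l1.subspace_diff[OF F_sub] by (simp add: seminorm_zero[OF q])
    then have "l1_weak \<beta> (x - z) = 0" using seminorm_nonneg[OF q, of "x - z"] by simp
    then show "x = z" using l1_weak_eq_0_iff[where \<beta> = \<beta> and a = "x - z", OF \<beta>] by simp
  qed
  have S_F: "S w \<in> F" if "w \<in> F" for w
  proof -
    have "S w \<in> S ` l1.span (range f)" using that by (simp add: F_def)
    also have "\<dots> = l1.span (S ` range f)" by (rule module_hom.span_image[OF linear_module_hom[OF S(1)], symmetric])
    also have "\<dots> \<subseteq> F" unfolding F_def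
    proof (rule l1.span_mono)
      have "S (f n) = f (Suc n)" for n by (simp add: f_def)
      then show "S ` range f \<subseteq> range f" by auto
    qed
    finally show ?thesis .
  qed
  define R where "R = inv_into F L"
  have R: "R a \<in> F" "L (R a) = a" if "a \<in> G" for a
    using that L(3) by (auto simp: R_def inv_into_into f_inv_into_f)
  have RL: "R (L w) = w" if "w \<in> F" for w using that L_inj by (simp add: R_def)
  define T where "T a = L (S (R a))" for a
  have TL: "T (L w) = L (S w)" if "w \<in> F" for w using RL[OF that] by (simp add: T_def)
  have fF: "f n \<in> F" for n by (simp add: F_def l1.span_base)
  have Tn: "(T ^^ n) (L y) = L (f n)" for n
    by (induction n) (use TL[OF fF] in \<open>simp_all add: f_def\<close>)
  show ?thesis
  proof (rule that)
    show "T a \<in> G" if "a \<in> G" for a using S_F[OF R(1)[OF that]] L(3) by (auto simp: T_def)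
  next
    fix a b assume ab: "a \<in> G" "b \<in> G"
    have "a + b = L (R a + R b)" using L(1) R ab by simp
    then have "T (a + b) = L (S (R a + R b))" using TL l1.subspace_add[OF F_sub R(1) R(1), of a b] ab by simp
    then show "T (a + b) = T a + T b" using L(1) S_F R(1) ab by (simp add: lin_add[OF S(1)] T_def)
  next
    fix c a assume a: "a \<in> G"
    have "l1_scale c a = L (l1_scale c (R a))" using L(2) R a by simp
    then have "T (l1_scale c a) = L (S (l1_scale c (R a)))" using TL l1.subspace_scale[OF F_sub R(1), of a c] a by simp
    then show "T (l1_scale c a) = l1_scale c (T a)" using L(2) S_F R(1) a by (simp add: lin_scale[OF S(1)] T_def)
  next
    fix a assume a: "a \<in> G"
    have "T a - a = L (S (R a) - R a)" using L_diff S_F R a by (simp add: T_def)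
    also have "norm \<dots> \<le> 2 * norm (S (R a) - R a)"
      using L(4) l1.subspace_diff[OF F_sub S_F[OF R(1)] R(1), of a a] a by simp
    also have "\<dots> \<le> 2 * l1_weak \<beta> (R a)" using S(2) by simp
    also have "\<dots> \<le> 2 * (2 * l1_weak \<beta> a)" using L(5)[OF R(1)] R(2) a by simp
    finally show "norm (T a - a) \<le> 4 * l1_weak \<beta> a" by simp
  next
    show "L y \<in> G" using fF[of 0] L(3) by (auto simp: f_def)
    fix z and d :: real assume z: "z \<in> G" and d: "d > 0"
    have "R z \<in> closure (range (\<lambda>n. (S ^^ n) y))" using S(3) by simp
    then obtain n where n: "norm (f n - R z) < d / 2"
      using d unfolding closure_approachable f_def by (auto simp: dist_norm dest: spec[of _ "d / 2"])
    have "norm ((T ^^ n) (L y) - z) = norm (L (f n - R z))" using L_diff[OF fF R(1)] R(2) z by (simp add: Tn)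
    also have "\<dots> \<le> 2 * norm (f n - R z)" by (intro L(4) l1.subspace_diff[OF F_sub] fF R z)
    finally show "\<exists>n. norm ((T ^^ n) (L y) - z) < d" using n by (intro exI[of _ n]) simp
  qed
qed

text \<open>\<open>c\<close> after \<open>J\<close> is the identity on finitely supported sequences,
  but \<open>J\<close> after \<open>c\<close> is known to be so only on the span of the
  \<open>e n\<close>, which may be a proper subspace. Still \<open>T (J a) = J (S a)\<close>, so the
  orbit of \<open>J x0\<close> is the image of a dense orbit under a continuous map with dense
  range.\<close>

theorem hypercyclic_of_infinite_rank:
  fixes sc :: "'k::{real_normed_field, banach, second_countable_topology} \<Rightarrow> 'a::{ab_group_add, t2_space} \<Rightarrow> 'a"
    and b :: "nat \<Rightarrow> 'a"
  assumes fs: "fundamental_seminorms sc p"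
    and hb: "\<And>x. p K x \<noteq> 0 \<Longrightarrow> \<exists>f. dominated sc (p K) f \<and> f x = 1"
    and inf: "\<not> finite_rank sc (p K)" and b: "module.span sc (range b) = UNIV"
  shows "\<exists>T. hypercyclic sc T"
proof -
  have sn: "seminorm sc (p k)" and mono: "mono (\<lambda>k. p k x)" for k x
    using fs by (auto simp: fundamental_seminorms_def)
  interpret vector_space sc by (rule seminorm_space[OF sn])
  show ?thesis
  proof (rule biorthogonal_system_exists[where p = p and K = K and b = b, OF sn mono hb inf b], assumption)
    fix e g
    assume dom: "\<And>n. dominated sc (p K) (g n)"
      and orth: "\<And>n m. g n (e m) = (if n = m then 1 else 0)"
      and fin: "\<And>x. \<exists>N. \<forall>n\<ge>N. g n x = 0" and e1: "\<And>n. p n (e n) \<le> 1"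
      and dense: "\<And>x k d. d > 0 \<Longrightarrow> \<exists>y\<in>span (range e). p k (x - y) < d"
    note gl = dominated_linear[OF dom]
    have "\<exists>C>0. \<forall>x. norm (g n x) \<le> C * p K x" for n using dominatedE[OF sn dom] by metis
    then obtain C where C: "\<And>n. C n > 0" "\<And>n x. norm (g n x) \<le> C n * p K x" by metis
    \<comment> \<open>The denominator offsets the domination constant of \<open>g n\<close>, the
      geometric factor makes the weighted sum converge; together the weak norm of \<open>c x\<close>
      is at most \<open>2 * p K x\<close>.\<close>
    define \<beta> where "\<beta> n = (1 / 2) ^ n / (1 + C n)" for n
    have \<beta>: "0 < \<beta> n" "\<beta> n \<le> 1" "\<beta> n * C n \<le> (1 / 2) ^ n" for n
    proof -
      have c: "C n > 0" by (rule C)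
      show "0 < \<beta> n" using c by (simp add: \<beta>_def)
      show "\<beta> n \<le> 1" using c power_le_one[of "1 / 2 :: real" n] by (simp add: \<beta>_def)
      show "\<beta> n * C n \<le> (1 / 2) ^ n" using c by (simp add: \<beta>_def divide_simps)
    qed
    define G where "G = l1.span (range (l1_unit :: nat \<Rightarrow> 'k l1))"
    have G_sub: "l1.subspace G" by (simp add: G_def l1.subspace_span)
    obtain S x0 where S: "\<And>a. a \<in> G \<Longrightarrow> S a \<in> G"
      "\<And>a b. a \<in> G \<Longrightarrow> b \<in> G \<Longrightarrow> S (a + b) = S a + S b"
      "\<And>c a. a \<in> G \<Longrightarrow> S (l1_scale c a) = l1_scale c (S a)"
      "\<And>a. a \<in> G \<Longrightarrow> norm (S a - a) \<le> 4 * l1_weak \<beta> a"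
      "x0 \<in> G" "\<And>z d. z \<in> G \<Longrightarrow> d > 0 \<Longrightarrow> \<exists>n. norm ((S ^^ n) x0 - z) < d"
      using hypercyclic_on_finite_sequences[where \<beta> = \<beta> and ?'k = 'k, OF \<beta>(1,2)] unfolding G_def by blast

    define c where "c x = Abs_l1 (\<lambda>n. g n x)" for x
    have c_nth: "l1_nth (c x) n = g n x" for x n
    proof -
      obtain N where N: "\<And>n. n \<ge> N \<Longrightarrow> g n x = 0" using fin by blast
      have "summable (\<lambda>n. norm (g n x))"
        by (rule summable_finite[of "{..<N}"]) (use N in auto)
      then show ?thesis by (simp add: c_def Abs_l1_inverse)
    qed
    have c_G: "c x \<in> G" for x using fin by (simp add: G_def l1_span_units c_nth)
    have c_add: "c (x + y) = c x + c y" and c_scale: "c (sc r x) = l1_scale r (c x)" for x y r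
      by (auto intro!: l1_eqI simp: c_nth lin_add[OF gl] lin_scale[OF gl])
    have c_weak: "l1_weak \<beta> (c x) \<le> 2 * p K x" for x
    proof -
      have "\<beta> n * norm (g n x) \<le> (1 / 2) ^ n * p K x" for n
      proof -
        have "\<beta> n * norm (g n x) \<le> \<beta> n * (C n * p K x)" using \<beta>(1)[of n] C(2) by (intro mult_left_mono) auto
        also have "\<dots> \<le> (1 / 2) ^ n * p K x"
          using mult_right_mono[OF \<beta>(3) seminorm_nonneg[OF sn]] by (simp add: mult.assoc)
        finally show ?thesis .
      qed
      then have "l1_weak \<beta> (c x) \<le> (\<Sum>n. (1 / 2) ^ n * p K x)"
        unfolding l1_weak_def c_nth
        using summable_l1_weak[where \<beta> = \<beta>, OF \<beta>(1,2), of "c x"]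
        by (intro suminf_le summable_mult2 summable_geometric) (auto simp: c_nth)
      also have "\<dots> = 2 * p K x"
        using suminf_mult2[OF summable_geometric[of "1/2 :: real"], of "p K x"] suminf_geometric[of "1/2 :: real"]
        by simp
      finally show ?thesis .
    qed

    define J where "J a = expansion sc e (l1_nth a)" for a
    have G_zero: "\<exists>N. \<forall>n\<ge>N. l1_nth a n = 0" if "a \<in> G" for a
      using that by (simp add: G_def l1_span_units)
    have J_add: "J (a + b) = J a + J b" if "a \<in> G" "b \<in> G" for a b
      using expansion_add[OF vector_space_axioms G_zero[OF that(1)] G_zero[OF that(2)], of e]
      by (simp add: J_def l1_nth_simps(2)[abs_def])
    have J_scale: "J (l1_scale r a) = sc r (J a)" if "a \<in> G" for a r
      using expansion_scale[OF vector_space_axioms G_zero[OF that], of e r]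
      by (simp add: J_def l1_nth_scale[abs_def])
    have J_diff: "J (a - b) = J a - J b" if ab: "a \<in> G" "b \<in> G" for a b
      using J_add[of a "- b"] J_scale[of b "- 1"] ab l1.subspace_neg[OF G_sub] by simp
    \<comment> \<open>A bound for \<open>p k (e n)\<close> over all \<open>n\<close>: the sum
      handles the finitely many \<open>n < k\<close>, and for \<open>n \<ge> k\<close> one has
      \<open>p k (e n) \<le> p n (e n) \<le> 1\<close>.\<close>
    define B where "B k = 1 + (\<Sum>n<k. p k (e n))" for k
    have B_pos: "B k > 0" for k unfolding B_def
      by (intro add_pos_nonneg sum_nonneg seminorm_nonneg[OF sn]) auto
    have B: "p k (e n) \<le> B k" for k n
    proof (cases "n < k")
      case True
      then have "p k (e n) \<le> (\<Sum>n<k. p k (e n))"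
        by (intro member_le_sum seminorm_nonneg[OF sn]) auto
      then show ?thesis by (simp add: B_def)
    next
      case False
      then have "p k (e n) \<le> p n (e n)" using monoD[OF mono, of k n] by simp
      also have "\<dots> \<le> 1" by (rule e1)
      also have "\<dots> \<le> B k" unfolding B_def using sum_nonneg[of "{..<k}" "\<lambda>n. p k (e n)"] seminorm_nonneg[OF sn] by simp
      finally show ?thesis .
    qed
    have J_bound: "p k (J a) \<le> B k * norm a" if aG: "a \<in> G" for k a
    proof -
      obtain N where N: "\<forall>n\<ge>N. l1_nth a n = 0" using G_zero[OF aG] by blast
      have "p k (J a) \<le> (\<Sum>n<N. norm (l1_nth a n) * p k (e n))"
        unfolding J_def by (rule seminorm_expansion_le[OF sn N])
      also have "\<dots> \<le> (\<Sum>n<N. norm (l1_nth a n) * B k)" by (intro sum_mono mult_left_mono B) auto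
      also have "\<dots> = B k * (\<Sum>n<N. norm (l1_nth a n))" by (simp add: sum_distrib_left mult.commute)
      also have "\<dots> \<le> B k * norm a"
        unfolding norm_l1_eq using B_pos[of k]
        by (intro mult_left_mono sum_le_suminf summable_l1_nth) auto
      finally show ?thesis .
    qed
    have gJ: "g m (J a) = l1_nth a m" if "a \<in> G" for m a
      unfolding J_def by (rule functional_expansion[OF gl G_zero[OF that] orth])
    have cJ: "c (J a) = a" if "a \<in> G" for a by (intro l1_eqI) (simp add: c_nth gJ that)

    define T where "T x = x + J (S (c x) - c x)" for x
    have Sc_G: "S (c x) - c x \<in> G" for x by (intro l1.subspace_diff[OF G_sub] S(1) c_G)
    have T_linear: "Vector_Spaces.linear sc sc T"
      unfolding Vector_Spaces.linear_iff
    proof (intro conjI allI vector_space_axioms)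
      fix x y
      have "S (c (x + y)) - c (x + y) = (S (c x) - c x) + (S (c y) - c y)"
        by (simp add: c_add S(2)[OF c_G c_G])
      then show "T (x + y) = T x + T y" by (simp add: T_def J_add[OF Sc_G Sc_G])
    next
      fix r x
      have "S (c (sc r x)) - c (sc r x) = l1_scale r (S (c x) - c x)"
        by (simp add: c_scale S(3)[OF c_G] l1.scale_right_diff_distrib)
      then show "T (sc r x) = sc r (T x)" by (simp add: T_def J_scale[OF Sc_G] scale_right_distrib)
    qed
    have T_bound: "p k (T x) \<le> (1 + 8 * B k) * p (max k K) x" for k x
    proof -
      have le: "p k x \<le> p (max k K) x" "p K x \<le> p (max k K) x" using monoD[OF mono] by simp_all
      have "p k (T x) \<le> p k x + B k * norm (S (c x) - c x)"
        unfolding T_def by (rule order_trans[OF seminorm_triangle[OF sn] add_left_mono[OF J_bound[OF Sc_G]]])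
      also have "norm (S (c x) - c x) \<le> 4 * (2 * p K x)"
        using S(4)[OF c_G, of x] c_weak[of x] by simp
      also have "p k x + B k * (4 * (2 * p K x)) \<le> p (max k K) x + B k * (4 * (2 * p (max k K) x))"
        using B_pos[of k] le by (intro add_mono mult_left_mono) auto
      finally show ?thesis using B_pos[of k] by (simp add: algebra_simps)
    qed
    have TJ: "T (J a) = J (S a)" if "a \<in> G" for a
      using J_diff[OF S(1)[OF that] that] by (simp add: T_def cJ[OF that])
    have Sn_G: "(S ^^ n) x0 \<in> G" for n by (induction n) (use S in auto)
    have Tn: "(T ^^ n) (J x0) = J ((S ^^ n) x0)" for n
      by (induction n) (use TJ[OF Sn_G] in simp_all)
    have Jc: "J (c y) = y" if "y \<in> span (range e)" for y
    proof -
      have "span (range e) \<subseteq> {y. J (c y) = y}"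
      proof (rule span_minimal)
        have "J (c (e m)) = e m" for m
        proof -
          have "J (c (e m)) = (\<Sum>n<Suc m. sc (l1_nth (c (e m)) n) (e n))"
            unfolding J_def by (rule expansion_eq_sum[OF vector_space_axioms]) (simp add: c_nth orth)
          also have "\<dots> = (\<Sum>n<Suc m. if n = m then e m else 0)"
            by (intro sum.cong) (auto simp: c_nth orth)
          finally show ?thesis by simp
        qed
        then show "range e \<subseteq> {y. J (c y) = y}" by auto
        have "J (c 0) = 0" by (simp add: J_def expansion_def c_nth lin_zero[OF gl])
        then show "subspace {y. J (c y) = y}"
          by (intro subspaceI) (simp_all add: c_add c_scale J_add[OF c_G c_G] J_scale[OF c_G])
      qed
      then show ?thesis using that by blast
    qed
    have "hypercyclic sc T"
    proof (rule hypercyclicI[OF fs T_linear, where x = "J x0"])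
      show "\<exists>l D. \<forall>x. p k (T x) \<le> D * p l x" for k using T_bound by blast
      fix k and d :: real and z assume d: "d > 0"
      obtain y where y: "y \<in> span (range e)" "p k (z - y) < d / 2" using dense[of "d / 2"] d by auto
      obtain n where n: "norm ((S ^^ n) x0 - c y) < d / (2 * B k)"
        using S(6)[OF c_G, of "d / (2 * B k)" y] d B_pos[of k] by auto
      have "p k ((T ^^ n) (J x0) - y) = p k (J ((S ^^ n) x0 - c y))"
        using J_diff[OF Sn_G c_G] Jc[OF y(1)] by (simp add: Tn)
      also have "\<dots> \<le> B k * norm ((S ^^ n) x0 - c y)"
        by (intro J_bound l1.subspace_diff[OF G_sub] Sn_G c_G)
      also have "\<dots> < d / 2" using n B_pos[of k] by (simp add: field_simps)
      finally have "p k ((T ^^ n) (J x0) - z) < d"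
        using seminorm_triangle_sub[OF sn, of k "(T ^^ n) (J x0)" z y] y(2)
        by (simp add: seminorm_diff_commute[OF sn, of k y z])
      then show "\<exists>n. p k ((T ^^ n) (J x0) - z) < d" by blast
    qed
    then show ?thesis by blast
  qed
qed

section \<open>Spaces all of whose continuous seminorms have finite rank\<close>

text \<open>Concatenate all nonempty finite words over a countable dense set of scalars. The result
  is a hypercyclic vector of the backward shift on the space of all sequences.\<close>

lemma hypercyclic_sequence_exists:
  shows "\<exists>a :: nat \<Rightarrow> 'k::{metric_space, second_countable_topology}.
    \<forall>m c. \<forall>e>0. \<exists>n. \<forall>i<m. dist (a (n + i)) (c i) < e"
proof -
  obtain C :: "'k set" where C: "countable C" "\<And>U. open U \<Longrightarrow> U \<noteq> {} \<Longrightarrow> \<exists>d\<in>C. d \<in> U"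
    by (rule countable_dense_setE) (rule that)
  define S where "S = lists C - {[]}"
  have "\<exists>d. d \<in> C" using C(2)[of UNIV] by blast
  then obtain d where "d \<in> C" by blast
  then have "[d] \<in> S" by (simp add: S_def)
  then have S: "countable S" "S \<noteq> {}" using C(1) by (simp_all only: S_def countable_Diff countable_lists) blast+
  define l where "l = from_nat_into S"
  have l: "range l = S" unfolding l_def using S by simp
  then have l_ne: "l n \<noteq> []" for n unfolding S_def by blast
  \<comment> \<open>The concatenation of the first \<open>m\<close> words. Each word is nonempty, so
    \<open>b m\<close> has length at least \<open>m\<close>, and its entry number \<open>j\<close>
    is available from \<open>b (Suc j)\<close> on.\<close>
  define b where "b m = concat (map l [0..<m])" for m
  have len: "m \<le> length (b m)" for m
  proof (induction m)
    case (Suc m)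
    have "length (l m) > 0" using l_ne by simp
    then have "Suc m \<le> length (b m) + length (l m)" using Suc by linarith
    then show ?case by (simp add: b_def)
  qed simp
  define a where "a j = b (Suc j) ! j" for j
  have a: "a (length (b m) + i) = l m ! i" if "i < length (l m)" for m i
  proof -
    define j where "j = length (b m) + i"
    have "m \<le> j" using len[of m] by (simp add: j_def)
    then have "[0..<Suc j] = [0..<m] @ m # [Suc m..<Suc j]"
      using upt_add_eq_append[of 0 m "Suc j - m"] upt_conv_Cons[of m "Suc j"] by simp
    then have "b (Suc j) = b m @ l m @ concat (map l [Suc m..<Suc j])" by (simp add: b_def del: upt_Suc)
    then have "b (Suc j) ! j = l m ! i" using that by (simp add: j_def nth_append)
    then show ?thesis by (simp add: a_def j_def)
  qed
  show ?thesis
  proof (intro exI[of _ a] allI impI)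
    fix m :: nat and c :: "nat \<Rightarrow> 'k" and e :: real assume e: "e > 0"
    have "\<forall>i. \<exists>d\<in>C. dist d (c i) < e"
    proof
      fix i
      have "\<exists>d\<in>C. d \<in> ball (c i) e" using e by (intro C(2)) auto
      then show "\<exists>d\<in>C. dist d (c i) < e" by (auto simp: dist_commute)
    qed
    then obtain d where d: "\<And>i. d i \<in> C" "\<And>i. dist (d i) (c i) < e" by metis
    \<comment> \<open>One letter more than required, so that the word is nonempty also for
      \<open>m = 0\<close>.\<close>
    have "map d [0..<Suc m] \<in> S" using d(1) by (auto simp: S_def)
    then have "map d [0..<Suc m] \<in> range l" using l by simp
    then obtain k where "map d [0..<Suc m] = l k" by (rule rangeE)
    then have k: "l k = map d [0..<Suc m]" by (rule sym)
    have "a (length (b k) + i) = d i" if "i < m" for i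
    proof -
      have "a (length (b k) + i) = l k ! i" using that by (intro a) (simp add: k)
      also have "\<dots> = d i" using that by (simp add: k del: upt_Suc)
      finally show ?thesis .
    qed
    then have "\<forall>i<m. dist (a (length (b k) + i)) (c i) < e" using d(2) by simp
    then show "\<exists>n. \<forall>i<m. dist (a (n + i)) (c i) < e" by blast
  qed
qed

text \<open>A new functional \<open>h j\<close> either takes a nonzero value at some
  \<open>z\<close> in the common kernel of the others, and \<open>z\<close> joins the spanning set,
  or it vanishes on that kernel and is matched automatically.\<close>

lemma finite_rank_functionals:
  fixes sc :: "'k::real_normed_field \<Rightarrow> 'a::ab_group_add \<Rightarrow> 'a"
  assumes vs: "vector_space sc" and "finite I" and lin: "\<And>i. i \<in> I \<Longrightarrow> Vector_Spaces.linear sc (*) (h i)"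
  shows "\<exists>F. finite F \<and> (\<forall>x. \<exists>y\<in>module.span sc F. \<forall>i\<in>I. h i (x - y) = 0)"
  using assms(2,3)
proof (induction I rule: finite_induct)
  case empty
  interpret vector_space sc by fact
  show ?case by (intro exI[of _ "{}"]) auto
next
  case (insert j I)
  interpret vector_space sc by fact
  obtain F where F: "finite F" "\<And>x. \<exists>y\<in>span F. \<forall>i\<in>I. h i (x - y) = 0" using insert by auto
  have hl: "Vector_Spaces.linear sc (*) (h i)" if "i \<in> insert j I" for i using insert.prems that .
  show ?case
  proof (cases "\<exists>z. (\<forall>i\<in>I. h i z = 0) \<and> h j z \<noteq> 0")
    case True
    then obtain z where z: "\<And>i. i \<in> I \<Longrightarrow> h i z = 0" "h j z \<noteq> 0" by blast
    have "\<exists>y\<in>span (insert z F). \<forall>i\<in>insert j I. h i (x - y) = 0" for x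
    proof -
      obtain y where y: "y \<in> span F" "\<And>i. i \<in> I \<Longrightarrow> h i (x - y) = 0" using F(2) by blast
      define y' where "y' = y + sc (h j (x - y) / h j z) z"
      have eq: "h i (x - y') = h i (x - y) - h j (x - y) / h j z * h i z" if "i \<in> insert j I" for i
        unfolding y'_def by (simp add: lin_diff[OF hl[OF that]] lin_add[OF hl[OF that]] lin_scale[OF hl[OF that]])
      have "h i (x - y') = 0" if "i \<in> insert j I" for i
        using eq[OF that] y(2)[of i] z that by (cases "i = j") auto
      moreover have "y' \<in> span (insert z F)"
        unfolding y'_def using y(1) span_mono[of F "insert z F"]
        by (intro span_add span_scale) (auto intro: span_base)
      ultimately show ?thesis by blast
    qed
    then show ?thesis using F(1) by (intro exI[of _ "insert z F"]) simp
  next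
    case False
    then show ?thesis using F by (intro exI[of _ F]) blast
  qed
qed

text \<open>The seminorm \<open>p2 k\<close> sees only finitely many \<open>e2 n\<close>, hence only
  finitely many coordinates \<open>g1 n x\<close>, and one \<open>p1 l\<close> dominates all of
  these. Applied in both directions, the lemma yields mutually inverse continuous maps.\<close>

lemma expansion_map_exists:
  fixes p1 :: "nat \<Rightarrow> 'a::ab_group_add \<Rightarrow> real" and p2 :: "nat \<Rightarrow> 'b::ab_group_add \<Rightarrow> real"
    and g1 :: "nat \<Rightarrow> 'a \<Rightarrow> 'k::real_normed_field" and s1 :: "'k::real_normed_field \<Rightarrow> 'a \<Rightarrow> 'a" and s2 :: "'k \<Rightarrow> 'b \<Rightarrow> 'b"
  assumes sn1: "\<And>k. seminorm s1 (p1 k)" and mono1: "\<And>x. mono (\<lambda>k. p1 k x)"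
    and sn2: "\<And>k. seminorm s2 (p2 k)"
    and dom: "\<And>n. \<exists>k. dominated s1 (p1 k) (g1 n)" and fin: "\<And>x. \<exists>N. \<forall>n\<ge>N. g1 n x = 0"
    and lin2: "\<And>n. Vector_Spaces.linear s2 (*) (g2 n)"
    and orth: "\<And>n m. g2 n (e2 m) = (if n = m then 1 else 0)"
    and small: "\<And>k. \<exists>N. \<forall>n\<ge>N. p2 k (e2 n) = 0"
  obtains \<Phi> where "Vector_Spaces.linear s1 s2 \<Phi>" "\<And>n x. g2 n (\<Phi> x) = g1 n x"
    "\<And>k. \<exists>l C. \<forall>x. p2 k (\<Phi> x) \<le> C * p1 l x"
proof -
  interpret v1: vector_space s1 by (rule seminorm_space[OF sn1])
  interpret v2: vector_space s2 by (rule seminorm_space[OF sn2])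
  have gl: "Vector_Spaces.linear s1 (*) (g1 n)" for n using dom dominated_linear by blast
  define \<Phi> where "\<Phi> x = expansion s2 e2 (\<lambda>n. g1 n x)" for x
  show ?thesis
  proof (rule that[of \<Phi>])
    show "Vector_Spaces.linear s1 s2 \<Phi>"
      by (simp add: Vector_Spaces.linear_iff v1.vector_space_axioms v2.vector_space_axioms \<Phi>_def
          lin_add[OF gl] lin_scale[OF gl] expansion_add[OF v2.vector_space_axioms fin fin]
          expansion_scale[OF v2.vector_space_axioms fin])
    show "g2 m (\<Phi> x) = g1 m x" for m x
      unfolding \<Phi>_def by (rule functional_expansion[OF lin2 fin orth])
    fix k
    obtain N where N: "\<And>n. n \<ge> N \<Longrightarrow> p2 k (e2 n) = 0" using small by blast
    obtain \<kappa> where \<kappa>: "\<And>n. dominated s1 (p1 (\<kappa> n)) (g1 n)" using dom by metis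
    define l where "l = (\<Sum>n<N. \<kappa> n)"
    have "\<exists>C. \<forall>x. norm (g1 n x) \<le> C * p1 l x" if "n < N" for n
    proof -
      have "\<kappa> n \<le> l" unfolding l_def using that by (intro member_le_sum) auto
      then have "dominated s1 (p1 l) (g1 n)" by (intro dominated_mono[OF sn1 \<kappa>] monoD[OF mono1])
      then show ?thesis by (simp add: dominated_def)
    qed
    then obtain C where C: "\<And>n x. n < N \<Longrightarrow> norm (g1 n x) \<le> C n * p1 l x" by metis
    have "p2 k (\<Phi> x) \<le> (\<Sum>n<N. C n * p2 k (e2 n)) * p1 l x" for x
    proof -
      obtain M where "\<forall>n\<ge>M. g1 n x = 0" using fin by metis
      then have M: "\<forall>n\<ge>max N M. g1 n x = 0" by simp
      have "p2 k (\<Phi> x) \<le> (\<Sum>n<max N M. norm (g1 n x) * p2 k (e2 n))"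
        unfolding \<Phi>_def by (rule seminorm_expansion_le[OF sn2 M])
      also have "\<dots> = (\<Sum>n<N. norm (g1 n x) * p2 k (e2 n))"
        by (rule sum.mono_neutral_right) (auto simp: N)
      also have "\<dots> \<le> (\<Sum>n<N. (C n * p1 l x) * p2 k (e2 n))"
        by (intro sum_mono mult_right_mono C seminorm_nonneg[OF sn2]) auto
      also have "\<dots> = (\<Sum>n<N. C n * p2 k (e2 n)) * p1 l x"
        by (simp add: sum_distrib_right sum_distrib_left mult_ac)
      finally show ?thesis .
    qed
    then show "\<exists>l C. \<forall>x. p2 k (\<Phi> x) \<le> C * p1 l x" by blast
  qed
qed

lemma residual_zeroD:
  assumes "\<forall>n\<ge>N. residual sc e g n x = 0" "\<And>n. Vector_Spaces.linear sc (*) (g n)"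
    "\<And>n m. g n (e m) = (if n = m then 1 else (0 :: 'k::real_normed_field))"
  shows "\<forall>n\<ge>N. g n x = 0" "(\<And>n. g n x = 0) \<Longrightarrow> x = 0"
proof -
  have "g n (residual sc e g n x) = g n x" for n
    by (rule functional_residual_eq[OF assms(2)]) (simp add: assms(3))
  then show "\<forall>n\<ge>N. g n x = 0" using assms(1) by (metis lin_zero[OF assms(2)])
  show "x = 0" if "\<And>n. g n x = 0"
    using residual_fixed[OF linear_space[OF assms(2)], of N g x e] that assms(1) by simp
qed

section \<open>A polynomial model of the orbit span of the shift\<close>

lemma vector_space_smult: "vector_space (smult :: 'k::field \<Rightarrow> 'k poly \<Rightarrow> 'k poly)"
  by unfold_locales (simp_all add: smult_add_right smult_add_left)

text \<open>The span of the orbit of a hypercyclic sequence under the backward shift on \<open>\<omega>\<close> is, as an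
  abstract space, the space of polynomials; a polynomial \<open>f\<close> stands for the sequence with entries
  \<open>orbit_eval a i f\<close>, and the shift acts by multiplication with the variable.\<close>

definition orbit_eval :: "(nat \<Rightarrow> 'k::real_normed_field) \<Rightarrow> nat \<Rightarrow> 'k poly \<Rightarrow> 'k" where
  "orbit_eval a i f = (\<Sum>n\<le>degree f. coeff f n * a (n + i))"

definition orbit_seminorm :: "(nat \<Rightarrow> 'k::real_normed_field) \<Rightarrow> nat \<Rightarrow> 'k poly \<Rightarrow> real" where
  "orbit_seminorm a k f = (\<Sum>i\<le>k. norm (orbit_eval a i f))"

lemma orbit_eval_eq: "degree f \<le> D \<Longrightarrow> orbit_eval a i f = (\<Sum>n\<le>D. coeff f n * a (n + i))"
  unfolding orbit_eval_def by (rule sum.mono_neutral_left) (auto simp: coeff_eq_0)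

lemma linear_orbit_eval: "Vector_Spaces.linear smult (*) (orbit_eval a i)"
proof (rule linear_functionalI[OF vector_space_smult])
  fix f g :: "'a poly" and c
  define D where "D = max (degree f) (degree g)"
  have "degree f \<le> D" "degree g \<le> D" "degree (f + g) \<le> D"
    by (simp_all add: D_def degree_add_le_max)
  then show "orbit_eval a i (f + g) = orbit_eval a i f + orbit_eval a i g"
    by (simp add: orbit_eval_eq algebra_simps sum.distrib)
  show "orbit_eval a i (smult c f) = c * orbit_eval a i f"
    using orbit_eval_eq[of "smult c f" "degree f"] by (simp add: orbit_eval_def sum_distrib_left mult.assoc)
qed

lemma orbit_eval_pCons: "orbit_eval a i (pCons 0 f) = orbit_eval a (Suc i) f"
proof -
  have "orbit_eval a i (pCons 0 f) = (\<Sum>n\<le>Suc (degree f). coeff (pCons 0 f) n * a (n + i))"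
    by (rule orbit_eval_eq) (rule degree_pCons_le)
  also have "\<dots> = (\<Sum>n\<le>degree f. coeff f n * a (Suc n + i))"
    by (subst sum.atMost_Suc_shift) simp
  finally show ?thesis by (simp add: orbit_eval_def)
qed

lemma orbit_eval_monom: "orbit_eval a i (monom 1 n) = a (n + i)"
proof -
  have "orbit_eval a i (monom 1 n) = (\<Sum>m\<le>n. coeff (monom 1 n) m * a (m + i))"
    by (rule orbit_eval_eq) (simp add: degree_monom_le)
  also have "\<dots> = (\<Sum>m\<le>n. if m = n then a (n + i) else 0)" by (intro sum.cong) auto
  finally show ?thesis by simp
qed

lemma seminorm_orbit: "seminorm smult (orbit_seminorm a k)"
  unfolding seminorm_def orbit_seminorm_def
proof (intro conjI allI vector_space_smult)
  show "(\<Sum>i\<le>k. norm (orbit_eval a i (f + g))) \<le> (\<Sum>i\<le>k. norm (orbit_eval a i f)) + (\<Sum>i\<le>k. norm (orbit_eval a i g))" for f g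
    unfolding sum.distrib[symmetric] lin_add[OF linear_orbit_eval] by (intro sum_mono norm_triangle_ineq)
  show "(\<Sum>i\<le>k. norm (orbit_eval a i (smult c f))) = norm c * (\<Sum>i\<le>k. norm (orbit_eval a i f))" for c f
    by (simp add: lin_scale[OF linear_orbit_eval] norm_mult sum_distrib_left)
qed

lemma norm_orbit_eval_le: "i \<le> k \<Longrightarrow> norm (orbit_eval a i f) \<le> orbit_seminorm a k f"
  unfolding orbit_seminorm_def by (intro member_le_sum) auto

lemma orbit_seminorm_pCons: "orbit_seminorm a k (pCons 0 f) \<le> orbit_seminorm a (Suc k) f"
  unfolding orbit_seminorm_def orbit_eval_pCons
  using sum.atMost_Suc_shift[of "\<lambda>i. norm (orbit_eval a i f)" k] by simp

lemma orbit_seminorm_functional: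
  assumes "orbit_seminorm a k f \<noteq> 0"
  shows "\<exists>h. dominated smult (orbit_seminorm a k) h \<and> h f = 1"
proof -
  have "\<exists>i\<le>k. orbit_eval a i f \<noteq> 0"
  proof (rule ccontr)
    assume "\<not> (\<exists>i\<le>k. orbit_eval a i f \<noteq> 0)"
    then have "orbit_seminorm a k f = 0" by (simp add: orbit_seminorm_def)
    then show False using assms by simp
  qed
  then obtain i where i: "i \<le> k" "orbit_eval a i f \<noteq> 0" by blast
  have "dominated smult (orbit_seminorm a k) (orbit_eval a i)"
    using norm_orbit_eval_le[OF i(1), of a] linear_orbit_eval[of a i] unfolding dominated_def
    by (intro conjI exI[of _ 1]) simp_all
  then show ?thesis using dominated_normalize i(2) by blast
qed

lemma finite_rank_orbit: "finite_rank smult (orbit_seminorm a k)"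
  using finite_rank_functionals[OF vector_space_smult, of "{..k}" "orbit_eval a"] linear_orbit_eval
  by (auto simp: finite_rank_def orbit_seminorm_def sum_nonneg_eq_0_iff)

lemma span_monom: "module.span smult (range (monom 1)) = (UNIV :: 'k::field poly set)"
proof -
  interpret vector_space "smult :: 'k \<Rightarrow> 'k poly \<Rightarrow> 'k poly" by (rule vector_space_smult)
  have "f \<in> span (range (monom 1))" for f :: "'k poly"
  proof -
    have "(\<Sum>i\<le>degree f. smult (coeff f i) (monom 1 i)) \<in> span (range (monom 1))"
      by (intro span_sum span_scale span_base) auto
    then show ?thesis by (simp add: smult_monom poly_as_sum_of_monoms)
  qed
  then show ?thesis by auto
qed

lemma poly_not_finitely_generated:
  assumes "finite F" shows "module.span smult F \<noteq> (UNIV :: 'k::field poly set)"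
proof
  interpret vector_space "smult :: 'k \<Rightarrow> 'k poly \<Rightarrow> 'k poly" by (rule vector_space_smult)
  assume "span F = UNIV"
  moreover have "span F \<subseteq> {f. degree f \<le> Max (insert 0 (degree ` F))}"
    using assms
    by (intro span_minimal subspaceI) (auto intro: degree_add_le degree_smult_le[THEN order_trans])
  ultimately have "degree (monom (1::'k) (Suc (Max (insert 0 (degree ` F))))) \<le> Max (insert 0 (degree ` F))"
    by blast
  then show False by (simp add: degree_monom_eq)
qed

theorem hypercyclic_of_finite_rank:
  fixes sc :: "'k::{real_normed_field, second_countable_topology} \<Rightarrow> 'a::{ab_group_add, t2_space} \<Rightarrow> 'a"
    and b :: "nat \<Rightarrow> 'a"
  assumes fs: "fundamental_seminorms sc p"
    and hb: "\<And>k x. p k x \<noteq> 0 \<Longrightarrow> \<exists>f. dominated sc (p k) f \<and> f x = 1"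
    and fr: "\<And>k. finite_rank sc (p k)" and b: "module.span sc (range b) = UNIV"
    and inf: "\<And>F. finite F \<Longrightarrow> module.span sc F \<noteq> UNIV"
  shows "\<exists>T. hypercyclic sc T"
proof -
  have sn: "seminorm sc (p k)" and mono: "mono (\<lambda>k. p k x)" for k x
    using fs by (auto simp: fundamental_seminorms_def)
  obtain a :: "nat \<Rightarrow> 'k" where "\<forall>m c. \<forall>e>0. \<exists>n. \<forall>i<m. dist (a (n + i)) (c i) < e"
    using hypercyclic_sequence_exists by (rule exE)
  then have a: "\<And>m c e. e > 0 \<Longrightarrow> \<exists>n. \<forall>i<m. dist (a (n + i)) (c i) < e" by blast
  define r where "r = orbit_seminorm a"
  have snr: "seminorm smult (r k)" for k unfolding r_def by (rule seminorm_orbit)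
  have mono_r: "mono (\<lambda>k. r k f)" for f
    unfolding r_def orbit_seminorm_def by (intro monoI sum_mono2) auto
  \<comment> \<open>At a suitable shift the sequence \<open>a\<close> is close to the unit vector at
    the degree of \<open>f\<close>, so \<open>orbit_eval\<close> there nearly equals the leading
    coefficient. This is the linear independence of the orbit.\<close>
  have sep_r: "\<exists>k. r k f \<noteq> 0" if f: "f \<noteq> 0" for f
  proof -
    define D where "D = degree f"
    \<comment> \<open>The extra 1 makes the accumulated error strictly smaller than the leading
      coefficient.\<close>
    define K where "K = 1 + (\<Sum>n\<le>D. norm (coeff f n))"
    have K: "K > 0" unfolding K_def by (intro add_pos_nonneg sum_nonneg) auto
    have lead: "coeff f D \<noteq> 0" using f by (simp add: D_def)
    then have "norm (coeff f D) / K > 0" using K by simp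
    then obtain i where i: "\<And>n. n < Suc D \<Longrightarrow> dist (a (i + n)) (if n = D then 1 else 0) < norm (coeff f D) / K"
      using a[of "norm (coeff f D) / K" "Suc D" "\<lambda>n. if n = D then 1 else 0"] by blast
    have "orbit_eval a i f - coeff f D = (\<Sum>n\<le>D. coeff f n * (a (n + i) - (if n = D then 1 else 0)))"
    proof -
      have "(\<Sum>n\<le>D. coeff f n * (if n = D then 1 else 0)) = (\<Sum>n\<le>D. if n = D then coeff f D else 0)"
        by (intro sum.cong) auto
      then have "(\<Sum>n\<le>D. coeff f n * (if n = D then 1 else 0)) = coeff f D" by simp
      then show ?thesis by (simp only: orbit_eval_def D_def[symmetric] right_diff_distrib sum_subtractf)
    qed
    also have "norm \<dots> \<le> (\<Sum>n\<le>D. norm (coeff f n) * (norm (coeff f D) / K))"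
    proof (rule sum_norm_le)
      fix n assume "n \<in> {..D}"
      then have "norm (a (n + i) - (if n = D then 1 else 0)) \<le> norm (coeff f D) / K"
        using i[of n] by (simp add: dist_norm add.commute)
      then show "norm (coeff f n * (a (n + i) - (if n = D then 1 else 0))) \<le> norm (coeff f n) * (norm (coeff f D) / K)"
        unfolding norm_mult by (intro mult_left_mono) auto
    qed
    also have "\<dots> = (K - 1) * (norm (coeff f D) / K)" unfolding sum_distrib_right[symmetric] by (simp add: K_def)
    also have "\<dots> < K * (norm (coeff f D) / K)" using K lead by (intro mult_strict_right_mono) auto
    also have "\<dots> = norm (coeff f D)" using K by simp
    finally have "orbit_eval a i f \<noteq> 0" by auto
    then show ?thesis using norm_orbit_eval_le[of i i a f] by (intro exI[of _ i]) (auto simp: r_def)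
  qed
  show ?thesis
  proof (rule biorthogonal_basis_exists[where p = p and b = b,
      OF sn mono fundamental_seminorms_separate[OF fs] hb fr b inf], assumption, assumption, assumption)
    fix e g
    assume dom: "\<And>n. \<exists>k. dominated sc (p k) (g n)"
      and orth: "\<And>n m. g n (e m) = (if n = m then 1 else 0)"
      and res: "\<And>x. \<exists>N. \<forall>n\<ge>N. residual sc e g n x = 0" and small: "\<And>k. \<exists>N. \<forall>n\<ge>N. p k (e n) = 0"
    show ?thesis
    proof (rule biorthogonal_basis_exists[where p = r and b = "monom 1",
        OF snr mono_r sep_r _ _ span_monom poly_not_finitely_generated], assumption)
      show "\<exists>h. dominated smult (r k) h \<and> h f = 1" if "r k f \<noteq> 0" for k f
        using that unfolding r_def by (rule orbit_seminorm_functional)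
      show "finite_rank smult (r k)" for k unfolding r_def by (rule finite_rank_orbit)
    next
      fix e' g'
      assume dom': "\<And>n. \<exists>k. dominated smult (r k) (g' n)"
        and orth': "\<And>n m. g' n (e' m) = (if n = m then 1 else 0)"
        and res': "\<And>x. \<exists>N. \<forall>n\<ge>N. residual smult e' g' n x = 0" and small': "\<And>k. \<exists>N. \<forall>n\<ge>N. r k (e' n) = 0"
      have gl: "Vector_Spaces.linear sc (*) (g n)" for n using dom dominated_linear by blast
      have gl': "Vector_Spaces.linear smult (*) (g' n)" for n using dom' dominated_linear by blast
      have fin: "\<exists>N. \<forall>n\<ge>N. g n x = 0" for x using res[of x] residual_zeroD(1)[OF _ gl orth] by metis
      have fin': "\<exists>N. \<forall>n\<ge>N. g' n x = 0" for x using res'[of x] residual_zeroD(1)[OF _ gl' orth'] by metis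
      have inj: "x = y" if "\<And>n. g n x = g n y" for x y
        using res[of "x - y"] residual_zeroD(2)[OF _ gl orth, of _ "x - y"] that by (auto simp: lin_diff[OF gl])
      have inj': "x = y" if "\<And>n. g' n x = g' n y" for x y
        using res'[of "x - y"] residual_zeroD(2)[OF _ gl' orth', of _ "x - y"] that by (auto simp: lin_diff[OF gl'])
      obtain \<Phi> where \<Phi>: "Vector_Spaces.linear smult sc \<Phi>" "\<And>n f. g n (\<Phi> f) = g' n f"
        "\<And>k. \<exists>l C. \<forall>f. p k (\<Phi> f) \<le> C * r l f"
        by (rule expansion_map_exists[OF snr mono_r sn dom' fin' gl orth small]) (rule that)
      obtain \<Psi> where \<Psi>: "Vector_Spaces.linear sc smult \<Psi>" "\<And>n x. g' n (\<Psi> x) = g n x"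
        "\<And>k. \<exists>l C. \<forall>x. r k (\<Psi> x) \<le> C * p l x"
        by (rule expansion_map_exists[OF sn mono snr dom fin gl' orth' small']) (rule that)
      have \<Psi>\<Phi>: "\<Psi> (\<Phi> f) = f" for f by (rule inj') (simp add: \<Phi> \<Psi>)
      have \<Phi>\<Psi>: "\<Phi> (\<Psi> x) = x" for x by (rule inj) (simp add: \<Phi> \<Psi>)
      define T where "T x = \<Phi> (pCons 0 (\<Psi> x))" for x
      \<comment> \<open>The polynomial 1 stands for \<open>a\<close> itself, so its orbit consists
        of the monomials, and \<open>monom 1 n\<close> stands for the sequence shifted by
        \<open>n\<close>.\<close>
      have Tn: "(T ^^ n) (\<Phi> 1) = \<Phi> (monom 1 n)" for n
        by (induction n) (simp_all add: T_def \<Psi>\<Phi> monom_Suc monom_0 one_pCons)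
      have "hypercyclic sc T"
      proof (rule hypercyclicI[OF fs, where x = "\<Phi> 1"])
        show "Vector_Spaces.linear sc sc T"
          using seminorm_space[OF sn]
          by (simp add: Vector_Spaces.linear_iff T_def lin_add[OF \<Psi>(1)] lin_scale[OF \<Psi>(1)]
              flip: lin_add[OF \<Phi>(1)] lin_scale[OF \<Phi>(1)])
        fix k
        obtain l C where C: "\<And>f. p k (\<Phi> f) \<le> C * r l f" using \<Phi>(3) by blast
        then have C': "p k (\<Phi> f) \<le> \<bar>C\<bar> * r l f" for f
          using mult_right_mono[of C "\<bar>C\<bar>" "r l f"] seminorm_nonneg[OF snr, of l f] order_trans[OF C] by simp
        show "\<exists>l C. \<forall>x. p k (T x) \<le> C * p l x"
        proof -
          obtain m D where D: "\<And>x. r (Suc l) (\<Psi> x) \<le> D * p m x" using \<Psi>(3) by blast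
          have "p k (T x) \<le> (\<bar>C\<bar> * D) * p m x" for x
          proof -
            have "p k (T x) \<le> \<bar>C\<bar> * r l (pCons 0 (\<Psi> x))" unfolding T_def by (rule C')
            also have "\<dots> \<le> \<bar>C\<bar> * r (Suc l) (\<Psi> x)" unfolding r_def by (intro mult_left_mono orbit_seminorm_pCons) auto
            also have "\<dots> \<le> \<bar>C\<bar> * (D * p m x)" by (intro mult_left_mono D) auto
            finally show ?thesis by simp
          qed
          then show ?thesis by blast
        qed
        fix d :: real and z assume d: "d > 0"
        \<comment> \<open>\<open>r l\<close> adds up \<open>l + 1\<close> entries, and
          \<open>\<bar>C\<bar> + 1\<close> is a positive substitute for the continuity constant of
          \<Phi>.\<close>
        define \<epsilon> where "\<epsilon> = d / ((\<bar>C\<bar> + 1) * (real l + 1))"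
        have "\<epsilon> > 0" using d by (simp add: \<epsilon>_def)
        then obtain n where n: "\<And>i. i < Suc l \<Longrightarrow> dist (a (n + i)) (orbit_eval a i (\<Psi> z)) < \<epsilon>"
          using a[of \<epsilon> "Suc l" "\<lambda>i. orbit_eval a i (\<Psi> z)"] by blast
        have "r l (monom 1 n - \<Psi> z) = (\<Sum>i\<le>l. dist (a (n + i)) (orbit_eval a i (\<Psi> z)))"
          by (simp add: r_def orbit_seminorm_def lin_diff[OF linear_orbit_eval] orbit_eval_monom dist_norm)
        also have "\<dots> < (\<Sum>i\<le>l. \<epsilon>)" using n by (intro sum_strict_mono) auto
        also have "\<dots> = d / (\<bar>C\<bar> + 1)"
        proof -
          have "real l + 1 \<noteq> 0" "\<bar>C\<bar> + 1 \<noteq> 0" by linarith+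
          then show ?thesis by (simp add: \<epsilon>_def divide_simps add.commute)
        qed
        finally have rl: "r l (monom 1 n - \<Psi> z) < d / (\<bar>C\<bar> + 1)" .
        have "p k ((T ^^ n) (\<Phi> 1) - z) = p k (\<Phi> (monom 1 n - \<Psi> z))"
          by (simp add: Tn lin_diff[OF \<Phi>(1)] \<Phi>\<Psi>)
        also have "\<dots> \<le> \<bar>C\<bar> * r l (monom 1 n - \<Psi> z)" by (rule C')
        also have "\<dots> \<le> (\<bar>C\<bar> + 1) * r l (monom 1 n - \<Psi> z)"
          by (intro mult_right_mono seminorm_nonneg[OF snr]) auto
        also have "\<dots> < d" using rl by (simp add: field_simps)
        finally show "\<exists>n. p k ((T ^^ n) (\<Phi> 1) - z) < d" by blast
      qed
      then show ?thesis by blast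
    qed
  qed
qed

text \<open>The Hahn-Banach property enters as the hypothesis \<open>hb\<close>, so that the real
  and complex cases share the rest of the argument.\<close>

theorem hypercyclic_operator_exists:
  fixes sc :: "'k::{real_normed_field, banach, second_countable_topology} \<Rightarrow> 'a::{ab_group_add, t2_space} \<Rightarrow> 'a"
  assumes hb: "\<And>p x. seminorm sc p \<Longrightarrow> p x \<noteq> 0 \<Longrightarrow> \<exists>f. dominated sc p f \<and> f x = 1"
    and lc: "locally_convex sc" and met: "metrizable_space (euclidean :: 'a topology)"
    and cd: "countably_dimensional sc"
  shows "\<exists>T. hypercyclic sc T"
proof -
  have tvs: "is_tvs sc" using lc by (simp add: locally_convex_def)
  interpret vector_space sc using tvs by (simp add: is_tvs_def)
  obtain p where p: "fundamental_seminorms sc p" by (rule fundamental_seminorms_exist[OF tvs lc met])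
  then have sn: "seminorm sc (p k)" for k by (simp add: fundamental_seminorms_def)
  obtain B where B: "countable B" "infinite B" "independent B" "span B = UNIV"
    using cd by (auto simp: countably_dimensional_def)
  have "B \<noteq> {}" using B(2) by auto
  then have range: "span (range (from_nat_into B)) = UNIV" using B(1,4) by simp
  show ?thesis
  proof (cases "\<forall>k. finite_rank sc (p k)")
    case True
    have "span F \<noteq> UNIV" if "finite F" for F
      using independent_span_bound[OF that B(3)] B(2) by auto
    then show ?thesis using True by (intro hypercyclic_of_finite_rank[OF p _ _ range] hb sn) auto
  next
    case False
    then obtain K where "\<not> finite_rank sc (p K)" by blast
    then show ?thesis by (intro hypercyclic_of_infinite_rank[OF p hb[OF sn] _ range])
  qed
qed

theorem theorem1p4:
  shows "(\<forall>sc :: real \<Rightarrow> 'a::{ab_group_add,t2_space} \<Rightarrow> 'a.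
            locally_convex sc \<and> metrizable_space (euclidean :: 'a topology) \<and>
            countably_dimensional sc \<longrightarrow> (\<exists>T. hypercyclic sc T))
       \<and> (\<forall>sc :: complex \<Rightarrow> 'a \<Rightarrow> 'a.
            locally_convex sc \<and> metrizable_space (euclidean :: 'a topology) \<and>
            countably_dimensional sc \<longrightarrow> (\<exists>T. hypercyclic sc T))"
proof (intro conjI allI impI; elim conjE)
  show "\<exists>T. hypercyclic sc T"
    if "locally_convex sc" "metrizable_space (euclidean :: 'a topology)" "countably_dimensional sc"
    for sc :: "real \<Rightarrow> 'a \<Rightarrow> 'a"
    using hypercyclic_operator_exists[OF hahn_banach_functional_real that] .
  show "\<exists>T. hypercyclic sc T"
    if "locally_convex sc" "metrizable_space (euclidean :: 'a topology)" "countably_dimensional sc"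
    for sc :: "complex \<Rightarrow> 'a \<Rightarrow> 'a"
    using hypercyclic_operator_exists[OF hahn_banach_functional_complex that] .
qed

end
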